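(* (a) Let $\mathcal P\in\mathscr P_3$ (so $N=3$) satisfy $$\int_{\overline{P_iM_i}} v_{\mathcal P}(x)\,|x-M_i|\,\mathrm d\mathcal H^1(x)=\int_{\overline{P_{i+1}M_i}} v_{\mathcal P}(x)\,|x-M_i|\,\mathrm d\mathcal H^1(x)\qquad\text{for all } i\in\{1,\dots,N\}. \tag{T}$$ Then $\mathcal P$ is an equilateral triangle. (b) Let $\mathcal P\in\mathscr P_4$ (so $N=4$) satisfy (T) and also $$\frac1{\ell_i}\int_{\overline{P_iP_{i+1}}} v_{\mathcal P}(x)\,\mathrm d\mathcal H^1(x)=\frac1{\ell_j}\int_{\overline{P_jP_{j+1}}} v_{\mathcal P}(x)\,\mathrm d\mathcal H^1(x)\qquad\text{for all } i,j\in\{1,\dots,N\}.$$ Then $\mathcal P$ is a square.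
   Context: For $N\ge 3$, $\mathscr P_N$ denotes the class of all (not necessarily convex) polygons in $\mathbb R^2$ with $N$ sides; a polygon is identified with the bounded planar region enclosed by its boundary, a simple closed polygonal line, and no interior angle equals $\pi$. A polygon $\mathcal P\in\mathscr P_N$ has consecutive vertices $P_1,\dots,P_N$, with $P_0=P_N$ and $P_{N+1}=P_1$. For points $P,Q\in\mathbb R^2$, $\overline{PQ}$ is the segment joining them. $\ell_i$ is the length of the side $\overline{P_iP_{i+1}}$ and $M_i$ is its midpoint. $\mathcal H^1$ is one-dimensional Hausdorff measure. The kernel $K:(0,\infty)\to\mathbb R$ satisfies: $K\in C^1((0,\infty))$ and $K\ge 0$; $K$ is strictly decreasing; $\int_0^1 K(r)\,r\,\mathrm dr<\infty$. The potential of $\mathcal P$ is $v_{\mathcal P}(x)=\int_{\mathcal P}K(|x-y|)\,\mathrm dy$. *)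

theory Defs
  imports "HOL-Analysis.Analysis"
begin

section \<open>One-dimensional Hausdorff measure\<close>

text \<open>
  The infimum is over countable covers by sets of diameter at most \<open>\<delta>\<close>. Boundedness is required
  explicitly because \<^const>\<open>diameter\<close> is real-valued and unspecified on unbounded sets. If there
  is no such cover, the infimum is \<open>\<infinity>\<close>.
\<close>

definition hausdorff1_pre :: "real \<Rightarrow> 'a::metric_space set \<Rightarrow> ennreal" where
  "hausdorff1_pre \<delta> A =
     (INF C \<in> {C :: nat \<Rightarrow> 'a set. A \<subseteq> (\<Union>n. C n) \<and> (\<forall>n. bounded (C n) \<and> diameter (C n) \<le> \<delta>)}.
        \<Sum>n. ennreal (diameter (C n)))"

definition hausdorff1_outer :: "'a::metric_space set \<Rightarrow> ennreal" where
  "hausdorff1_outer A = (SUP \<delta> \<in> {0<..}. hausdorff1_pre \<delta> A)"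

definition hausdorff1 :: "'a::metric_space measure" where
  "hausdorff1 = measure_of UNIV (sets borel) hausdorff1_outer"


section \<open>Polygons\<close>

text \<open>
  The vertices of an \<open>N\<close>-gon are \<open>P 1, \<dots>, P N\<close>, with the cyclic convention \<open>P 0 = P N\<close> and
  \<open>P (N + 1) = P 1\<close>; the values of \<open>P\<close> at other indices play no role.
  The path \<open>polyline P n\<close> runs through \<open>P 1, P 2, \<dots>, P (n + 2)\<close>, so it has \<open>n + 1\<close> sides; it
  starts with a side rather than a point because a constant piece would never be a simple path.
\<close>

primrec polyline :: "(nat \<Rightarrow> 'a::real_normed_vector) \<Rightarrow> nat \<Rightarrow> real \<Rightarrow> 'a" where
  "polyline P 0 = linepath (P 1) (P 2)"
| "polyline P (Suc n) = polyline P n +++ linepath (P (n + 2)) (P (n + 3))"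

definition boundary_path :: "nat \<Rightarrow> (nat \<Rightarrow> real^2) \<Rightarrow> real \<Rightarrow> real^2" where
  "boundary_path N P = polyline P (N - 1)"

definition region :: "nat \<Rightarrow> (nat \<Rightarrow> real^2) \<Rightarrow> (real^2) set" where
  "region N P = inside (path_image (boundary_path N P))"

text \<open>
  The unoriented angle at \<open>B\<close> between the rays towards \<open>A\<close> and \<open>C\<close>, in \<open>[0, \<pi>]\<close>. The interior angle
  \<open>\<theta>\<close> of a simple polygon at a vertex is either this angle or \<open>2\<pi>\<close> minus it; in both cases
  \<open>\<theta> = \<pi>\<close> iff the unoriented angle is \<open>\<pi>\<close>.
\<close>

definition corner_angle :: "real^2 \<Rightarrow> real^2 \<Rightarrow> real^2 \<Rightarrow> real" where
  "corner_angle A B C = arccos (((A - B) \<bullet> (C - B)) / (norm (A - B) * norm (C - B)))"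

definition is_polygon :: "nat \<Rightarrow> (nat \<Rightarrow> real^2) \<Rightarrow> bool" where
  "is_polygon N P \<longleftrightarrow>
     3 \<le> N \<and> P 0 = P N \<and> P (N + 1) = P 1 \<and>
     simple_path (boundary_path N P) \<and>
     (\<forall>i\<in>{1..N}. corner_angle (P (i - 1)) (P i) (P (i + 1)) \<noteq> pi)"

definition side_length :: "(nat \<Rightarrow> real^2) \<Rightarrow> nat \<Rightarrow> real" where
  "side_length P i = dist (P i) (P (i + 1))"

definition side_midpoint :: "(nat \<Rightarrow> real^2) \<Rightarrow> nat \<Rightarrow> real^2" where
  "side_midpoint P i = midpoint (P i) (P (i + 1))"

definition is_equilateral_triangle :: "(nat \<Rightarrow> real^2) \<Rightarrow> bool" where
  "is_equilateral_triangle P \<longleftrightarrow>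
     is_polygon 3 P \<and> (\<forall>i\<in>{1..3}. \<forall>j\<in>{1..3}. side_length P i = side_length P j)"

text \<open>
  With four equal sides, unoriented right angles already exclude interior angles \<open>3\<pi>/2\<close>.
\<close>

definition is_square :: "(nat \<Rightarrow> real^2) \<Rightarrow> bool" where
  "is_square P \<longleftrightarrow>
     is_polygon 4 P \<and>
     (\<forall>i\<in>{1..4}. \<forall>j\<in>{1..4}. side_length P i = side_length P j) \<and>
     (\<forall>i\<in>{1..4}. corner_angle (P (i - 1)) (P i) (P (i + 1)) = pi / 2)"


section \<open>Kernel, potential and the two conditions\<close>

text \<open>
  A kernel is a function on \<open>(0, \<infinity>)\<close>: its values on \<open>(-\<infinity>, 0]\<close> are arbitrary. In the potential only
  \<open>K 0\<close> is ever evaluated besides, on a null set.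
\<close>

definition is_kernel :: "(real \<Rightarrow> real) \<Rightarrow> bool" where
  "is_kernel K \<longleftrightarrow>
     K C1_differentiable_on {0<..} \<and>
     (\<forall>r>0. 0 \<le> K r) \<and>
     strict_antimono_on {0<..} K \<and>
     set_integrable lborel {0<..<1} (\<lambda>r. K r * r)"

definition potential :: "(real \<Rightarrow> real) \<Rightarrow> nat \<Rightarrow> (nat \<Rightarrow> real^2) \<Rightarrow> real^2 \<Rightarrow> real" where
  "potential K N P x = (LINT y : region N P | lborel. K (dist x y))"

definition balanced_moments :: "(real \<Rightarrow> real) \<Rightarrow> nat \<Rightarrow> (nat \<Rightarrow> real^2) \<Rightarrow> bool" where
  "balanced_moments K N P \<longleftrightarrow>
     (\<forall>i\<in>{1..N}.
        (LINT x : closed_segment (P i) (side_midpoint P i) | hausdorff1.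
           potential K N P x * dist x (side_midpoint P i)) =
        (LINT x : closed_segment (P (i + 1)) (side_midpoint P i) | hausdorff1.
           potential K N P x * dist x (side_midpoint P i)))"

definition equal_side_averages :: "(real \<Rightarrow> real) \<Rightarrow> nat \<Rightarrow> (nat \<Rightarrow> real^2) \<Rightarrow> bool" where
  "equal_side_averages K N P \<longleftrightarrow>
     (\<forall>i\<in>{1..N}. \<forall>j\<in>{1..N}.
        1 / side_length P i *
          (LINT x : closed_segment (P i) (P (i + 1)) | hausdorff1. potential K N P x) =
        1 / side_length P j *
          (LINT x : closed_segment (P j) (P (j + 1)) | hausdorff1. potential K N P x))"

end

theory Submission
  imports Defs
begin

text \<open>
  Both boundary conditions concern the potential \<open>v\<close> on the sides only, and both are exploited by
  cutting the region into intervals parallel to a fixed line. Let two points on such a line have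
  midpoint \<open>x0\<close>, and let a slice of the region at another height have its centre to the right of
  \<open>x0\<close>. As the kernel decreases with the distance, the slice attracts the right point more than the
  left one: a reflection in the perpendicular bisector of the two points cancels everything
  except a part of one sign. This is \<open>slice_gap_neg\<close>; the difference of the two values of
  \<open>v\<close> is the integral of these slice contributions.

  Triangles. The slices parallel to a side are centred on the median. If the triangle is not
  isosceles over that side, then all centres lie strictly on one side of the perpendicular bisector,
  \<open>v\<close> is larger on that half of the side at every pair of mirror points, and the two weighted
  integrals in the balance condition differ. So the triangle is isosceles over each side. The
  argument holds for every trapezoid (\<open>trapezoid_moment_pos\<close>), with the triangle as the case of a
  degenerate top side.

  Quadrilaterals. Balance and equal averages together say that on each side, in either direction of
  travel, the integral of \<open>t * v\<close> over the affine parameter \<open>t\<close> has the same value. A simple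
  quadrilateral \<open>ABCD\<close> has a diagonal, say \<open>AC\<close>, that separates the other two vertices, whether
  or not it is convex. Its slices parallel to \<open>AC\<close> are intervals with centre \<open>c s\<close> and half-width
  \<open>w s\<close> at height \<open>s\<close>, where abscissas are measured from the midpoint of \<open>AC\<close>; so \<open>c\<close> is linear on
  each side of \<open>AC\<close> and \<open>c 0 = 0\<close>. The equality of the four side integrals gives
  \<open>\<integral> c s * (v s (c s + w s) - v s (c s - w s)) ds = 0\<close>, which is, up to a factor, the
  first variation of the interaction energy when \<open>B\<close> and \<open>D\<close> slide parallel to \<open>AC\<close> with velocities
  proportional to their abscissas. The difference in the
  integrand is itself an integral over slices \<open>t\<close> of a quantity \<open>J s t\<close> that is antisymmetric
  in \<open>(s, t)\<close> and has the sign opposite to \<open>c s - c t\<close>. Hence the expression is half of the double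
  integral of \<open>(c s - c t) * J s t\<close>, which is negative unless \<open>c\<close> vanishes identically
  (\<open>slice_centers_not_injective\<close>), as in the proof that Steiner symmetrization increases the energy.
  So \<open>B\<close> and \<open>D\<close> lie on the bisector of \<open>AC\<close> (\<open>separating_diagonal_bisected\<close>). Then \<open>BD\<close> separates
  \<open>A\<close> and \<open>C\<close>, the same argument applies to it, and all sides are equal. A rhombus is a trapezoid, and
  the first argument, applied to one side of it, gives a right angle.

  Two analytic facts support this. The Hausdorff measure has to be identified with arc length on
  segments: it is a Borel measure by the Caratheodory criterion, it is at least arc length on
  Borel sets and at most arc length on the whole segment. And the kernel has to be locally integrable in the plane;
  since it decreases, it may be compared with its value at the larger coordinate, which reduces the
  claim to the integrability of \<open>K r * r\<close>.
\<close>

section \<open>One-dimensional Hausdorff measure as a Borel measure\<close>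

lemma hausdorff1_pre_antimono: "d \<le> e \<Longrightarrow> hausdorff1_pre e A \<le> hausdorff1_pre d A"
  unfolding hausdorff1_pre_def by (rule INF_superset_mono) (auto intro: order_trans)

lemma hausdorff1_pre_mono: "A \<subseteq> B \<Longrightarrow> hausdorff1_pre d A \<le> hausdorff1_pre d B"
  unfolding hausdorff1_pre_def by (rule INF_superset_mono) auto

lemma hausdorff1_pre_le_outer: "0 < d \<Longrightarrow> hausdorff1_pre d A \<le> hausdorff1_outer A"
  unfolding hausdorff1_outer_def by (rule SUP_upper) simp

lemma hausdorff1_outer_mono: "A \<subseteq> B \<Longrightarrow> hausdorff1_outer A \<le> hausdorff1_outer B"
  unfolding hausdorff1_outer_def by (intro SUP_mono') (rule hausdorff1_pre_mono)

lemma hausdorff1_outer_empty: "hausdorff1_outer ({} :: 'a::metric_space set) = 0"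
proof -
  have "hausdorff1_pre d ({} :: 'a set) \<le> 0" if "0 < d" for d
  proof -
    have "hausdorff1_pre d ({} :: 'a set) \<le> (\<Sum>n::nat. ennreal (diameter ({}::'a set)))"
      unfolding hausdorff1_pre_def using that by (intro INF_lower) auto
    then show ?thesis by simp
  qed
  then show ?thesis unfolding hausdorff1_outer_def by (auto intro!: antisym SUP_least)
qed

lemma hausdorff1_pre_countably_subadditive:
  fixes A :: "nat \<Rightarrow> 'a::metric_space set"
  shows "hausdorff1_pre d (\<Union>i. A i) \<le> (\<Sum>i. hausdorff1_pre d (A i))"
proof (rule ennreal_le_epsilon)
  fix e :: real assume fin: "(\<Sum>i. hausdorff1_pre d (A i)) < top" and e: "0 < e"
  have "\<exists>C. A i \<subseteq> (\<Union>n. C n) \<and> (\<forall>n. bounded (C n) \<and> diameter (C n) \<le> d) \<and>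
      (\<Sum>n. ennreal (diameter (C n))) \<le> hausdorff1_pre d (A i) + ennreal (e * (1/2)^Suc i)" for i
  proof -
    have "hausdorff1_pre d (A i) < top"
      using fin ennreal_suminf_lessD by blast
    then have "hausdorff1_pre d (A i) < hausdorff1_pre d (A i) + ennreal (e * (1/2)^Suc i)"
      using e by (cases "hausdorff1_pre d (A i)") (auto simp: ennreal_plus[symmetric] ennreal_less_iff simp del: ennreal_plus)
    then obtain C where "A i \<subseteq> (\<Union>n. C n)" "\<forall>n. bounded (C n) \<and> diameter (C n) \<le> d"
        "(\<Sum>n. ennreal (diameter (C n))) < hausdorff1_pre d (A i) + ennreal (e * (1/2)^Suc i)"
      unfolding hausdorff1_pre_def[of d "A i"] INF_less_iff by auto
    then show ?thesis by (auto intro: less_imp_le)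
  qed
  then obtain C where C: "\<And>i. A i \<subseteq> (\<Union>n. C i n)"
      "\<And>i n. bounded (C i n)" "\<And>i n. diameter (C i n) \<le> d"
      "\<And>i. (\<Sum>n. ennreal (diameter (C i n))) \<le> hausdorff1_pre d (A i) + ennreal (e * (1/2)^Suc i)"
    by metis
  define D where "D k = (case prod_decode k of (i, n) \<Rightarrow> C i n)" for k
  have "hausdorff1_pre d (\<Union>i. A i) \<le> (\<Sum>k. ennreal (diameter (D k)))"
    unfolding hausdorff1_pre_def
  proof (intro INF_lower CollectI conjI allI)
    show "(\<Union>i. A i) \<subseteq> (\<Union>k. D k)"
    proof safe
      fix x i assume "x \<in> A i"
      then obtain n where "x \<in> C i n" using C(1) by blast
      then show "x \<in> (\<Union>k. D k)" by (intro UN_I[of "prod_encode (i, n)"]) (auto simp: D_def)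
    qed
  qed (auto simp: D_def C(2,3) split: prod.split)
  also have "\<dots> = (\<Sum>k. (case prod_decode k of (i, n) \<Rightarrow> ennreal (diameter (C i n))))"
    by (simp add: D_def split_def)
  also have "\<dots> = (\<Sum>i. \<Sum>n. ennreal (diameter (C i n)))"
    by (rule suminf_ennreal_2dimen) simp
  also have "\<dots> \<le> (\<Sum>i. hausdorff1_pre d (A i) + ennreal (e * (1/2)^Suc i))"
    by (intro suminf_le C(4)) auto
  also have "\<dots> = (\<Sum>i. hausdorff1_pre d (A i)) + (\<Sum>i. ennreal (e * (1/2)^Suc i))"
    by (intro suminf_add[symmetric]) auto
  also have "(\<Sum>i. ennreal (e * (1/2)^Suc i)) = ennreal e"
  proof -
    have "(\<lambda>i. e * (1/2)^Suc i) sums (e * 1)"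
      by (intro sums_mult power_half_series)
    then show ?thesis using e by (intro suminf_ennreal_eq) auto
  qed
  finally show "hausdorff1_pre d (\<Union>i. A i) \<le> (\<Sum>i. hausdorff1_pre d (A i)) + ennreal e" .
qed

lemma hausdorff1_outer_countably_subadditive:
  "hausdorff1_outer (\<Union>i. A i) \<le> (\<Sum>i. hausdorff1_outer (A i))"
proof (subst hausdorff1_outer_def, rule SUP_least)
  fix d :: real assume "d \<in> {0<..}"
  then have "(\<Sum>i. hausdorff1_pre d (A i)) \<le> (\<Sum>i. hausdorff1_outer (A i))"
    by (intro suminf_le hausdorff1_pre_le_outer) auto
  with hausdorff1_pre_countably_subadditive
  show "hausdorff1_pre d (\<Union>i. A i) \<le> (\<Sum>i. hausdorff1_outer (A i))" by (rule order_trans)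
qed

lemma outer_measure_space_hausdorff1: "outer_measure_space (Pow UNIV) hausdorff1_outer"
  unfolding outer_measure_space_def positive_def increasing_def countably_subadditive_def
  by (auto intro: hausdorff1_outer_mono hausdorff1_outer_countably_subadditive hausdorff1_outer_empty)

lemma hausdorff1_outer_Un: "hausdorff1_outer (A \<union> B) \<le> hausdorff1_outer A + hausdorff1_outer B"
proof -
  have "hausdorff1_outer (\<Union>i::nat. binaryset A B i) \<le> (\<Sum>i. hausdorff1_outer (binaryset A B i))"
    by (rule hausdorff1_outer_countably_subadditive)
  then show ?thesis
    by (simp add: UN_binaryset_eq suminf_binaryset_eq[where f=hausdorff1_outer] hausdorff1_outer_empty)
qed

text \<open>
  Only covers of mesh below the distance \<open>e\<close> matter; none of their members meets both sets, so
  such a cover splits into a cover of each.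
\<close>

lemma hausdorff1_outer_separated:
  assumes e: "0 < e" and sep: "\<And>x y. x \<in> A \<Longrightarrow> y \<in> B \<Longrightarrow> e \<le> dist x y"
  shows "hausdorff1_outer A + hausdorff1_outer B \<le> hausdorff1_outer (A \<union> B)"
proof -
  have *: "hausdorff1_pre d A + hausdorff1_pre d' B \<le> hausdorff1_outer (A \<union> B)" if d: "0 < d" "0 < d'" for d d'
  proof -
    define r where "r = min (min d d') (e/2)"
    have r: "0 < r" "r \<le> d" "r \<le> d'" "r < e" using d e by (auto simp: r_def)
    have "hausdorff1_pre r A + hausdorff1_pre r B \<le> hausdorff1_pre r (A \<union> B)"
      unfolding hausdorff1_pre_def[of r "A \<union> B"]
    proof (rule INF_greatest, clarify)
      fix C :: "nat \<Rightarrow> 'a set"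
      assume cov: "A \<union> B \<subseteq> (\<Union>n. C n)" and C: "\<forall>n. bounded (C n) \<and> diameter (C n) \<le> r"
      define CA where "CA n = (if C n \<inter> A = {} then {} else C n)" for n
      define CB where "CB n = (if C n \<inter> A = {} then C n else {})" for n
      have "hausdorff1_pre r A \<le> (\<Sum>n. ennreal (diameter (CA n)))"
        unfolding hausdorff1_pre_def
      proof (intro INF_lower CollectI conjI allI)
        show "A \<subseteq> (\<Union>n. CA n)"
        proof
          fix x assume x: "x \<in> A"
          then obtain n where "x \<in> C n" using cov by blast
          with x have "x \<in> CA n" by (auto simp: CA_def)
          then show "x \<in> (\<Union>n. CA n)" by blast
        qed
      qed (use C r in \<open>auto simp: CA_def\<close>)
      moreover have "hausdorff1_pre r B \<le> (\<Sum>n. ennreal (diameter (CB n)))"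
        unfolding hausdorff1_pre_def
      proof (intro INF_lower CollectI conjI allI)
        show "B \<subseteq> (\<Union>n. CB n)"
        proof
          fix y assume y: "y \<in> B"
          then obtain n where n: "y \<in> C n" using cov by blast
          have "C n \<inter> A = {}"
          proof (rule ccontr)
            assume "C n \<inter> A \<noteq> {}"
            then obtain x where x: "x \<in> C n" "x \<in> A" by blast
            have "dist x y \<le> diameter (C n)" using C x n by (intro diameter_bounded_bound) auto
            moreover have "diameter (C n) \<le> r" using C by blast
            ultimately show False using sep[OF x(2) y] r by linarith
          qed
          with n have "y \<in> CB n" by (auto simp: CB_def)
          then show "y \<in> (\<Union>n. CB n)" by blast
        qed
      qed (use C r in \<open>auto simp: CB_def\<close>)
      ultimately have "hausdorff1_pre r A + hausdorff1_pre r B \<le>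
          (\<Sum>n. ennreal (diameter (CA n))) + (\<Sum>n. ennreal (diameter (CB n)))"
        by (rule add_mono)
      also have "\<dots> = (\<Sum>n. ennreal (diameter (CA n)) + ennreal (diameter (CB n)))"
        by (intro suminf_add) auto
      also have "\<dots> = (\<Sum>n. ennreal (diameter (C n)))"
        by (intro suminf_cong) (simp add: CA_def CB_def)
      finally show "hausdorff1_pre r A + hausdorff1_pre r B \<le> (\<Sum>n. ennreal (diameter (C n)))" .
    qed
    moreover have "hausdorff1_pre d A + hausdorff1_pre d' B \<le> hausdorff1_pre r A + hausdorff1_pre r B"
      by (intro add_mono hausdorff1_pre_antimono r)
    ultimately show ?thesis using hausdorff1_pre_le_outer[OF r(1), of "A \<union> B"] by (meson order_trans)
  qed
  have "(SUP d\<in>{0<..}. hausdorff1_pre d A + hausdorff1_pre d' B) = hausdorff1_outer A + hausdorff1_pre d' B" for d'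
    unfolding hausdorff1_outer_def by (rule ennreal_SUP_add_left) auto
  then have "hausdorff1_outer A + hausdorff1_pre d' B \<le> hausdorff1_outer (A \<union> B)" if "0 < d'" for d'
    using * that by (metis (no_types, lifting) SUP_least greaterThan_iff)
  moreover have "(SUP d'\<in>{0<..}. hausdorff1_outer A + hausdorff1_pre d' B) = hausdorff1_outer A + hausdorff1_outer B"
    unfolding hausdorff1_outer_def[of B] by (rule ennreal_SUP_add_right[symmetric]) auto
  ultimately show ?thesis by (metis (no_types, lifting) SUP_least greaterThan_iff)
qed

lemma hausdorff1_outer_finite_separated:
  assumes "finite J" "0 < e"
    and "\<And>i j x y. i \<in> J \<Longrightarrow> j \<in> J \<Longrightarrow> i \<noteq> j \<Longrightarrow> x \<in> A i \<Longrightarrow> y \<in> A j \<Longrightarrow> e \<le> dist x y"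
  shows "(\<Sum>i\<in>J. hausdorff1_outer (A i)) \<le> hausdorff1_outer (\<Union>i\<in>J. A i)"
  using assms(1,3)
proof (induction J)
  case (insert j J)
  have "(\<Sum>i\<in>insert j J. hausdorff1_outer (A i)) = hausdorff1_outer (A j) + (\<Sum>i\<in>J. hausdorff1_outer (A i))"
    using insert by simp
  also have "\<dots> \<le> hausdorff1_outer (A j) + hausdorff1_outer (\<Union>i\<in>J. A i)"
    using insert by (intro add_left_mono insert.IH) auto
  also have "\<dots> \<le> hausdorff1_outer (A j \<union> (\<Union>i\<in>J. A i))"
    using insert by (intro hausdorff1_outer_separated[OF assms(2)]) auto
  finally show ?case by simp
qed simp

text \<open>
  The Caratheodory criterion for metric outer measures. For a test set \<open>E\<close>, the part at
  distance at least \<open>1 / (n + 1)\<close> from \<open>F\<close> is separated from \<open>E \<inter> F\<close>, so it remains to see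
  that it exhausts \<open>E - F\<close> in measure. The missing points lie in shells \<open>R k\<close> around \<open>F\<close>. Shells
  of the same parity are separated from each other, so the sum over all shells is at most twice
  the measure of \<open>E\<close>, and its tails tend to zero.
\<close>

lemma closed_in_hausdorff1_lambda_system:
  assumes "closed F"
  shows "F \<in> lambda_system UNIV (Pow UNIV) hausdorff1_outer"
proof (cases "F = {}")
  case True
  then show ?thesis by (simp add: lambda_system_def hausdorff1_outer_empty)
next
  case F: False
  have "hausdorff1_outer (E \<inter> F) + hausdorff1_outer (E - F) \<le> hausdorff1_outer E" for E
  proof (cases "hausdorff1_outer E = top")
    case fin: False
    \<comment> \<open>the shells close in on \<open>F\<close> as \<open>k\<close> grows; \<open>En n\<close> is the part of \<open>E\<close> farther out than shell \<open>n\<close>\<close>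
    define R where "R k = {x \<in> E. 1 / (real k + 2) \<le> infdist x F \<and> infdist x F < 1 / (real k + 1)}" for k :: nat
    define En where "En n = {x \<in> E. 1 / (real n + 1) \<le> infdist x F}" for n :: nat
    have RE: "R k \<subseteq> E" for k by (auto simp: R_def)
    have sepR: "1 / (real i + 2) - 1 / (real i + 3) \<le> dist x y"
      if "x \<in> R i" "y \<in> R j" "i + 2 \<le> j" for i j x y
    proof -
      have "infdist y F < 1 / (real j + 1)" "1 / (real i + 2) \<le> infdist x F"
        using that by (auto simp: R_def)
      moreover have "1 / (real j + 1) \<le> 1 / (real i + 3)"
        using that by (intro divide_left_mono) auto
      moreover have "infdist x F \<le> infdist y F + dist x y" by (rule infdist_triangle)
      ultimately show ?thesis by linarith
    qed
    have half: "(\<Sum>k\<in>J. hausdorff1_outer (R k)) \<le> hausdorff1_outer E"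
      if J: "finite J" and par: "\<And>i j. i \<in> J \<Longrightarrow> j \<in> J \<Longrightarrow> even i = even j" for J
    proof -
      define m where "m = Max (insert 0 J)"
      have sep: "1 / ((real m + 2) * (real m + 3)) \<le> dist x y"
        if ij: "i \<in> J" "j \<in> J" "i < j" and xy: "x \<in> R i" "y \<in> R j" for i j x y
      proof -
        have "i + 2 \<le> j"
        proof -
          have "j \<noteq> Suc i" using par[OF ij(1,2)] by auto
          then show ?thesis using ij(3) by linarith
        qed
        then have "1 / (real i + 2) - 1 / (real i + 3) \<le> dist x y" by (rule sepR[OF xy])
        moreover have "1 / (real i + 2) - 1 / (real i + 3) = 1 / ((real i + 2) * (real i + 3))"
          by (simp add: field_simps)
        moreover have "i \<le> m" using ij J by (auto simp: m_def)
        then have "1 / ((real m + 2) * (real m + 3)) \<le> 1 / ((real i + 2) * (real i + 3))"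
          by (intro divide_left_mono mult_mono) auto
        ultimately show ?thesis by linarith
      qed
      have "(\<Sum>k\<in>J. hausdorff1_outer (R k)) \<le> hausdorff1_outer (\<Union>k\<in>J. R k)"
      proof (rule hausdorff1_outer_finite_separated[OF J])
        show "0 < 1 / ((real m + 2) * (real m + 3))" by simp
        show "1 / ((real m + 2) * (real m + 3)) \<le> dist x y"
          if "i \<in> J" "j \<in> J" "i \<noteq> j" "x \<in> R i" "y \<in> R j" for i j x y
          using sep[of i j x y] sep[of j i y x] that by (cases "i < j") (auto simp: dist_commute)
      qed
      also have "\<dots> \<le> hausdorff1_outer E" using RE by (intro hausdorff1_outer_mono) blast
      finally show ?thesis .
    qed
    have "(\<Sum>k<n. hausdorff1_outer (R k)) \<le> hausdorff1_outer E + hausdorff1_outer E" for n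
    proof -
      have "(\<Sum>k<n. hausdorff1_outer (R k)) =
          (\<Sum>k\<in>{k. k < n \<and> even k}. hausdorff1_outer (R k)) + (\<Sum>k\<in>{k. k < n \<and> odd k}. hausdorff1_outer (R k))"
        by (subst sum.union_disjoint[symmetric]) (auto intro!: sum.cong)
      also have "\<dots> \<le> hausdorff1_outer E + hausdorff1_outer E"
        by (intro add_mono half) auto
      finally show ?thesis .
    qed
    then have "(\<Sum>k. hausdorff1_outer (R k)) \<le> hausdorff1_outer E + hausdorff1_outer E"
      by (intro suminf_le_const) auto
    then have sum_fin: "(\<Sum>k. hausdorff1_outer (R k)) < top"
      using fin by (metis ennreal_add_eq_top less_top order_le_less_trans)
    have tail: "(\<lambda>n. \<Sum>k. hausdorff1_outer (R (k + n))) \<longlonglongrightarrow> 0"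
    proof -
      define a where "a k = enn2real (hausdorff1_outer (R k))" for k
      have ak: "hausdorff1_outer (R k) = ennreal (a k)" for k
        using ennreal_suminf_lessD[OF sum_fin, of k] by (simp add: a_def)
      have a0: "0 \<le> a k" for k by (simp add: a_def)
      have sa: "summable a"
        using sum_fin by (intro summable_suminf_not_top a0) (auto simp: ak)
      have "(\<Sum>k. hausdorff1_outer (R (k + n))) = ennreal (\<Sum>k. a (k + n))" for n
        unfolding ak using sa a0 by (intro suminf_ennreal2) (auto simp: summable_iff_shift)
      moreover have "(\<lambda>n. ennreal (\<Sum>k. a (k + n))) \<longlonglongrightarrow> ennreal 0"
        by (intro tendsto_ennrealI suminf_exist_split2 sa)
      ultimately show ?thesis by simp
    qed
    have le: "hausdorff1_outer (E \<inter> F) + hausdorff1_outer (E - F) \<le>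
        hausdorff1_outer E + (\<Sum>k. hausdorff1_outer (R (k + n)))" for n
    proof -
      have "E - F \<subseteq> En n \<union> (\<Union>k. R (k + n))"
      proof
        fix x assume x: "x \<in> E - F"
        then have pos: "0 < infdist x F"
          using assms F by (metis DiffE in_closed_iff_infdist_zero infdist_nonneg less_eq_real_def)
        show "x \<in> En n \<union> (\<Union>k. R (k + n))"
        proof (cases "x \<in> En n")
          case False
          define k where "k = (LEAST k. 1 / (real k + 1) \<le> infdist x F)"
          have "\<exists>k::nat. 1 / (real k + 1) \<le> infdist x F"
            using pos by (metis add.commute less_imp_le nat_approx_posE of_nat_Suc)
          then have k: "1 / (real k + 1) \<le> infdist x F" unfolding k_def by (rule LeastI_ex)
          have nk: "n < k"
          proof (rule ccontr)
            assume "\<not> n < k"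
            then have "1 / (real n + 1) \<le> 1 / (real k + 1)" by (intro divide_left_mono) auto
            with k False x show False by (auto simp: En_def)
          qed
          have "\<not> 1 / (real (k - 1) + 1) \<le> infdist x F"
            using nk unfolding k_def by (intro not_less_Least) auto
          then have "x \<in> R ((k - 1 - n) + n)"
            using x nk k by (auto simp: R_def of_nat_diff add.commute)
          then show ?thesis by blast
        qed simp
      qed
      then have "hausdorff1_outer (E - F) \<le> hausdorff1_outer (En n \<union> (\<Union>k. R (k + n)))"
        by (rule hausdorff1_outer_mono)
      also have "\<dots> \<le> hausdorff1_outer (En n) + (\<Sum>k. hausdorff1_outer (R (k + n)))"
        by (rule order_trans[OF hausdorff1_outer_Un add_left_mono[OF hausdorff1_outer_countably_subadditive]])
      finally have "hausdorff1_outer (E \<inter> F) + hausdorff1_outer (E - F) \<le>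
          hausdorff1_outer (E \<inter> F) + (hausdorff1_outer (En n) + (\<Sum>k. hausdorff1_outer (R (k + n))))"
        by (rule add_left_mono)
      also have "\<dots> = (hausdorff1_outer (E \<inter> F) + hausdorff1_outer (En n)) + (\<Sum>k. hausdorff1_outer (R (k + n)))"
        by (simp add: add.assoc)
      also have "hausdorff1_outer (E \<inter> F) + hausdorff1_outer (En n) \<le> hausdorff1_outer ((E \<inter> F) \<union> En n)"
      proof (rule hausdorff1_outer_separated)
        show "0 < 1 / (real n + 1)" by simp
        show "1 / (real n + 1) \<le> dist x y" if "x \<in> E \<inter> F" "y \<in> En n" for x y
          using that infdist_le[of x F y] by (auto simp: En_def dist_commute)
      qed
      also have "\<dots> \<le> hausdorff1_outer E" by (intro hausdorff1_outer_mono) (auto simp: En_def)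
      finally show ?thesis by (simp add: add_right_mono)
    qed
    have "(\<lambda>n. hausdorff1_outer E + (\<Sum>k. hausdorff1_outer (R (k + n)))) \<longlonglongrightarrow> hausdorff1_outer E + 0"
      by (intro tendsto_add tail tendsto_const)
    then show ?thesis
      using le by (intro LIMSEQ_le_const[where X="\<lambda>n. hausdorff1_outer E + (\<Sum>k. hausdorff1_outer (R (k + n)))"]) auto
  qed simp
  moreover have "hausdorff1_outer E \<le> hausdorff1_outer (E \<inter> F) + hausdorff1_outer (E - F)" for E
    using hausdorff1_outer_Un[of "E \<inter> F" "E - F"] by (simp add: Int_Diff_Un)
  ultimately have "hausdorff1_outer (E \<inter> F) + hausdorff1_outer (E - F) = hausdorff1_outer E" for E
    by (rule antisym)
  then show ?thesis by (auto simp: lambda_system_def Int_commute Diff_eq)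
qed

lemma sets_hausdorff1 [measurable_cong, simp]: "sets hausdorff1 = sets borel"
  unfolding hausdorff1_def using sets.sigma_sets_eq[of borel] by simp

text \<open>
  The measure was built from the outer measure by \<open>measure_of\<close>, which yields zero
  unless the set function is countably additive on Borel sets; this is what the preceding criterion
  provides.
\<close>

lemma emeasure_hausdorff1:
  assumes "A \<in> sets borel"
  shows "emeasure hausdorff1 A = hausdorff1_outer A"
proof -
  let ?L = "lambda_system UNIV (Pow UNIV) (hausdorff1_outer :: 'a set \<Rightarrow> ennreal)"
  have ms: "measure_space UNIV ?L hausdorff1_outer"
    by (rule sigma_algebra.caratheodory_lemma[OF sigma_algebra_Pow outer_measure_space_hausdorff1])
  have sa: "sigma_algebra UNIV ?L" using ms by (simp add: measure_space_def)
  have "sigma_sets UNIV (Collect closed) \<subseteq> ?L"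
    using closed_in_hausdorff1_lambda_system
    by (intro sigma_algebra.sigma_sets_subset[OF sa]) auto
  then have "sets (borel :: 'a measure) \<subseteq> ?L" by (simp add: borel_eq_closed)
  then have "measure_space UNIV (sets (borel :: 'a measure)) hausdorff1_outer"
    using sets.sigma_algebra_axioms[of borel] by (intro measure_down[OF ms]) auto
  then show ?thesis
    unfolding hausdorff1_def using assms
    by (intro emeasure_measure_of_sigma) (auto simp: measure_space_def sets.sigma_algebra_axioms[of borel, simplified])
qed

section \<open>Hausdorff integrals over segments\<close>

text \<open>
  Pulled back to the parameter interval, a cover by sets of diameter \<open>d n\<close> becomes a cover by
  sets contained in intervals of length \<open>d n / dist A B\<close>.
\<close>

lemma hausdorff1_outer_segment_ge:
  fixes A B :: "'a::euclidean_space"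
  assumes S: "S \<in> sets borel" "S \<subseteq> {0..1}"
  shows "ennreal (dist A B) * emeasure lborel S \<le> hausdorff1_outer ((\<lambda>t. A + t *\<^sub>R (B - A)) ` S)"
proof (cases "A = B")
  case False
  define L where "L = dist A B"
  have L: "0 < L" using False by (simp add: L_def)
  let ?\<gamma> = "\<lambda>t. A + t *\<^sub>R (B - A)"
  have dist_\<gamma>: "dist (?\<gamma> s) (?\<gamma> t) = L * \<bar>s - t\<bar>" for s t
    by (simp add: dist_norm L_def norm_minus_commute flip: scaleR_diff_left)
  have "ennreal L * emeasure lborel S \<le> hausdorff1_pre 1 (?\<gamma> ` S)"
    unfolding hausdorff1_pre_def
  proof (rule INF_greatest, clarify)
    fix C :: "nat \<Rightarrow> 'a set"
    assume cov: "?\<gamma> ` S \<subseteq> (\<Union>n. C n)" and C: "\<forall>n. bounded (C n) \<and> diameter (C n) \<le> 1"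
    define T where "T n = {t \<in> S. ?\<gamma> t \<in> C n}" for n
    define J where "J n = (if T n = {} then {} else {Inf (T n)..Sup (T n)})" for n
    have TJ: "T n \<subseteq> J n" for n
    proof -
      have "bdd_below (T n)" "bdd_above (T n)" using S(2) by (auto simp: T_def intro!: bdd_belowI[of _ 0] bdd_aboveI[of _ 1])
      then show ?thesis by (auto simp: J_def intro: cInf_lower cSup_upper)
    qed
    have J_len: "emeasure lborel (J n) \<le> ennreal (diameter (C n) / L)" for n
    proof (cases "T n = {}")
      case ne: False
      let ?d = "diameter (C n) / L"
      have close: "s - ?d \<le> t" if "s \<in> T n" "t \<in> T n" for s t
      proof -
        have "dist (?\<gamma> s) (?\<gamma> t) \<le> diameter (C n)"
          using that C by (intro diameter_bounded_bound) (auto simp: T_def)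
        then have "\<bar>s - t\<bar> \<le> ?d" using L unfolding dist_\<gamma> by (simp add: field_simps)
        then show ?thesis by linarith
      qed
      have "Sup (T n) \<le> Inf (T n) + ?d"
      proof (rule cSup_least[OF ne])
        fix s assume "s \<in> T n"
        then have "s - ?d \<le> Inf (T n)" by (intro cInf_greatest[OF ne] close)
        then show "s \<le> Inf (T n) + ?d" by linarith
      qed
      moreover have "Inf (T n) \<le> Sup (T n)"
        using ne TJ[of n] by (auto simp: J_def split: if_splits)
      ultimately show ?thesis by (simp add: J_def ne ennreal_leI)
    qed (simp add: J_def)
    have "S \<subseteq> (\<Union>n. J n)"
    proof
      fix t assume t: "t \<in> S"
      then obtain n where "?\<gamma> t \<in> C n" using cov by blast
      with t TJ[of n] show "t \<in> (\<Union>n. J n)" by (auto simp: T_def)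
    qed
    then have "emeasure lborel S \<le> emeasure lborel (\<Union>n. J n)"
      by (intro emeasure_mono) (auto simp: J_def)
    also have "\<dots> \<le> (\<Sum>n. emeasure lborel (J n))"
      by (intro emeasure_subadditive_countably) (auto simp: J_def)
    also have "\<dots> \<le> (\<Sum>n. ennreal (diameter (C n) / L))"
      by (intro suminf_le J_len) auto
    finally have "ennreal L * emeasure lborel S \<le> ennreal L * (\<Sum>n. ennreal (diameter (C n) / L))"
      by (rule mult_left_mono) simp
    also have "\<dots> = (\<Sum>n. ennreal L * ennreal (diameter (C n) / L))" by simp
    also have "\<dots> = (\<Sum>n. ennreal (diameter (C n)))"
      using L C by (intro suminf_cong) (simp add: diameter_ge_0 flip: ennreal_mult)
    finally show "ennreal L * emeasure lborel S \<le> (\<Sum>n. ennreal (diameter (C n)))" .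
  qed
  also have "\<dots> \<le> hausdorff1_outer (?\<gamma> ` S)" by (rule hausdorff1_pre_le_outer) simp
  finally show ?thesis by (simp add: L_def)
qed simp

lemma closed_segment_param: "closed_segment A B = (\<lambda>t. A + t *\<^sub>R (B - A)) ` {0..1}"
  by (force simp: closed_segment_def algebra_simps)

text \<open>
  Cut the segment into \<open>n\<close> pieces of equal length.
\<close>

lemma hausdorff1_outer_segment_le:
  fixes A B :: "'a::euclidean_space"
  shows "hausdorff1_outer (closed_segment A B) \<le> ennreal (dist A B)"
  unfolding hausdorff1_outer_def
proof (rule SUP_least)
  fix d :: real assume "d \<in> {0<..}"
  then have d: "0 < d" by simp
  define L where "L = dist A B"
  let ?\<gamma> = "\<lambda>t. A + t *\<^sub>R (B - A)"
  have dist_\<gamma>: "dist (?\<gamma> s) (?\<gamma> t) = L * \<bar>s - t\<bar>" for s t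
    by (simp add: dist_norm L_def norm_minus_commute flip: scaleR_diff_left)
  obtain m :: nat where "L / d < real m" using reals_Archimedean2 by blast
  then obtain n :: nat where n: "0 < n" "L / n \<le> d"
    using d by (intro that[of "Suc m"]) (auto simp: field_simps intro: order_trans)
  define C where "C i = (if i < n then ?\<gamma> ` {real i / n .. (real i + 1) / n} else {})" for i
  have diam: "diameter (C i) \<le> (if i < n then L / n else 0)" for i
  proof (cases "i < n")
    case True
    have "diameter (C i) \<le> L / n"
    proof (rule diameter_le)
      show "norm (x - y) \<le> L / n" if xy: "x \<in> C i" "y \<in> C i" for x y
      proof -
        obtain s t where st: "x = ?\<gamma> s" "y = ?\<gamma> t" "s \<in> {real i / n .. (real i + 1) / n}" "t \<in> {real i / n .. (real i + 1) / n}"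
          using xy True unfolding C_def by (simp only: if_True image_iff) blast
        then have "\<bar>s - t\<bar> \<le> 1 / n" by (auto simp: add_divide_distrib)
        then have "dist x y \<le> L * (1 / n)"
          unfolding st dist_\<gamma> by (intro mult_left_mono) (auto simp: L_def)
        then show ?thesis by (simp add: dist_norm)
      qed
    qed (simp add: L_def)
    then show ?thesis using True by simp
  qed (simp add: C_def)
  have "hausdorff1_pre d (closed_segment A B) \<le> (\<Sum>i. ennreal (diameter (C i)))"
    unfolding hausdorff1_pre_def
  proof (intro INF_lower CollectI conjI allI)
    show "closed_segment A B \<subseteq> (\<Union>i. C i)"
    proof
      fix x assume "x \<in> closed_segment A B"
      then obtain t where "x = ?\<gamma> t" "t \<in> {0..1}" unfolding closed_segment_param by (rule imageE)
      then have t: "x = ?\<gamma> t" "0 \<le> t" "t \<le> 1" by auto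
      define i where "i = min (nat \<lfloor>t * n\<rfloor>) (n - 1)"
      have "real i \<le> t * n" "t * n \<le> real i + 1" "i < n"
        using t n by (auto simp: i_def min_def of_nat_diff)
          (linarith | (metis mult_left_le_one_le of_nat_0_le_iff))+
      then have "x \<in> C i" using n by (auto simp: C_def t field_simps)
      then show "x \<in> (\<Union>i. C i)" by blast
    qed
    show "bounded (C i)" for i
      by (auto simp: C_def intro!: compact_imp_bounded compact_continuous_image continuous_intros)
    show "diameter (C i) \<le> d" for i using diam[of i] n d by (auto split: if_splits)
  qed
  also have "\<dots> \<le> (\<Sum>i. ennreal (if i < n then L / n else 0))"
    by (intro suminf_le ennreal_leI diam) auto
  also have "\<dots> = (\<Sum>i<n. ennreal (if i < n then L / n else 0))"
    by (intro suminf_finite) auto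
  also have "\<dots> = ennreal L"
    using n by (simp add: L_def ennreal_of_nat_eq_real_of_nat flip: ennreal_mult)
  finally show "hausdorff1_pre d (closed_segment A B) \<le> ennreal (dist A B)" by (simp add: L_def)
qed

text \<open>
  Hausdorff measure dominates arc length on the part of the segment in \<open>X\<close> and on the part
  outside \<open>X\<close>, while in total it is at most the length. As everything is finite, both inequalities
  are equalities.
\<close>

lemma emeasure_hausdorff1_segment:
  fixes A B :: "'a::euclidean_space"
  assumes X [measurable]: "X \<in> sets borel"
  shows "emeasure hausdorff1 (X \<inter> closed_segment A B) =
    ennreal (dist A B) * emeasure lborel ((\<lambda>t. A + t *\<^sub>R (B - A)) -` X \<inter> {0..1})"
proof -
  let ?\<gamma> = "\<lambda>t. A + t *\<^sub>R (B - A)" and ?s = "closed_segment A B" and ?L = "ennreal (dist A B)"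
  define \<mu> where "\<mu> X = emeasure hausdorff1 (X \<inter> ?s)" for X
  define \<nu> where "\<nu> X = ?L * emeasure lborel (?\<gamma> -` X \<inter> {0..1})" for X
  have [measurable]: "?\<gamma> \<in> borel_measurable borel" by (intro borel_measurable_continuous_onI continuous_intros)
  have pre: "?\<gamma> -` X \<inter> {0..1} \<in> sets borel" if "X \<in> sets borel" for X
    using measurable_sets[OF \<open>?\<gamma> \<in> borel_measurable borel\<close> that] by simp
  have ge: "\<nu> X \<le> \<mu> X" if X: "X \<in> sets borel" for X
  proof -
    have "?\<gamma> ` (?\<gamma> -` X \<inter> {0..1}) = X \<inter> ?s" by (auto simp: closed_segment_param)
    then show ?thesis
      using hausdorff1_outer_segment_ge[OF pre[OF X], of A B] X
      by (simp add: \<mu>_def \<nu>_def emeasure_hausdorff1)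
  qed
  have "\<mu> X + \<mu> (- X) = emeasure hausdorff1 ?s"
    unfolding \<mu>_def by (subst plus_emeasure) (auto intro!: arg_cong[where f="emeasure hausdorff1"])
  also have "\<dots> \<le> ?L" by (simp add: emeasure_hausdorff1 hausdorff1_outer_segment_le)
  also have "?L = \<nu> X + \<nu> (- X)"
  proof -
    have "emeasure lborel (?\<gamma> -` X \<inter> {0..1}) + emeasure lborel (?\<gamma> -` (- X) \<inter> {0..1}) = emeasure lborel {0..1::real}"
    proof (subst plus_emeasure)
      have "?\<gamma> -` X \<inter> {0..1} \<union> ?\<gamma> -` (- X) \<inter> {0..1} = {0..1}" by auto
      then show "emeasure lborel (?\<gamma> -` X \<inter> {0..1} \<union> ?\<gamma> -` (- X) \<inter> {0..1}) = emeasure lborel {0..1::real}"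
        by (rule arg_cong)
    qed (use pre[OF X] pre[of "- X"] in auto)
    then show ?thesis by (simp add: \<nu>_def flip: distrib_left)
  qed
  finally have *: "\<mu> X + \<mu> (- X) \<le> \<nu> X + \<nu> (- X)" .
  have fin: "\<nu> (- X) < top" "\<nu> X < top"
  proof -
    have "emeasure lborel (?\<gamma> -` X \<inter> {0..1}) < top" if "X \<in> sets borel" for X
    proof -
      have "emeasure lborel (?\<gamma> -` X \<inter> {0..1}) \<le> emeasure lborel {0..1::real}"
        by (intro emeasure_mono) auto
      also have "\<dots> < top" by simp
      finally show ?thesis .
    qed
    from this[of X] this[of "- X"] show "\<nu> (- X) < top" "\<nu> X < top" by (auto simp: \<nu>_def ennreal_mult_less_top)
  qed
  have "\<mu> X + \<nu> (- X) \<le> \<nu> X + \<nu> (- X)"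
    using * ge[of "- X"] by (meson X add_left_mono borel_comp order_trans)
  then have "\<mu> X \<le> \<nu> X" using fin by (metis add.commute ennreal_add_left_cancel_le less_irrefl infinity_ennreal_def)
  with ge[OF X] show ?thesis unfolding \<mu>_def \<nu>_def by (rule antisym[rotated])
qed

lemma hausdorff1_segment_eq_distr:
  fixes A B :: "'a::euclidean_space"
  shows "density hausdorff1 (indicator (closed_segment A B)) =
    distr (density lborel (\<lambda>t. ennreal (dist A B) * indicator {0..1} t)) borel (\<lambda>t. A + t *\<^sub>R (B - A))"
proof (rule measure_eqI)
  let ?\<gamma> = "\<lambda>t. A + t *\<^sub>R (B - A)"
  fix X assume "X \<in> sets (density hausdorff1 (indicator (closed_segment A B)))"
  then have X [measurable]: "X \<in> sets borel" by simp
  have g [measurable]: "?\<gamma> \<in> borel_measurable borel" by (intro borel_measurable_continuous_onI continuous_intros)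
  have pre [measurable]: "?\<gamma> -` X \<in> sets borel" using measurable_sets[OF g X] by simp
  have "emeasure (density hausdorff1 (indicator (closed_segment A B))) X = emeasure hausdorff1 (X \<inter> closed_segment A B)"
    by (subst emeasure_density)
      (auto simp: Int_commute borel_closed measurable_cong_sets[OF sets_hausdorff1 refl] simp flip: indicator_inter_arith)
  also have "\<dots> = ennreal (dist A B) * emeasure lborel ({0..1} \<inter> ?\<gamma> -` X)"
    by (subst emeasure_hausdorff1_segment) (auto simp: Int_commute)
  also have "\<dots> = emeasure (density lborel (\<lambda>t. ennreal (dist A B) * indicator {0..1} t)) (?\<gamma> -` X)"
    by (subst emeasure_density)
      (auto simp: nn_integral_cmult mult.assoc simp flip: indicator_inter_arith)
  finally show "emeasure (density hausdorff1 (indicator (closed_segment A B))) X =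
      emeasure (distr (density lborel (\<lambda>t. ennreal (dist A B) * indicator {0..1} t)) borel ?\<gamma>) X"
    by (subst emeasure_distr) auto
qed simp

lemma LINT_hausdorff1_segment:
  fixes f :: "'a::euclidean_space \<Rightarrow> real"
  assumes f [measurable]: "f \<in> borel_measurable borel"
  shows "(LINT x : closed_segment A B | hausdorff1. f x) =
    dist A B * (LINT t : {0..1} | lborel. f (A + t *\<^sub>R (B - A)))"
proof -
  let ?\<gamma> = "\<lambda>t. A + t *\<^sub>R (B - A)"
  have g [measurable]: "?\<gamma> \<in> borel_measurable borel" by (intro borel_measurable_continuous_onI continuous_intros)
  have "(LINT x : closed_segment A B | hausdorff1. f x) = (LINT x | density hausdorff1 (indicator (closed_segment A B)). f x)"
    unfolding set_lebesgue_integral_def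
    by (subst integral_density[symmetric])
      (auto simp: ennreal_indicator borel_closed measurable_cong_sets[OF sets_hausdorff1 refl])
  also have "\<dots> = (LINT t | density lborel (\<lambda>t. ennreal (dist A B * indicator {0..1} t)). f (?\<gamma> t))"
    unfolding hausdorff1_segment_eq_distr
    by (subst integral_distr) (auto simp: ennreal_mult' ennreal_indicator)
  also have "\<dots> = (LINT t | lborel. (dist A B * indicator {0..1} t) *\<^sub>R f (?\<gamma> t))"
    by (subst integral_density) auto
  also have "\<dots> = dist A B * (LINT t : {0..1} | lborel. f (?\<gamma> t))"
    unfolding set_lebesgue_integral_def by (simp add: mult.assoc)
  finally show ?thesis .
qed

text \<open>
  Needed because the balance condition integrates over two halves of a side, whereas the
  computations use one parameter on the whole side.
\<close>

lemma LINT_hausdorff1_subsegment: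
  fixes f :: "'a::euclidean_space \<Rightarrow> real"
  assumes f [measurable]: "f \<in> borel_measurable borel" and "A \<noteq> B" "{a..b} \<subseteq> {0..1}" "a \<le> b"
  shows "(LINT x : closed_segment (A + a *\<^sub>R (B - A)) (A + b *\<^sub>R (B - A)) | hausdorff1. f x) =
    dist A B * (LINT t : {a..b} | lborel. f (A + t *\<^sub>R (B - A)))"
proof -
  let ?\<gamma> = "\<lambda>t. A + t *\<^sub>R (B - A)"
  let ?s = "closed_segment (?\<gamma> a) (?\<gamma> b)"
  have seg: "?s = ?\<gamma> ` {a..b}"
  proof -
    have "?s = (\<lambda>x. A + x) ` (\<lambda>t. t *\<^sub>R (B - A)) ` closed_segment a b"
      by (subst closed_segment_linear_image[symmetric]) (auto simp: closed_segment_translation linear_scaleR_left)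
    then show ?thesis using assms(4) by (simp add: image_image closed_segment_eq_real_ivl)
  qed
  have inj: "?\<gamma> t \<in> ?s \<longleftrightarrow> t \<in> {a..b}" for t
    using assms(2) by (auto simp: seg)
  have sub: "?s \<subseteq> closed_segment A B" unfolding seg closed_segment_param[of A B] using assms(3) by blast
  have [measurable]: "?s \<in> sets borel" by (simp add: borel_closed)
  have "(LINT x : ?s | hausdorff1. f x) = (LINT x : closed_segment A B | hausdorff1. indicator ?s x * f x)"
    unfolding set_lebesgue_integral_def
    using sub by (intro Bochner_Integration.integral_cong) (auto simp: indicator_def)
  also have "\<dots> = dist A B * (LINT t : {0..1} | lborel. indicator ?s (?\<gamma> t) * f (?\<gamma> t))"
    by (rule LINT_hausdorff1_segment) measurable
  also have "(LINT t : {0..1} | lborel. indicator ?s (?\<gamma> t) * f (?\<gamma> t)) = (LINT t : {a..b} | lborel. f (?\<gamma> t))"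
    unfolding set_lebesgue_integral_def
    using assms(3,4) by (intro Bochner_Integration.integral_cong refl) (unfold indicator_def inj, auto)
  finally show ?thesis .
qed

text \<open>
  In the parameter \<open>t\<close> of the whole side, the distance to the midpoint is proportional to
  \<open>\<bar>t - 1/2\<bar>\<close>, so equality of the two halves is the vanishing of the first moment about
  \<open>1/2\<close>.
\<close>

lemma first_moment_zero_if_balanced:
  fixes f :: "'a::euclidean_space \<Rightarrow> real"
  assumes f [measurable]: "f \<in> borel_measurable borel" and AB: "A \<noteq> B"
    and int: "set_integrable lborel {0..1} (\<lambda>t. f (A + t *\<^sub>R (B - A)))"
    and bal: "(LINT x : closed_segment A (midpoint A B) | hausdorff1. f x * dist x (midpoint A B)) =
       (LINT x : closed_segment B (midpoint A B) | hausdorff1. f x * dist x (midpoint A B))"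
  shows "(LINT t : {0..1} | lborel. (t - 1/2) * f (A + t *\<^sub>R (B - A))) = 0"
proof -
  let ?\<gamma> = "\<lambda>t. A + t *\<^sub>R (B - A)"
  let ?M = "midpoint A B"
  define V where "V t = f (?\<gamma> t)" for t
  have g [measurable]: "?\<gamma> \<in> borel_measurable borel" by (intro borel_measurable_continuous_onI continuous_intros)
  have M: "?M = ?\<gamma> (1/2)" by (simp add: midpoint_def algebra_simps flip: scaleR_add_left)
  have d: "dist (?\<gamma> t) ?M = \<bar>t - 1/2\<bar> * dist A B" for t
    unfolding M by (simp add: dist_norm norm_minus_commute flip: scaleR_diff_left)
  have [measurable]: "(\<lambda>x. f x * dist x ?M) \<in> borel_measurable borel" by measurable
  have half: "(LINT x : closed_segment (?\<gamma> a) (?\<gamma> b) | hausdorff1. f x * dist x ?M) =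
      (dist A B)\<^sup>2 * (LINT t : {a..b} | lborel. \<bar>t - 1/2\<bar> * V t)" if "{a..b} \<subseteq> {0..1}" "a \<le> b" for a b
    by (subst LINT_hausdorff1_subsegment)
      (use AB that in \<open>auto simp: d V_def power2_eq_square set_lebesgue_integral_def mult_ac
         simp flip: integral_mult_right_zero intro!: Bochner_Integration.integral_cong\<close>)
  have "(dist A B)\<^sup>2 * (LINT t : {0..1/2} | lborel. \<bar>t - 1/2\<bar> * V t) = (dist A B)\<^sup>2 * (LINT t : {1/2..1} | lborel. \<bar>t - 1/2\<bar> * V t)"
    using half[of 0 "1/2"] half[of "1/2" 1] bal by (simp add: M[symmetric] closed_segment_commute)
  then have *: "(LINT t : {0..1/2} | lborel. \<bar>t - 1/2\<bar> * V t) = (LINT t : {1/2..1} | lborel. \<bar>t - 1/2\<bar> * V t)"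
    using AB by simp
  have intV: "set_integrable lborel {0..1} V" using int by (simp add: V_def[abs_def])
  have int1: "set_integrable lborel {0..1} (\<lambda>t. \<bar>t - 1/2\<bar> * V t)"
    unfolding set_integrable_def
    by (rule Bochner_Integration.integrable_bound[OF intV[unfolded set_integrable_def]])
      (auto simp: V_def abs_mult indicator_def intro!: mult_left_le_one_le)
  have i1: "set_integrable lborel {0..1/2} (\<lambda>t. \<bar>t - 1/2\<bar> * V t)" "set_integrable lborel {1/2..1} (\<lambda>t. \<bar>t - 1/2\<bar> * V t)"
    by (rule set_integrable_subset[OF int1]; auto)+
  have "(LINT t : {0..1} | lborel. (t - 1/2) * V t) = (LINT t | lborel. indicator {1/2..1} t *\<^sub>R (\<bar>t - 1/2\<bar> * V t) - indicator {0..1/2} t *\<^sub>R (\<bar>t - 1/2\<bar> * V t))"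
    unfolding set_lebesgue_integral_def by (intro Bochner_Integration.integral_cong) (auto simp: indicator_def abs_if algebra_simps)
  also have "\<dots> = 0"
    using i1 * unfolding set_integrable_def set_lebesgue_integral_def by (subst Bochner_Integration.integral_diff) auto
  finally show ?thesis by (simp add: V_def)
qed

section \<open>The kernel and one-dimensional slices\<close>

lemma integral_pos_if_pos_on:
  fixes f :: "'a \<Rightarrow> real"
  assumes f: "integrable M f" "AE x in M. 0 \<le> f x"
    and A: "A \<in> sets M" "emeasure M A \<noteq> 0" "AE x in M. x \<in> A \<longrightarrow> 0 < f x"
  shows "0 < integral\<^sup>L M f"
proof (rule ccontr)
  assume "\<not> 0 < integral\<^sup>L M f"
  with integral_nonneg_AE[OF f(2)] have "integral\<^sup>L M f = 0" by linarith
  then have "AE x in M. f x = 0" using integral_nonneg_eq_0_iff_AE[OF f] by simp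
  with A(3) have "AE x in M. x \<notin> A" by eventually_elim auto
  then show False using A(1,2) by (simp add: AE_iff_measurable[OF _ refl] sets.sets_into_space Int_absorb1 Collect_conj_eq flip: Int_def)
qed

text \<open>
  The kernel as a function of the height difference \<open>h\<close> and the horizontal difference \<open>x\<close>. The
  value \<open>0\<close> at the origin makes it nonnegative and Borel whatever \<open>K\<close> is outside \<open>(0, \<infinity>)\<close>.
\<close>

definition planar_kernel :: "(real \<Rightarrow> real) \<Rightarrow> real \<Rightarrow> real \<Rightarrow> real" where
  "planar_kernel K h x = (if h = 0 \<and> x = 0 then 0 else K (sqrt (h\<^sup>2 + x\<^sup>2)))"

lemma planar_kernel_minus [simp]:
  "planar_kernel K (- h) x = planar_kernel K h x" "planar_kernel K h (- x) = planar_kernel K h x"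
  by (simp_all add: planar_kernel_def)

lemma planar_kernel_minus_commute: "planar_kernel K (s - t) x = planar_kernel K (t - s) x"
  using planar_kernel_minus(1)[of K "s - t" x] by simp

text \<open>
  The contribution of one slice, of half-width \<open>w\<close> and centred at \<open>0\<close>, to the difference of the
  potentials at two points at height difference \<open>h\<close>. The points have distance \<open>2 b\<close> and midpoint
  \<open>d\<close>, so \<open>d\<close> is the offset of the midpoint from the centre of the slice.
\<close>

definition slice_gap :: "(real \<Rightarrow> real) \<Rightarrow> real \<Rightarrow> real \<Rightarrow> real \<Rightarrow> real \<Rightarrow> real" where
  "slice_gap K h b w d = (\<integral>y. indicator {-w<..<w} y * (planar_kernel K h (d + b - y) - planar_kernel K h (d - b - y)) \<partial>lborel)"

locale radial_kernel =
  fixes K :: "real \<Rightarrow> real"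
  assumes K: "is_kernel K"
begin

lemma kernel_nonneg: "0 < r \<Longrightarrow> 0 \<le> K r"
  and kernel_strict_antimono: "0 < r \<Longrightarrow> r < s \<Longrightarrow> K s < K r"
  and kernel_antimono: "0 < r \<Longrightarrow> r \<le> s \<Longrightarrow> K s \<le> K r"
  and kernel_continuous: "continuous_on {0<..} K"
proof -
  show "0 < r \<Longrightarrow> 0 \<le> K r" using K by (simp add: is_kernel_def)
  show *: "0 < r \<Longrightarrow> r < s \<Longrightarrow> K s < K r" for r s
    using K by (auto simp: is_kernel_def monotone_on_def)
  show "0 < r \<Longrightarrow> r \<le> s \<Longrightarrow> K s \<le> K r"
    using *[of r s] by (cases "r = s") auto
  show "continuous_on {0<..} K"
    using K by (auto simp: is_kernel_def intro: C1_differentiable_imp_continuous_on)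
qed

lemma planar_kernel_nonneg [simp]: "0 \<le> planar_kernel K h x"
  using sum_power2_gt_zero_iff[of h x] by (auto simp: planar_kernel_def intro!: kernel_nonneg)

lemma kernel_measurable [measurable]: "(\<lambda>r. indicator {0<..} r * K r) \<in> borel_measurable borel"
  using borel_measurable_continuous_on_indicator[OF _ kernel_continuous] by simp

lemma planar_kernel_altdef:
  "planar_kernel K h x = indicator {0<..} (sqrt (h\<^sup>2 + x\<^sup>2)) * K (sqrt (h\<^sup>2 + x\<^sup>2))"
  using sum_power2_gt_zero_iff[of h x] by (auto simp: planar_kernel_def indicator_def)

lemma planar_kernel_measurable [measurable]:
  assumes "f \<in> borel_measurable M" "g \<in> borel_measurable M"
  shows "(\<lambda>z. planar_kernel K (f z) (g z)) \<in> borel_measurable M"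
  unfolding planar_kernel_altdef
  by (rule measurable_compose[OF _ kernel_measurable]) (use assms in measurable)

lemma planar_kernel_continuous: "h \<noteq> 0 \<Longrightarrow> continuous_on UNIV (planar_kernel K h)"
proof -
  assume h: "h \<noteq> 0"
  have "continuous_on UNIV (\<lambda>x. K (sqrt (h\<^sup>2 + x\<^sup>2)))"
    by (rule continuous_on_compose2[OF kernel_continuous])
      (use h in \<open>auto simp: sum_power2_gt_zero_iff intro!: continuous_intros\<close>)
  then show ?thesis using h by (simp add: planar_kernel_def[abs_def])
qed

lemma planar_kernel_strict: "h \<noteq> 0 \<Longrightarrow> \<bar>x\<bar> < \<bar>y\<bar> \<Longrightarrow> planar_kernel K h y < planar_kernel K h x"
  by (auto simp: planar_kernel_def sum_power2_gt_zero_iff abs_square_less_1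
      intro!: kernel_strict_antimono power2_strict_mono)

lemma planar_kernel_mono: "h \<noteq> 0 \<Longrightarrow> \<bar>x\<bar> \<le> \<bar>y\<bar> \<Longrightarrow> planar_kernel K h y \<le> planar_kernel K h x"
  by (auto simp: planar_kernel_def sum_power2_gt_zero_iff abs_le_square_iff intro!: kernel_antimono)

lemma slice_integrable:
  assumes "h \<noteq> 0" "A \<in> sets borel" "A \<subseteq> {-R..R}"
  shows "integrable lborel (\<lambda>y. indicator A y * planar_kernel K h (a - y))"
    "integrable lborel (\<lambda>y. indicator A y * planar_kernel K h (a + y))"
proof -
  have "integrable lborel (\<lambda>y. indicator {-R..R} y * planar_kernel K h 0)"
    by (intro integrable_mult_left) (cases "0 \<le> R"; simp add: integrable_indicator_iff)
  then show "integrable lborel (\<lambda>y. indicator A y * planar_kernel K h (a - y))"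
    "integrable lborel (\<lambda>y. indicator A y * planar_kernel K h (a + y))"
    by (rule Bochner_Integration.integrable_bound; use assms in
      \<open>auto simp: indicator_def abs_mult intro!: AE_I2 planar_kernel_mono\<close>)+
qed

text \<open>
  Mirror the slice in its centre.
\<close>

lemma slice_gap_minus:
  "slice_gap K h b w (- d) = - slice_gap K h b w d"
proof -
  have "slice_gap K h b w (- d) = (\<integral>y. indicator {-w<..<w} (- y) * (planar_kernel K h (- d + b - (- y)) - planar_kernel K h (- d - b - (- y))) \<partial>lborel)"
    unfolding slice_gap_def by (subst lborel_integral_real_affine[where c="-1" and t=0]) auto
  also have "\<dots> = (\<integral>y. - (indicator {-w<..<w} y * (planar_kernel K h (d + b - y) - planar_kernel K h (d - b - y))) \<partial>lborel)"
  proof (intro Bochner_Integration.integral_cong refl)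
    fix y
    have "planar_kernel K h (- d + b - (- y)) = planar_kernel K h (d - b - y)"
      "planar_kernel K h (- d - b - (- y)) = planar_kernel K h (d + b - y)"
      using planar_kernel_minus(2)[of K h "d - b - y"] planar_kernel_minus(2)[of K h "d + b - y"]
      by (simp_all only: minus_diff_eq) (simp_all add: algebra_simps)
    then show "indicator {-w<..<w} (- y) * (planar_kernel K h (- d + b - (- y)) - planar_kernel K h (- d - b - (- y))) =
      - (indicator {-w<..<w} y * (planar_kernel K h (d + b - y) - planar_kernel K h (d - b - y)))"
      by (auto simp: indicator_def)
  qed
  finally show ?thesis by (simp add: slice_gap_def)
qed

text \<open>
  The difference \<open>q\<close> of the two kernels is odd under the reflection \<open>y \<mapsto> 2 * d - y\<close> that exchanges the
  two points, and negative on the near side \<open>y < d\<close> of the mirror. The part of the slice beyond the mirror is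
  reflected into the slice, so after cancellation only a set on the near side remains.
\<close>

lemma slice_gap_neg:
  assumes h: "h \<noteq> 0" and b: "0 < b" and w: "0 < w" and d: "0 < d"
  shows "slice_gap K h b w d < 0"
proof -
  define q where "q y = planar_kernel K h (d + b - y) - planar_kernel K h (d - b - y)" for y
  define i where "i y = indicat_real {-w<..<w} y" for y
  have refl_q: "q (2 * d - y) = - q y" for y
    using planar_kernel_minus(2)[of K h "d - b - y"] planar_kernel_minus(2)[of K h "d + b - y"]
    by (simp add: q_def algebra_simps)
  have q_neg: "q y < 0" if "y < d" for y
  proof -
    have "\<bar>d - b - y\<bar> < \<bar>d + b - y\<bar>" using that b by linarith
    then show ?thesis using planar_kernel_strict[OF h] by (simp add: q_def)
  qed
  have q_pos: "0 < q y" if "d < y" for y using q_neg[of "2 * d - y"] refl_q[of y] that by simp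
  have [measurable]: "q \<in> borel_measurable borel" unfolding q_def by measurable
  have int1: "integrable lborel (\<lambda>y. i y * q y)"
    unfolding i_def q_def right_diff_distrib
    by (intro Bochner_Integration.integrable_diff slice_integrable[OF h, where R=w]) auto
  have int2: "integrable lborel (\<lambda>y. i (2 * d - y) * q y)"
    using lborel_integrable_real_affine[OF int1, of "-1" "2 * d"] by (simp add: refl_q)
  have "slice_gap K h b w d = (\<integral>y. i y * q y \<partial>lborel)" by (simp add: slice_gap_def i_def q_def)
  moreover have "(\<integral>y. i y * q y \<partial>lborel) = (\<integral>y. i (2 * d - y) * - q y \<partial>lborel)"
    by (subst lborel_integral_real_affine[where c="-1" and t="2 * d"]) (auto simp: refl_q)
  ultimately have eq: "2 * slice_gap K h b w d = (\<integral>y. (i y - i (2 * d - y)) * q y \<partial>lborel)"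
    using int1 int2 by (simp add: left_diff_distrib)
  have int: "integrable lborel (\<lambda>y. (i y - i (2 * d - y)) * q y)"
    using int1 int2 by (simp add: left_diff_distrib)
  have nonpos: "(i y - i (2 * d - y)) * q y \<le> 0" for y
  proof (cases y d rule: linorder_cases)
    case less
    have "i (2 * d - y) \<le> i y" using less d by (auto simp: i_def indicator_def)
    then show ?thesis using q_neg[OF less] by (simp add: mult_nonneg_nonpos)
  next
    case greater
    have "i y \<le> i (2 * d - y)" using greater d by (auto simp: i_def indicator_def)
    then show ?thesis using q_pos[OF greater] by (simp add: mult_nonpos_nonneg)
  next
    case equal then show ?thesis by simp
  qed
  \<comment> \<open>the points between \<open>-w\<close> and \<open>v\<close> lie in the slice, but their mirror images do not\<close>
  define v where "v = min (min w d) (2 * d - w)"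
  have v: "- w < v" using w d by (simp add: v_def)
  have neg: "(i y - i (2 * d - y)) * q y < 0" if "y \<in> {-w<..<v}" for y
    using that q_neg[of y] by (auto simp: i_def indicator_def v_def)
  have "0 < (\<integral>y. - ((i y - i (2 * d - y)) * q y) \<partial>lborel)"
  proof (rule integral_pos_if_pos_on)
    show "emeasure lborel {-w<..<v} \<noteq> 0" using v by simp
    show "AE y in lborel. y \<in> {-w<..<v} \<longrightarrow> 0 < - ((i y - i (2 * d - y)) * q y)"
      using neg by (intro AE_I2) auto
    show "AE y in lborel. 0 \<le> - ((i y - i (2 * d - y)) * q y)"
      using nonpos by (intro AE_I2) auto
  qed (use int in auto)
  then show ?thesis using eq by simp
qed

text \<open>
  The contribution is unchanged when the half-distance of the two points and the half-width of the
  slice are exchanged: with an antiderivative \<open>H\<close> of the kernel it is a combination of the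
  values of \<open>H\<close> at the four points \<open>d \<plusminus> b \<plusminus> w\<close>, symmetric in \<open>b\<close> and \<open>w\<close>. For two slices
  of a region this means that the action of each on the ends of the other is equal and opposite.
\<close>

lemma slice_gap_commute:
  assumes h: "h \<noteq> 0" and b: "0 < b" and w: "0 < w"
  shows "slice_gap K h b w d = slice_gap K h w b d"
proof -
  have cont: "isCont (planar_kernel K h) x" for x
    using planar_kernel_continuous[OF h] by (simp add: continuous_on_eq_continuous_at)
  obtain H where H: "\<And>x. (H has_real_derivative planar_kernel K h x) (at x)"
    using einterval_antiderivative[of "-\<infinity>" "\<infinity>" "planar_kernel K h"] cont
    by (auto simp: has_real_derivative_iff_has_vector_derivative)
  have *: "slice_gap K h b w d = (H (d + b + w) - H (d + b - w)) - (H (d - b + w) - H (d - b - w))" if "0 < w" for b w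
  proof -
    have "(\<integral>y. indicator {-w<..<w} y * planar_kernel K h (a - y) \<partial>lborel) = H (a + w) - H (a - w)" for a
    proof -
      have "(\<integral>y. indicator {-w<..<w} y * planar_kernel K h (a - y) \<partial>lborel) = (\<integral>y. indicator {-w..w} y *\<^sub>R planar_kernel K h (a - y) \<partial>lborel)"
        using AE_lborel_singleton[of "-w"] AE_lborel_singleton[of w]
        by (intro integral_cong_AE) (auto simp: indicator_def)
      also have "\<dots> = (- H (a - w)) - (- H (a - (- w)))"
      proof (rule integral_FTC_atLeastAtMost[where F="\<lambda>y. - H (a - y)"])
        have "((\<lambda>y. - H (a - y)) has_real_derivative planar_kernel K h (a - x)) (at x)" for x
          by (auto intro!: derivative_eq_intros DERIV_chain2[OF H])
        then show "((\<lambda>y. - H (a - y)) has_vector_derivative planar_kernel K h (a - x)) (at x within {-w..w})" for x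
          by (simp add: has_real_derivative_iff_has_vector_derivative has_vector_derivative_at_within)
        show "continuous_on {-w..w} (\<lambda>y. planar_kernel K h (a - y))"
          by (rule continuous_on_compose2[OF planar_kernel_continuous[OF h]]) (auto intro!: continuous_intros)
      qed (use that in auto)
      finally show ?thesis by simp
    qed
    then show ?thesis
      unfolding slice_gap_def right_diff_distrib
      by (subst Bochner_Integration.integral_diff) (auto intro!: slice_integrable[OF h, where R=w])
  qed
  show ?thesis using *[OF b, of w] *[OF w, of b] by (simp add: algebra_simps)
qed

text \<open>
  The Euclidean norm is at least the larger coordinate and the kernel decreases, so
  \<open>planar_kernel K h x\<close> is at most \<open>K \<bar>h\<bar>\<close> where \<open>\<bar>x\<bar> \<le> \<bar>h\<bar> \<noteq> 0\<close>, and at most \<open>K \<bar>x\<bar>\<close>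
  elsewhere. Integrating the first bound over \<open>x\<close> gives \<open>2 * \<bar>h\<bar> * K \<bar>h\<bar>\<close>, which is integrable near
  zero; the second bound is the same with exchanged coordinates.
\<close>

lemma nn_integral_planar_kernel_box:
  "(\<integral>\<^sup>+z. indicator ({-R..R} \<times> {-R..R}) z * ennreal (planar_kernel K (fst z) (snd z)) \<partial>lborel) < \<infinity>"
proof -
  define q where "q r = indicator {0<..} r * K r" for r
  have [measurable]: "q \<in> borel_measurable borel" unfolding q_def by simp
  have q0: "0 \<le> q r" for r using kernel_nonneg[of r] by (simp add: q_def indicator_def)
  define G where "G h = indicator {-R..R} h * (2 * \<bar>h\<bar> * q \<bar>h\<bar>)" for h
  have [measurable]: "G \<in> borel_measurable borel" unfolding G_def by measurable
  have G0: "0 \<le> G h" for h using q0[of "\<bar>h\<bar>"] by (simp add: G_def)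
  have int_G: "integrable lborel G"
  proof -
    define g where "g r = indicat_real {0<..<1} r * (K r * r)" for r
    have g: "integrable lborel g"
      using K by (simp add: is_kernel_def set_integrable_def g_def[abs_def])
    have g': "integrable lborel (\<lambda>r. g (- r))"
      using lborel_integrable_real_affine[OF g, of "-1" 0] by simp
    have c: "integrable lborel (\<lambda>r. indicat_real {-R..R} r * (2 * R * K 1))"
      by (intro integrable_mult_left) (cases "0 \<le> R"; simp add: integrable_indicator_iff)
    have "integrable lborel (\<lambda>r. 2 * g r + 2 * g (- r) + indicat_real {-R..R} r * (2 * R * K 1))"
      using g g' c by simp
    then show ?thesis
    proof (rule Bochner_Integration.integrable_bound)
      show "AE h in lborel. norm (G h) \<le> norm (2 * g h + 2 * g (- h) + indicat_real {-R..R} h * (2 * R * K 1))"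
      proof (rule AE_I2)
        fix h :: real
        have g0: "0 \<le> g r" for r using kernel_nonneg[of r] by (simp add: g_def indicator_def)
        have c0: "0 \<le> indicat_real {-R..R} h * (2 * R * K 1)" using kernel_nonneg[of 1] by (auto simp: indicator_def)
        have "G h \<le> 2 * g h + 2 * g (- h) + indicat_real {-R..R} h * (2 * R * K 1)"
        proof (cases "h \<in> {-R..R} \<and> h \<noteq> 0")
          case True
          show ?thesis
          proof (cases "\<bar>h\<bar> < 1")
            case lt: True
            have "G h = 2 * g h + 2 * g (- h)"
              using True lt by (auto simp: G_def g_def q_def indicator_def abs_if)
            then show ?thesis using c0 by simp
          next
            case False
            have "\<bar>h\<bar> * K \<bar>h\<bar> \<le> R * K 1"
              using True False kernel_antimono[of 1 "\<bar>h\<bar>"] kernel_nonneg[of "\<bar>h\<bar>"] by (intro mult_mono) auto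
            then show ?thesis using True g0[of h] g0[of "-h"] by (simp add: G_def q_def)
          qed
        qed (use g0[of h] g0[of "-h"] c0 in \<open>auto simp: G_def\<close>)
        then show "norm (G h) \<le> norm (2 * g h + 2 * g (- h) + indicat_real {-R..R} h * (2 * R * K 1))"
          using G0[of h] by simp
      qed
    qed simp
  qed
  define F where "F h x = ennreal (indicator {-R..R} h * (indicator {-\<bar>h\<bar>..\<bar>h\<bar>} x * q \<bar>h\<bar>))" for h x
  have ind: "indicator {-\<bar>h\<bar>..\<bar>h\<bar>} x = (if \<bar>x\<bar> \<le> \<bar>h\<bar> then 1 else 0)" for h x :: real
    by (auto simp: indicator_def)
  have [measurable]: "(\<lambda>z. F (fst z) (snd z)) \<in> borel_measurable (borel \<Otimes>\<^sub>M borel)"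
    unfolding F_def ind by measurable
  have [measurable]: "(\<lambda>z. F (snd z) (fst z)) \<in> borel_measurable (borel \<Otimes>\<^sub>M borel)"
    unfolding F_def ind by measurable
  have F_h: "(\<integral>\<^sup>+x. F h x \<partial>lborel) = ennreal (G h)" for h
  proof -
    have "(\<integral>\<^sup>+x. F h x \<partial>lborel) = (\<integral>\<^sup>+x. ennreal (indicator {-R..R} h * q \<bar>h\<bar>) * indicator {-\<bar>h\<bar>..\<bar>h\<bar>} x \<partial>lborel)"
      by (intro nn_integral_cong) (auto simp: F_def indicator_def)
    also have "\<dots> = ennreal (indicator {-R..R} h * q \<bar>h\<bar>) * emeasure lborel {-\<bar>h\<bar>..\<bar>h\<bar>}"
      by (rule nn_integral_cmult_indicator) simp
    also have "\<dots> = ennreal (G h)"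
      using q0[of "\<bar>h\<bar>"] by (simp add: G_def mult_ac flip: ennreal_mult)
    finally show ?thesis .
  qed
  have fin: "(\<integral>\<^sup>+h. ennreal (G h) \<partial>lborel) < \<infinity>"
    using int_G G0 by (simp add: integrable_iff_bounded)
  have "(\<integral>\<^sup>+z. indicator ({-R..R} \<times> {-R..R}) z * ennreal (planar_kernel K (fst z) (snd z)) \<partial>lborel)
      \<le> (\<integral>\<^sup>+z. F (fst z) (snd z) + F (snd z) (fst z) \<partial>lborel)"
  proof (intro nn_integral_mono)
    fix z :: "real \<times> real"
    obtain h x where z: "z = (h, x)" by (cases z)
    have bound: "planar_kernel K a b \<le> q \<bar>a\<bar>" if "\<bar>b\<bar> \<le> \<bar>a\<bar>" for a b
    proof (cases "a = 0")
      case False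
      have "\<bar>a\<bar> \<le> sqrt (a\<^sup>2 + b\<^sup>2)" by (rule real_le_rsqrt) simp
      then show ?thesis using False by (auto simp: planar_kernel_def q_def intro!: kernel_antimono)
    qed (use that in \<open>auto simp: planar_kernel_def q_def\<close>)
    have sym: "planar_kernel K h x = planar_kernel K x h" by (simp add: planar_kernel_def add.commute conj_commute)
    show "indicator ({-R..R} \<times> {-R..R}) z * ennreal (planar_kernel K (fst z) (snd z)) \<le> F (fst z) (snd z) + F (snd z) (fst z)"
    proof (cases "h \<in> {-R..R} \<and> x \<in> {-R..R}")
      case True
      show ?thesis
      proof (cases "\<bar>x\<bar> \<le> \<bar>h\<bar>")
        case le: True
        have "ennreal (planar_kernel K h x) \<le> F h x" using True le bound[OF le] by (simp add: F_def ind ennreal_leI)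
        then show ?thesis using True by (simp add: z add_increasing2)
      next
        case False
        then have le: "\<bar>h\<bar> \<le> \<bar>x\<bar>" by simp
        have "ennreal (planar_kernel K h x) \<le> F x h" unfolding sym using True le bound[OF le] by (simp add: F_def ind ennreal_leI)
        then show ?thesis using True by (simp add: z add_increasing)
      qed
    qed (auto simp: z)
  qed
  also have "\<dots> = (\<integral>\<^sup>+z. F (fst z) (snd z) \<partial>lborel) + (\<integral>\<^sup>+z. F (snd z) (fst z) \<partial>lborel)"
    by (intro nn_integral_add) (simp_all flip: borel_prod)
  also have "(\<integral>\<^sup>+z. F (fst z) (snd z) \<partial>lborel) = (\<integral>\<^sup>+h. \<integral>\<^sup>+x. F h x \<partial>lborel \<partial>lborel)"
    by (simp add: lborel.nn_integral_fst[symmetric] flip: lborel_prod)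
  also have "(\<integral>\<^sup>+z. F (snd z) (fst z) \<partial>lborel) = (\<integral>\<^sup>+h. \<integral>\<^sup>+x. F h x \<partial>lborel \<partial>lborel)"
    by (simp add: lborel_pair.nn_integral_snd[symmetric] flip: lborel_prod)
  finally have "(\<integral>\<^sup>+z. indicator ({-R..R} \<times> {-R..R}) z * ennreal (planar_kernel K (fst z) (snd z)) \<partial>lborel)
      \<le> (\<integral>\<^sup>+h. ennreal (G h) \<partial>lborel) + (\<integral>\<^sup>+h. ennreal (G h) \<partial>lborel)"
    by (simp only: F_h)
  also have "\<dots> < \<infinity>" using fin by simp
  finally show ?thesis .
qed

end

section \<open>Potentials of regions with interval slices\<close>

lemma borel_measurable_fst_comp [measurable (raw)]:
  fixes f :: "'a \<Rightarrow> 'b::second_countable_topology \<times> 'c::second_countable_topology"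
  assumes "f \<in> borel_measurable M"
  shows "(\<lambda>x. fst (f x)) \<in> borel_measurable M"
  using assms by (rule borel_measurable_continuous_on[rotated]) (intro continuous_intros)

lemma borel_measurable_snd_comp [measurable (raw)]:
  fixes f :: "'a \<Rightarrow> 'b::second_countable_topology \<times> 'c::second_countable_topology"
  assumes "f \<in> borel_measurable M"
  shows "(\<lambda>x. snd (f x)) \<in> borel_measurable M"
  using assms by (rule borel_measurable_continuous_on[rotated]) (intro continuous_intros)

text \<open>
  Points are given as height first and abscissa second, so that in Fubini's theorem the inner
  integral runs over a slice.
\<close>

definition planar_potential :: "(real \<Rightarrow> real) \<Rightarrow> (real \<times> real) set \<Rightarrow> real \<Rightarrow> real \<Rightarrow> real" where
  "planar_potential K U s x = (\<integral>z. indicator U z * planar_kernel K (s - fst z) (x - snd z) \<partial>lborel)"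

definition sliced_region :: "real \<Rightarrow> real \<Rightarrow> (real \<Rightarrow> real) \<Rightarrow> (real \<Rightarrow> real) \<Rightarrow> (real \<times> real) set" where
  "sliced_region t0 t1 c w = {z. t0 < fst z \<and> fst z < t1 \<and> \<bar>snd z - c (fst z)\<bar> < w (fst z)}"

lemma sliced_region_measurable [measurable]:
  assumes [measurable]: "c \<in> borel_measurable borel" "w \<in> borel_measurable borel"
  shows "sliced_region t0 t1 c w \<in> sets borel"
proof -
  have "{z \<in> space (borel :: (real \<times> real) measure). t0 < fst z \<and> fst z < t1 \<and> \<bar>snd z - c (fst z)\<bar> < w (fst z)} \<in> sets borel"
    by measurable
  then show ?thesis by (simp add: sliced_region_def)
qed

context radial_kernel
begin

lemma nn_planar_potential_le:
  assumes [measurable]: "U \<in> sets borel" and U: "U \<subseteq> {-R..R} \<times> {-R..R}" and z0: "s \<in> {-R..R}" "x \<in> {-R..R}"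
  shows "(\<integral>\<^sup>+z. indicator U z * ennreal (planar_kernel K (s - fst z) (x - snd z)) \<partial>lborel) \<le>
    (\<integral>\<^sup>+z. indicator ({-2*R..2*R} \<times> {-2*R..2*R}) z * ennreal (planar_kernel K (fst z) (snd z)) \<partial>lborel)"
proof -
  define f where "f z = indicator ({-2*R..2*R} \<times> {-2*R..2*R}) z * ennreal (planar_kernel K (fst z) (snd z))" for z
  have [measurable]: "{-2*R..2*R} \<times> {-2*R..2*R} \<in> sets (borel :: (real \<times> real) measure)"
    by (intro borel_closed closed_Times) auto
  have [measurable]: "f \<in> borel_measurable borel" unfolding f_def by measurable
  have "(\<integral>\<^sup>+z. indicator U z * ennreal (planar_kernel K (s - fst z) (x - snd z)) \<partial>lborel) \<le> (\<integral>\<^sup>+z. f ((s, x) + (-1) *\<^sub>R z) \<partial>lborel)"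
    using U z0 by (intro nn_integral_mono) (force simp: f_def indicator_def)
  also have "\<dots> = (\<integral>\<^sup>+z. f z \<partial>lborel)"
    by (subst (2) lborel_affine[of "-1" "(s, x)"]) (simp_all add: nn_integral_density nn_integral_distr)
  finally show ?thesis by (simp add: f_def)
qed

lemma planar_potential_integrable:
  assumes [measurable]: "U \<in> sets borel" and U: "U \<subseteq> {-R..R} \<times> {-R..R}" and z0: "s \<in> {-R..R}" "x \<in> {-R..R}"
  shows "integrable lborel (\<lambda>z. indicator U z * planar_kernel K (s - fst z) (x - snd z))"
proof (rule integrableI_bounded)
  have "(\<integral>\<^sup>+z. ennreal (norm (indicator U z * planar_kernel K (s - fst z) (x - snd z))) \<partial>lborel)
     = (\<integral>\<^sup>+z. indicator U z * ennreal (planar_kernel K (s - fst z) (x - snd z)) \<partial>lborel)"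
    by (intro nn_integral_cong) (auto simp: indicator_def)
  also have "\<dots> < \<infinity>"
    by (rule order_le_less_trans[OF nn_planar_potential_le[OF assms]]) (use nn_integral_planar_kernel_box[of "2 * R"] in simp)
  finally show "(\<integral>\<^sup>+z. ennreal (norm (indicator U z * planar_kernel K (s - fst z) (x - snd z))) \<partial>lborel) < \<infinity>" .
qed measurable

lemma planar_potential_bounded:
  assumes "U \<in> sets borel" "U \<subseteq> {-R..R} \<times> {-R..R}"
  shows "\<exists>C. \<forall>s\<in>{-R..R}. \<forall>x\<in>{-R..R}. \<bar>planar_potential K U s x\<bar> \<le> C \<and>
    (\<integral>\<^sup>+z. ennreal (indicator U z * planar_kernel K (s - fst z) (x - snd z)) \<partial>lborel) \<le> ennreal C"
proof (intro exI ballI)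
  define C where "C = enn2real (\<integral>\<^sup>+z. indicator ({-2*R..2*R} \<times> {-2*R..2*R}) z * ennreal (planar_kernel K (fst z) (snd z)) \<partial>lborel)"
  fix s x assume "s \<in> {-R..R}" "x \<in> {-R..R}"
  note * = assms this
  have C: "ennreal C = (\<integral>\<^sup>+z. indicator ({-2*R..2*R} \<times> {-2*R..2*R}) z * ennreal (planar_kernel K (fst z) (snd z)) \<partial>lborel)"
    using nn_integral_planar_kernel_box[of "2 * R"] by (simp add: C_def)
  have nn: "(\<integral>\<^sup>+z. ennreal (indicator U z * planar_kernel K (s - fst z) (x - snd z)) \<partial>lborel)
     = (\<integral>\<^sup>+z. indicator U z * ennreal (planar_kernel K (s - fst z) (x - snd z)) \<partial>lborel)"
    by (intro nn_integral_cong) (auto simp: indicator_def)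
  also have "\<dots> \<le> ennreal C" unfolding C by (rule nn_planar_potential_le[OF *])
  finally have le: "(\<integral>\<^sup>+z. ennreal (indicator U z * planar_kernel K (s - fst z) (x - snd z)) \<partial>lborel) \<le> ennreal C" .
  have "ennreal (planar_potential K U s x) \<le> ennreal C"
    unfolding planar_potential_def
    by (subst nn_integral_eq_integral[symmetric]) (use le planar_potential_integrable[OF *] in auto)
  moreover have "0 \<le> planar_potential K U s x" unfolding planar_potential_def by simp
  moreover have "0 \<le> C" by (simp add: C_def)
  ultimately show "\<bar>planar_potential K U s x\<bar> \<le> C \<and>
    (\<integral>\<^sup>+z. ennreal (indicator U z * planar_kernel K (s - fst z) (x - snd z)) \<partial>lborel) \<le> ennreal C"
    using le by simp
qed

lemma planar_potential_measurable [measurable]: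
  assumes [measurable]: "U \<in> sets borel" "f \<in> borel_measurable M" "g \<in> borel_measurable M"
  shows "(\<lambda>x. planar_potential K U (f x) (g x)) \<in> borel_measurable M"
  unfolding planar_potential_def by measurable

text \<open>
  Translate the centre of the slice to the origin.
\<close>

lemma slice_gap_of_slice:
  "(\<integral>y. indicator (sliced_region t0 t1 c w) (t, y) * (planar_kernel K h (x0 + b - y) - planar_kernel K h (x0 - b - y)) \<partial>lborel)
     = indicator {t0<..<t1} t * slice_gap K h b (w t) (x0 - c t)"
proof -
  have "(\<integral>y. indicator (sliced_region t0 t1 c w) (t, y) * (planar_kernel K h (x0 + b - y) - planar_kernel K h (x0 - b - y)) \<partial>lborel)
    = (\<integral>y. indicator (sliced_region t0 t1 c w) (t, c t + y) * (planar_kernel K h (x0 + b - (c t + y)) - planar_kernel K h (x0 - b - (c t + y))) \<partial>lborel)"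
    by (subst lborel_integral_real_affine[where c=1 and t="c t"]) auto
  also have "\<dots> = (\<integral>y. indicator {t0<..<t1} t * (indicator {- w t<..<w t} y * (planar_kernel K h (x0 - c t + b - y) - planar_kernel K h (x0 - c t - b - y))) \<partial>lborel)"
    by (intro Bochner_Integration.integral_cong refl) (auto simp: indicator_def sliced_region_def algebra_simps)
  finally show ?thesis by (simp add: slice_gap_def)
qed

lemma potential_gap_eq_slice_gaps:
  assumes [measurable]: "c \<in> borel_measurable borel" "w \<in> borel_measurable borel"
    and U: "sliced_region t0 t1 c w \<subseteq> {-R..R} \<times> {-R..R}"
    and z: "s \<in> {-R..R}" "x0 + b \<in> {-R..R}" "x0 - b \<in> {-R..R}"
  shows "planar_potential K (sliced_region t0 t1 c w) s (x0 + b) - planar_potential K (sliced_region t0 t1 c w) s (x0 - b)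
     = (\<integral>t. indicator {t0<..<t1} t * slice_gap K (s - t) b (w t) (x0 - c t) \<partial>lborel)"
    and "integrable lborel (\<lambda>t. indicator {t0<..<t1} t * slice_gap K (s - t) b (w t) (x0 - c t))"
proof -
  let ?U = "sliced_region t0 t1 c w"
  define f where "f z = indicator ?U z * (planar_kernel K (s - fst z) (x0 + b - snd z) - planar_kernel K (s - fst z) (x0 - b - snd z))" for z
  have int: "integrable lborel f"
    unfolding f_def right_diff_distrib
    by (intro Bochner_Integration.integrable_diff planar_potential_integrable[OF _ U]) (use z in auto)
  then have int': "integrable (lborel \<Otimes>\<^sub>M lborel) f" by (simp add: lborel_prod)
  have slice: "(\<integral>y. f (t, y) \<partial>lborel) = indicator {t0<..<t1} t * slice_gap K (s - t) b (w t) (x0 - c t)" for t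
    unfolding f_def fst_conv snd_conv by (rule slice_gap_of_slice)
  have "planar_potential K ?U s (x0 + b) - planar_potential K ?U s (x0 - b) = (\<integral>z. f z \<partial>lborel)"
    unfolding planar_potential_def f_def right_diff_distrib
    by (subst Bochner_Integration.integral_diff) (use z in \<open>auto intro!: planar_potential_integrable[OF _ U]\<close>)
  also have "\<dots> = (\<integral>t. \<integral>y. f (t, y) \<partial>lborel \<partial>lborel)"
    using lborel_pair.integral_fst'[OF int'] by (simp add: lborel_prod)
  finally show "planar_potential K ?U s (x0 + b) - planar_potential K ?U s (x0 - b)
     = (\<integral>t. indicator {t0<..<t1} t * slice_gap K (s - t) b (w t) (x0 - c t) \<partial>lborel)"
    by (simp add: slice)
  show "integrable lborel (\<lambda>t. indicator {t0<..<t1} t * slice_gap K (s - t) b (w t) (x0 - c t))"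
    using lborel_pair.integrable_fst'[OF int'] by (simp add: slice)
qed

text \<open>
  All slices are centred to the right of \<open>x0\<close>, so each of them favours the right point.
\<close>

lemma potential_gap_pos:
  assumes [measurable]: "c \<in> borel_measurable borel" "w \<in> borel_measurable borel"
    and U: "sliced_region t0 t1 c w \<subseteq> {-R..R} \<times> {-R..R}"
    and z: "s \<in> {-R..R}" "x0 + b \<in> {-R..R}" "x0 - b \<in> {-R..R}"
    and t01: "t0 < t1" and b: "0 < b"
    and w: "\<And>t. t0 < t \<Longrightarrow> t < t1 \<Longrightarrow> 0 < w t"
    and c: "\<And>t. t0 < t \<Longrightarrow> t < t1 \<Longrightarrow> x0 < c t"
  shows "planar_potential K (sliced_region t0 t1 c w) s (x0 - b) < planar_potential K (sliced_region t0 t1 c w) s (x0 + b)"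
proof -
  have pos: "0 < slice_gap K (s - t) b (w t) (x0 - c t)" if "t0 < t" "t < t1" "t \<noteq> s" for t
    using slice_gap_neg[of "s - t" b "w t" "c t - x0"] slice_gap_minus[of "s - t" b "w t" "c t - x0"]
      that b w[of t] c[of t] by simp
  have "AE t in lborel. t \<noteq> s" by (rule AE_lborel_singleton)
  then have "AE t in lborel. t \<in> {t0<..<t1} \<longrightarrow> 0 < indicator {t0<..<t1} t * slice_gap K (s - t) b (w t) (x0 - c t)"
    and "AE t in lborel. 0 \<le> indicator {t0<..<t1} t * slice_gap K (s - t) b (w t) (x0 - c t)"
    by (eventually_elim; use pos in \<open>fastforce simp: indicator_def intro: less_imp_le\<close>)+
  then have "0 < (\<integral>t. indicator {t0<..<t1} t * slice_gap K (s - t) b (w t) (x0 - c t) \<partial>lborel)"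
    using t01 by (intro integral_pos_if_pos_on[OF potential_gap_eq_slice_gaps(2)[OF assms(1-6)], of "{t0<..<t1}"]) auto
  then show ?thesis
    unfolding potential_gap_eq_slice_gaps(1)[OF assms(1-6), symmetric] by simp
qed

text \<open>
  The strictness of the Steiner symmetrization inequality. The integral in the last hypothesis is the
  integral of \<open>c s * J s t\<close> over all pairs of heights, where \<open>J s t\<close> is the contribution of the
  slice at height \<open>t\<close> to the difference of the potentials at the ends of the slice at height \<open>s\<close>. Since \<open>J\<close> is
  antisymmetric, exchanging \<open>s\<close> and \<open>t\<close> turns this into half the integral of \<open>(c s - c t) * J s t\<close>,
  whose integrand is never positive and is negative on \<open>{\<alpha><..<\<beta>} \<times> {\<alpha><..<\<beta>}\<close> off the diagonal.
\<close>

lemma slice_centers_not_injective: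
  assumes c [measurable]: "c \<in> borel_measurable borel" and [measurable]: "w \<in> borel_measurable borel"
    and U: "sliced_region t0 t1 c w \<subseteq> {-R..R} \<times> {-R..R}"
    and s_bd: "\<And>s. s \<in> {t0<..<t1} \<Longrightarrow> \<bar>s\<bar> \<le> R" and x_bd: "\<And>s. s \<in> {t0<..<t1} \<Longrightarrow> \<bar>c s\<bar> + w s \<le> R"
    and w: "\<And>t. t \<in> {t0<..<t1} \<Longrightarrow> 0 < w t"
    and ab: "{\<alpha><..<\<beta>} \<subseteq> {t0<..<t1}" "\<alpha> < \<beta>" and inj: "inj_on c {\<alpha><..<\<beta>}"
    and zero: "(\<integral>s. indicator {t0<..<t1} s * (c s * (planar_potential K (sliced_region t0 t1 c w) s (c s + w s) -
        planar_potential K (sliced_region t0 t1 c w) s (c s - w s))) \<partial>lborel) = 0"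
  shows False
proof -
  let ?U = "sliced_region t0 t1 c w" and ?I = "{t0<..<t1}"
  define J where "J s t = slice_gap K (s - t) (w s) (w t) (c s - c t)" for s t
  define f where "f z = indicator ?I (fst z) * indicator ?I (snd z) * (c (fst z) * J (fst z) (snd z))" for z
  have [measurable]: "(\<lambda>z. J (fst z) (snd z)) \<in> borel_measurable (borel \<Otimes>\<^sub>M borel)"
  proof -
    have ind: "indicator {- a<..<a} y = (if \<bar>y\<bar> < a then 1 else 0::real)" for a y :: real by (auto simp: indicator_def)
    show ?thesis unfolding J_def slice_gap_def ind by measurable
  qed
  have f_meas [measurable]: "f \<in> borel_measurable (borel \<Otimes>\<^sub>M borel)"
    unfolding f_def by measurable
  obtain C where C: "\<And>s x. s \<in> {-R..R} \<Longrightarrow> x \<in> {-R..R} \<Longrightarrow>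
    (\<integral>\<^sup>+z. ennreal (indicator ?U z * planar_kernel K (s - fst z) (x - snd z)) \<partial>lborel) \<le> ennreal C"
    using planar_potential_bounded[OF sliced_region_measurable[OF assms(1,2)] U] by blast
  have in_box: "s \<in> {-R..R}" "c s + w s \<in> {-R..R}" "c s - w s \<in> {-R..R}" if "s \<in> ?I" for s
    using s_bd[OF that] x_bd[OF that] w[OF that] by (auto simp: abs_if split: if_splits)
  have slice_le: "ennreal (indicator ?I t * \<bar>J s t\<bar>) \<le>
      (\<integral>\<^sup>+y. ennreal (indicator ?U (t, y) * planar_kernel K (s - t) (c s + w s - y)) +
         ennreal (indicator ?U (t, y) * planar_kernel K (s - t) (c s - w s - y)) \<partial>lborel)" for s t
  proof -
    define g where "g y = indicator ?U (t, y) * (planar_kernel K (s - t) (c s + w s - y) - planar_kernel K (s - t) (c s - w s - y))" for y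
    have "indicator ?I t * J s t = (\<integral>y. g y \<partial>lborel)"
      unfolding g_def J_def by (rule slice_gap_of_slice[symmetric])
    then have "ennreal (indicator ?I t * \<bar>J s t\<bar>) = ennreal (norm (\<integral>y. g y \<partial>lborel))"
      by (metis abs_indicator abs_mult real_norm_def)
    also have "\<dots> \<le> (\<integral>\<^sup>+y. norm (g y) \<partial>lborel)"
      using integral_norm_bound_ennreal[of lborel g] by (cases "integrable lborel g") (auto simp: not_integrable_integral_eq)
    also have "\<dots> \<le> (\<integral>\<^sup>+y. ennreal (indicator ?U (t, y) * planar_kernel K (s - t) (c s + w s - y)) +
         ennreal (indicator ?U (t, y) * planar_kernel K (s - t) (c s - w s - y)) \<partial>lborel)"
    proof (intro nn_integral_mono)
      fix y
      have "norm (g y) \<le> indicator ?U (t, y) * planar_kernel K (s - t) (c s + w s - y) + indicator ?U (t, y) * planar_kernel K (s - t) (c s - w s - y)"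
        by (auto simp: g_def indicator_def intro: order_trans[OF abs_triangle_ineq4])
      then show "ennreal (norm (g y)) \<le> ennreal (indicator ?U (t, y) * planar_kernel K (s - t) (c s + w s - y)) +
         ennreal (indicator ?U (t, y) * planar_kernel K (s - t) (c s - w s - y))"
        by (auto dest: ennreal_leI)
    qed
    finally show ?thesis .
  qed
  have int_f: "integrable (lborel \<Otimes>\<^sub>M lborel) f"
  proof (rule integrableI_bounded)
    have "(\<integral>\<^sup>+z. ennreal (norm (f z)) \<partial>(lborel \<Otimes>\<^sub>M lborel)) = (\<integral>\<^sup>+s. \<integral>\<^sup>+t. ennreal (norm (f (s, t))) \<partial>lborel \<partial>lborel)"
      by (subst lborel.nn_integral_fst[symmetric]) auto
    also have "\<dots> \<le> (\<integral>\<^sup>+s. ennreal (R * (2 * C)) * indicator ?I s \<partial>lborel)"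
    proof (intro nn_integral_mono)
      fix s
      show "(\<integral>\<^sup>+t. ennreal (norm (f (s, t))) \<partial>lborel) \<le> ennreal (R * (2 * C)) * indicator ?I s"
      proof (cases "s \<in> ?I")
        case True
        have cs: "\<bar>c s\<bar> \<le> R" using x_bd[OF True] w[OF True] by linarith
        let ?k = "\<lambda>x z. ennreal (indicator ?U z * planar_kernel K (s - fst z) (x - snd z))"
        have km: "?k x \<in> borel_measurable borel" for x by measurable
        then have [measurable]: "?k x \<in> borel_measurable (borel \<Otimes>\<^sub>M borel)" for x
          unfolding borel_prod .
        have "(\<integral>\<^sup>+t. (\<integral>\<^sup>+y. ?k (c s + w s) (t, y) + ?k (c s - w s) (t, y) \<partial>lborel) \<partial>lborel) = (\<integral>\<^sup>+z. ?k (c s + w s) z + ?k (c s - w s) z \<partial>lborel)"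
          unfolding lborel_prod[symmetric] by (rule lborel.nn_integral_fst) measurable
        also have "\<dots> = (\<integral>\<^sup>+z. ?k (c s + w s) z \<partial>lborel) + (\<integral>\<^sup>+z. ?k (c s - w s) z \<partial>lborel)"
          by (rule nn_integral_add) (use km in simp_all)
        also have "\<dots> \<le> ennreal C + ennreal C"
          by (intro add_mono C in_box True)
        also have "ennreal C + ennreal C = ennreal (2 * C)"
        proof -
          have "2 * ennreal C = ennreal 2 * ennreal C" by simp
          also have "\<dots> = ennreal (2 * C)" by (rule ennreal_mult'[symmetric]) simp
          finally show ?thesis by (simp only: mult_2)
        qed
        finally have k_le: "(\<integral>\<^sup>+t. (\<integral>\<^sup>+y. ?k (c s + w s) (t, y) + ?k (c s - w s) (t, y) \<partial>lborel) \<partial>lborel) \<le> ennreal (2 * C)" .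
        have "(\<integral>\<^sup>+t. ennreal (norm (f (s, t))) \<partial>lborel) \<le> (\<integral>\<^sup>+t. ennreal R * ennreal (indicator ?I t * \<bar>J s t\<bar>) \<partial>lborel)"
        proof (intro nn_integral_mono)
          fix t
          have "norm (f (s, t)) \<le> R * (indicator ?I t * \<bar>J s t\<bar>)"
            using True cs by (auto simp: f_def indicator_def abs_mult intro!: mult_right_mono)
          then show "ennreal (norm (f (s, t))) \<le> ennreal R * ennreal (indicator ?I t * \<bar>J s t\<bar>)"
            using cs by (subst ennreal_mult[symmetric]) (auto intro: ennreal_leI)
        qed
        also have "\<dots> \<le> (\<integral>\<^sup>+t. ennreal R * (\<integral>\<^sup>+y. ?k (c s + w s) (t, y) + ?k (c s - w s) (t, y) \<partial>lborel) \<partial>lborel)"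
          using slice_le by (intro nn_integral_mono mult_left_mono) auto
        also have "\<dots> = ennreal R * (\<integral>\<^sup>+t. (\<integral>\<^sup>+y. ?k (c s + w s) (t, y) + ?k (c s - w s) (t, y) \<partial>lborel) \<partial>lborel)"
          by (intro nn_integral_cmult) measurable
        also have "\<dots> \<le> ennreal R * ennreal (2 * C)"
          using k_le by (rule mult_left_mono) simp
        also have "\<dots> = ennreal (R * (2 * C)) * indicator ?I s"
          using True cs ennreal_mult'[of R "2 * C"] by simp
        finally show ?thesis .
      qed (simp add: f_def)
    qed
    also have "\<dots> < \<infinity>"
      by (cases "t0 \<le> t1") (simp_all add: nn_integral_cmult_indicator ennreal_mult_less_top)
    finally show "(\<integral>\<^sup>+z. ennreal (norm (f z)) \<partial>(lborel \<Otimes>\<^sub>M lborel)) < \<infinity>" .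
  qed simp
  \<comment> \<open>minus twice the symmetrization of \<open>f\<close>\<close>
  define q where "q z = indicator ?I (fst z) * indicator ?I (snd z) * - ((c (fst z) - c (snd z)) * J (fst z) (snd z))" for z
  have swap: "J t s = - J s t" if "s \<in> ?I" "t \<in> ?I" for s t
  proof (cases "s = t")
    case True
    then show ?thesis using slice_gap_minus[of 0 "w s" "w s" 0] by (simp add: J_def)
  next
    case False
    have "J t s = slice_gap K (s - t) (w t) (w s) (c t - c s)"
      by (simp add: J_def slice_gap_def planar_kernel_minus_commute[of K t s])
    also have "\<dots> = - slice_gap K (s - t) (w t) (w s) (c s - c t)"
      using slice_gap_minus[of "s - t" "w t" "w s" "c s - c t"] by simp
    also have "\<dots> = - J s t"
      using False w that by (simp add: J_def slice_gap_commute[of "s - t" "w t" "w s"])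
    finally show ?thesis .
  qed
  have q: "q z = - (f z + f (snd z, fst z))" for z
    using swap[of "fst z" "snd z"] by (cases "fst z \<in> ?I \<and> snd z \<in> ?I") (auto simp: q_def f_def algebra_simps)
  have int_swap: "integrable (lborel \<Otimes>\<^sub>M lborel) (\<lambda>z. f (snd z, fst z))"
    using lborel_pair.integrable_product_swap[OF int_f] by (simp add: case_prod_unfold)
  have int_q: "integrable (lborel \<Otimes>\<^sub>M lborel) q"
    unfolding q[abs_def] using int_f int_swap by simp
  have "(\<integral>z. f z \<partial>(lborel \<Otimes>\<^sub>M lborel)) = (\<integral>s. \<integral>t. f (s, t) \<partial>lborel \<partial>lborel)"
    by (rule lborel_pair.integral_fst'[OF int_f, symmetric])
  also have "\<dots> = (\<integral>s. indicator ?I s * (c s * (planar_potential K ?U s (c s + w s) - planar_potential K ?U s (c s - w s))) \<partial>lborel)"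
  proof (intro Bochner_Integration.integral_cong refl)
    fix s
    show "(\<integral>t. f (s, t) \<partial>lborel) = indicator ?I s * (c s * (planar_potential K ?U s (c s + w s) - planar_potential K ?U s (c s - w s)))"
    proof (cases "s \<in> ?I")
      case True
      have "(\<integral>t. f (s, t) \<partial>lborel) = (\<integral>t. c s * (indicator ?I t * slice_gap K (s - t) (w s) (w t) (c s - c t)) \<partial>lborel)"
        using True by (intro Bochner_Integration.integral_cong refl) (simp add: f_def J_def)
      then show ?thesis
        using True by (simp add: potential_gap_eq_slice_gaps(1)[OF assms(1-3) in_box[OF True]])
    qed (simp add: f_def)
  qed
  finally have "(\<integral>z. f z \<partial>(lborel \<Otimes>\<^sub>M lborel)) = 0" using zero by simp
  moreover have "(\<integral>z. f (snd z, fst z) \<partial>(lborel \<Otimes>\<^sub>M lborel)) = (\<integral>z. f z \<partial>(lborel \<Otimes>\<^sub>M lborel))"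
    using lborel_pair.integral_product_swap[of f] int_f by (simp add: case_prod_unfold)
  ultimately have "(\<integral>z. q z \<partial>(lborel \<Otimes>\<^sub>M lborel)) = 0"
    unfolding q using int_f int_swap by simp
  moreover have "0 < (\<integral>z. q z \<partial>(lborel \<Otimes>\<^sub>M lborel))"
  proof -
    have pos: "0 < - ((c s - c t) * J s t)" if I: "s \<in> ?I" "t \<in> ?I" and ne: "c s \<noteq> c t" for s t
    proof -
      have st: "s - t \<noteq> 0" using ne by auto
      consider "0 < c s - c t" | "0 < c t - c s" using ne by linarith
      then show ?thesis
      proof cases
        case 1
        then have "J s t < 0" unfolding J_def by (intro slice_gap_neg st w I)
        then show ?thesis using 1 by (simp add: mult_pos_neg)
      next
        case 2
        then have "slice_gap K (s - t) (w s) (w t) (c t - c s) < 0" by (intro slice_gap_neg st w I)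
        then have "0 < J s t" using slice_gap_minus[of "s - t" "w s" "w t" "c t - c s"] by (simp add: J_def)
        then show ?thesis using 2 by (simp add: mult_neg_pos)
      qed
    qed
    \<comment> \<open>a rectangle in the square \<open>{\<alpha><..<\<beta>} \<times> {\<alpha><..<\<beta>}\<close> that avoids the diagonal\<close>
    define m where "m = (\<alpha> + \<beta>) / 2"
    let ?A = "{\<alpha><..<m} \<times> {m<..<\<beta>}"
    have m: "\<alpha> < m" "m < \<beta>" using ab by (auto simp: m_def)
    show ?thesis
    proof (rule integral_pos_if_pos_on[OF int_q])
      show "AE z in lborel \<Otimes>\<^sub>M lborel. 0 \<le> q z"
      proof (rule AE_I2)
        fix z
        show "0 \<le> q z"
          using pos[of "fst z" "snd z"]
          by (cases "fst z \<in> ?I \<and> snd z \<in> ?I \<and> c (fst z) \<noteq> c (snd z)") (auto simp: q_def)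
      qed
      show "AE z in lborel \<Otimes>\<^sub>M lborel. z \<in> ?A \<longrightarrow> 0 < q z"
      proof (rule AE_I2, rule impI)
        fix z assume z: "z \<in> ?A"
        then have ab': "fst z \<in> {\<alpha><..<\<beta>}" "snd z \<in> {\<alpha><..<\<beta>}" "fst z \<noteq> snd z" using m by auto
        then have "fst z \<in> ?I" "snd z \<in> ?I" using ab(1) by blast+
        moreover have "c (fst z) \<noteq> c (snd z)" using inj_onD[OF inj _ ab'(1,2)] ab'(3) by blast
        ultimately show "0 < q z" using pos[of "fst z" "snd z"] by (simp add: q_def)
      qed
      show "?A \<in> sets (lborel \<Otimes>\<^sub>M lborel)" by simp
      show "emeasure (lborel \<Otimes>\<^sub>M lborel) ?A \<noteq> 0"
        using m by (subst lborel.emeasure_pair_measure_Times) auto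
    qed
  qed
  ultimately show False by simp
qed

end

section \<open>Orthonormal frames and the inside of a sliced curve\<close>

definition rot90 :: "real^2 \<Rightarrow> real^2" where
  "rot90 v = vector [- v$2, v$1]"

text \<open>
  Twice the signed area of the triangle \<open>ABC\<close>.
\<close>

abbreviation orient :: "real^2 \<Rightarrow> real^2 \<Rightarrow> real^2 \<Rightarrow> real" where
  "orient A B C \<equiv> (C - A) \<bullet> rot90 (B - A)"

text \<open>
  Both signs of \<open>f\<close> are allowed, so that a given vertex can be placed at positive height
  whatever the orientation of the polygon.
\<close>

locale orthonormal_frame =
  fixes Q e f :: "real^2"
  assumes norm_e: "norm e = 1" and f: "f = rot90 e \<or> f = - rot90 e"
begin

definition pt :: "real \<Rightarrow> real \<Rightarrow> real^2" where
  "pt s x = Q + x *\<^sub>R e + s *\<^sub>R f"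

definition height :: "real^2 \<Rightarrow> real" where "height z = (z - Q) \<bullet> f"
definition abscissa :: "real^2 \<Rightarrow> real" where "abscissa z = (z - Q) \<bullet> e"

lemma e_sq: "e$1 * e$1 + e$2 * e$2 = 1"
  using norm_e by (simp add: norm_eq_1 inner_vec_def sum_2)

lemma inner_frame: "e \<bullet> e = 1" "f \<bullet> f = 1" "e \<bullet> f = 0" "f \<bullet> e = 0"
  using f e_sq by (auto simp: rot90_def inner_vec_def sum_2)

lemma norm_f: "norm f = 1"
  by (simp add: norm_eq_1 inner_frame)

lemma height_pt [simp]: "height (pt s x) = s" and abscissa_pt [simp]: "abscissa (pt s x) = x"
  by (simp_all add: height_def abscissa_def pt_def inner_add_left inner_frame)

lemma pt_coords [simp]: "pt (height z) (abscissa z) = z"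
proof -
  have "v = (v \<bullet> e) *\<^sub>R e + (v \<bullet> f) *\<^sub>R f" for v
  proof -
    have "(v$1 * e$1 + v$2 * e$2) * e$1 + (- (v$1 * e$2) + v$2 * e$1) * (- e$2) = v$1"
      "(v$1 * e$1 + v$2 * e$2) * e$2 + (- (v$1 * e$2) + v$2 * e$1) * e$1 = v$2"
      using e_sq by algebra+
    then show ?thesis
      using f by (auto simp: vec_eq_iff forall_2 rot90_def inner_vec_def sum_2 algebra_simps)
  qed
  from this[of "z - Q"] show ?thesis by (simp add: pt_def height_def abscissa_def algebra_simps)
qed

lemma pt_eq_iff [simp]: "pt s x = pt s' x' \<longleftrightarrow> s = s' \<and> x = x'"
  by (metis height_pt abscissa_pt)

lemma dist_pt: "dist (pt s x) (pt s' x') = sqrt ((s - s')\<^sup>2 + (x - x')\<^sup>2)"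
proof -
  have "pt s x - pt s' x' = (x - x') *\<^sub>R e + (s - s') *\<^sub>R f" by (simp add: pt_def algebra_simps)
  then show ?thesis
    unfolding dist_norm norm_eq_sqrt_inner
    by (simp add: inner_add_left inner_add_right inner_frame power2_eq_square add.commute)
qed

lemma pt_affine: "pt s x + t *\<^sub>R (pt s' x' - pt s x) = pt (s + t * (s' - s)) (x + t * (x' - x))"
  by (simp add: pt_def algebra_simps)

lemma in_segment_pt:
  "pt s x \<in> closed_segment (pt s1 x1) (pt s2 x2) \<longleftrightarrow> (\<exists>t\<in>{0..1}. s = s1 + t * (s2 - s1) \<and> x = x1 + t * (x2 - x1))"
  unfolding closed_segment_param image_iff pt_affine pt_eq_iff by auto

lemma in_segment_horizontal:
  "x1 \<le> x2 \<Longrightarrow> pt s x \<in> closed_segment (pt s1 x1) (pt s1 x2) \<longleftrightarrow> s = s1 \<and> x1 \<le> x \<and> x \<le> x2"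
proof
  assume le: "x1 \<le> x2"
  { assume "pt s x \<in> closed_segment (pt s1 x1) (pt s1 x2)"
    then obtain t where t: "0 \<le> t" "t \<le> 1" "s = s1" "x = x1 + t * (x2 - x1)" by (auto simp: in_segment_pt)
    then show "s = s1 \<and> x1 \<le> x \<and> x \<le> x2"
      using le mult_left_le_one_le[of "x2 - x1" t] by auto }
  { assume x: "s = s1 \<and> x1 \<le> x \<and> x \<le> x2"
    show "pt s x \<in> closed_segment (pt s1 x1) (pt s1 x2)"
    proof (cases "x1 = x2")
      case False
      then show ?thesis using x le unfolding in_segment_pt
        by (intro bexI[of _ "(x - x1) / (x2 - x1)"]) auto
    qed (use x in auto) }
qed

lemma in_segment_graph:
  assumes "s1 < s2"
  shows "pt s x \<in> closed_segment (pt s1 x1) (pt s2 x2) \<longleftrightarrow>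
    s1 \<le> s \<and> s \<le> s2 \<and> x = x1 + (x2 - x1) * ((s - s1) / (s2 - s1))"
proof
  assume "pt s x \<in> closed_segment (pt s1 x1) (pt s2 x2)"
  then obtain t where t: "0 \<le> t" "t \<le> 1" "s = s1 + t * (s2 - s1)" "x = x1 + t * (x2 - x1)"
    by (auto simp: in_segment_pt)
  have "(s - s1) / (s2 - s1) = t" using t assms by simp
  moreover have "t * (s2 - s1) \<le> s2 - s1" "0 \<le> t * (s2 - s1)"
    using t(1,2) assms mult_left_le_one_le[of "s2 - s1" t] by simp_all
  then have "s1 \<le> s" "s \<le> s2" using t(3) by linarith+
  ultimately show "s1 \<le> s \<and> s \<le> s2 \<and> x = x1 + (x2 - x1) * ((s - s1) / (s2 - s1))"
    using t(4) by (simp add: mult.commute)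
next
  assume "s1 \<le> s \<and> s \<le> s2 \<and> x = x1 + (x2 - x1) * ((s - s1) / (s2 - s1))"
  then show "pt s x \<in> closed_segment (pt s1 x1) (pt s2 x2)"
    using assms unfolding in_segment_pt by (intro bexI[of _ "(s - s1) / (s2 - s1)"]) auto
qed

lemma continuous_height [continuous_intros]: "continuous_on A g \<Longrightarrow> continuous_on A (\<lambda>z. height (g z))"
  and continuous_abscissa [continuous_intros]: "continuous_on A g \<Longrightarrow> continuous_on A (\<lambda>z. abscissa (g z))"
  unfolding height_def abscissa_def by (auto intro!: continuous_intros)

lemma pt_measurable [measurable]: "(\<lambda>z. pt (fst z) (snd z)) \<in> borel_measurable borel"
  unfolding pt_def by (intro borel_measurable_continuous_onI continuous_intros)

lemma distr_vector_lborel: "distr lborel borel (\<lambda>z. vector [fst z, snd z] :: real^2) = lborel"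
proof (rule lborel_eqI[symmetric])
  have cont: "continuous_on UNIV (\<lambda>z::real \<times> real. vector [fst z, snd z] :: real^2)"
    by (subst continuous_on_componentwise) (auto simp: Basis_vec_def UNIV_2 inner_axis intro!: continuous_intros)
  then have [measurable]: "(\<lambda>z::real \<times> real. vector [fst z, snd z] :: real^2) \<in> borel_measurable borel"
    by (rule borel_measurable_continuous_onI)
  fix l u :: "real^2"
  assume lu: "\<And>b. b \<in> Basis \<Longrightarrow> l \<bullet> b \<le> u \<bullet> b"
  have Basis2: "Basis = {axis 1 1, axis 2 1 :: real^2}" by (auto simp: Basis_vec_def UNIV_2)
  have ne: "axis 1 1 \<noteq> (axis 2 1 :: real^2)" by (simp add: axis_eq_axis)
  have le: "l$1 \<le> u$1" "l$2 \<le> u$2" using lu[of "axis 1 1"] lu[of "axis 2 1"] by (auto simp: inner_axis Basis2)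
  have "(\<lambda>z. vector [fst z, snd z] :: real^2) -` box l u = {l$1<..<u$1} \<times> {l$2<..<u$2}"
    by (auto simp: mem_box_cart forall_2)
  then have "emeasure (distr lborel borel (\<lambda>z. vector [fst z, snd z] :: real^2)) (box l u) = emeasure (lborel \<Otimes>\<^sub>M lborel) ({l$1<..<u$1} \<times> {l$2<..<u$2})"
    by (subst emeasure_distr) (auto simp: lborel_prod)
  also have "\<dots> = ennreal (u$1 - l$1) * ennreal (u$2 - l$2)"
    using le by (subst lborel.emeasure_pair_measure_Times) auto
  also have "\<dots> = ennreal (\<Prod>b\<in>Basis. (u - l) \<bullet> b)"
    using le ne by (simp add: Basis2 inner_axis ennreal_mult)
  finally show "emeasure (distr lborel borel (\<lambda>z. vector [fst z, snd z] :: real^2)) (box l u) = ennreal (\<Prod>b\<in>Basis. (u - l) \<bullet> b)" .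
qed simp

lemma distr_orthogonal_lborel:
  fixes T :: "real^2 \<Rightarrow> real^2"
  assumes T: "orthogonal_transformation T"
  shows "distr lborel borel T = lborel"
proof (rule lborel_eqI[symmetric])
  have T_cont: "continuous_on UNIV T"
    using T by (simp add: linear_continuous_on linear_linear orthogonal_transformation_linear)
  then have [measurable]: "T \<in> borel_measurable borel" by (rule borel_measurable_continuous_onI)
  fix l u :: "real^2"
  assume lu: "\<And>b. b \<in> Basis \<Longrightarrow> l \<bullet> b \<le> u \<bullet> b"
  have bij: "bij T" using T by (rule orthogonal_transformation_bij)
  have invT: "orthogonal_transformation (inv T)" using T by (rule orthogonal_transformation_inv)
  have pre: "T -` box l u = inv T ` box l u" using bij by (rule bij_vimage_eq_inv_image)
  have "T -` box l u \<in> lmeasurable" unfolding pre by (intro measurable_orthogonal_image invT) auto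
  then have "emeasure lebesgue (T -` box l u) = ennreal (measure lebesgue (T -` box l u))"
    by (rule emeasure_eq_measure2)
  moreover have "T -` box l u \<in> sets borel" using measurable_sets[of T borel borel "box l u"] by simp
  then have "emeasure lebesgue (T -` box l u) = emeasure lborel (T -` box l u)" by simp
  ultimately have "emeasure lborel (T -` box l u) = ennreal (measure lebesgue (T -` box l u))" by simp
  also have "\<dots> = ennreal (measure lebesgue (box l u))"
    unfolding pre by (subst measure_orthogonal_image[OF invT]) auto
  also have "\<dots> = ennreal (\<Prod>b\<in>Basis. (u - l) \<bullet> b)"
    using lu by (simp add: measure_completion measure_lborel_box_eq)
  finally show "emeasure (distr lborel borel T) (box l u) = ennreal (\<Prod>b\<in>Basis. (u - l) \<bullet> b)"
    by (subst emeasure_distr) auto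
qed simp

text \<open>
  The chart is a composition of the identification of \<open>\<real> \<times> \<real>\<close> with \<open>real^2\<close>, an orthogonal
  transformation and a translation, and each of them preserves Lebesgue measure.
\<close>

lemma distr_pt_lborel: "distr lborel borel (\<lambda>z. pt (fst z) (snd z)) = lborel"
proof -
  define T where "T v = v$2 *\<^sub>R e + v$1 *\<^sub>R f" for v :: "real^2"
  have T: "orthogonal_transformation T"
    unfolding orthogonal_transformation_def
  proof (intro conjI allI)
    show "linear T" unfolding T_def by (intro linearI) (auto simp: algebra_simps)
    show "T v \<bullet> T w = v \<bullet> w" for v w
    proof -
      have "T v \<bullet> T w = v$1 * w$1 + v$2 * w$2"
        by (simp add: T_def inner_add_left inner_add_right inner_frame)
      then show ?thesis by (simp add: inner_vec_def sum_2)
    qed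
  qed
  have [measurable]: "T \<in> borel_measurable borel"
    using T by (intro borel_measurable_continuous_onI linear_continuous_on)
      (simp add: linear_linear orthogonal_transformation_linear)
  have cont: "continuous_on UNIV (\<lambda>z::real \<times> real. vector [fst z, snd z] :: real^2)"
    by (subst continuous_on_componentwise) (auto simp: Basis_vec_def UNIV_2 inner_axis intro!: continuous_intros)
  then have [measurable]: "(\<lambda>z::real \<times> real. vector [fst z, snd z] :: real^2) \<in> borel_measurable borel"
    by (rule borel_measurable_continuous_onI)
  have "lborel = distr (distr (distr lborel borel (\<lambda>z. vector [fst z, snd z])) borel T) borel ((+) Q)"
    by (simp only: distr_vector_lborel distr_orthogonal_lborel[OF T] lborel_distr_plus)
  also have "\<dots> = distr lborel borel (\<lambda>z. pt (fst z) (snd z))"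
    by (simp add: distr_distr comp_def T_def pt_def add.assoc)
  finally show ?thesis by simp
qed

text \<open>
  The complement of \<open>\<Gamma>\<close> is the disjoint union of the open sliced region \<open>V\<close> and an open set \<open>X\<close>.
  A component that meets \<open>V\<close> stays in \<open>V\<close> and is bounded. From a point of \<open>X\<close> the
  horizontal ray pointing away from the centre of the slice never meets \<open>\<Gamma>\<close>, so its component is
  unbounded.
\<close>

lemma inside_eq_sliced_region:
  assumes c: "continuous_on UNIV c" and w: "continuous_on UNIV w"
    and U: "sliced_region t0 t1 c w \<subseteq> {-R..R} \<times> {-R..R}"
    and \<Gamma>: "\<And>s x. pt s x \<in> \<Gamma> \<longleftrightarrow> t0 \<le> s \<and> s \<le> t1 \<and> \<bar>x - c s\<bar> \<le> w s \<and> (s = t0 \<or> s = t1 \<or> \<bar>x - c s\<bar> = w s)"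
  shows "pt s x \<in> inside \<Gamma> \<longleftrightarrow> (s, x) \<in> sliced_region t0 t1 c w"
proof
  define V where "V = {z. t0 < height z} \<inter> {z. height z < t1} \<inter> {z. \<bar>abscissa z - c (height z)\<bar> < w (height z)}"
  define X where "X = {z. height z < t0} \<union> {z. t1 < height z} \<union> {z. w (height z) < \<bar>abscissa z - c (height z)\<bar>}"
  note [continuous_intros] = continuous_on_compose2[OF c] continuous_on_compose2[OF w]
  have "open V" "open X"
    unfolding V_def X_def by (auto intro!: open_Int open_Un open_Collect_less continuous_intros)
  have \<Gamma>_compl: "- \<Gamma> = V \<union> X"
  proof -
    have "z \<in> \<Gamma> \<longleftrightarrow> z \<notin> V \<union> X" for z
      using \<Gamma>[of "height z" "abscissa z"] by (auto simp: V_def X_def)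
    then show ?thesis by blast
  qed
  have VX: "V \<inter> X = {}" by (auto simp: V_def X_def)
  {
    assume z: "(s, x) \<in> sliced_region t0 t1 c w"
    let ?C = "connected_component_set (- \<Gamma>) (pt s x)"
    have zV: "pt s x \<in> V" using z by (simp add: V_def sliced_region_def)
    then have mem: "pt s x \<in> ?C" using \<Gamma>_compl by simp
    have "?C \<subseteq> V \<union> X" using connected_component_subset[of "- \<Gamma>" "pt s x"] \<Gamma>_compl by simp
    then have "X \<inter> ?C = {}"
      using connectedD[OF connected_connected_component[of "- \<Gamma>" "pt s x"] \<open>open V\<close> \<open>open X\<close>] zV mem VX by blast
    with \<open>?C \<subseteq> V \<union> X\<close> have "?C \<subseteq> V" by blast
    moreover have "bounded V"
    proof (rule boundedI)
      fix v assume "v \<in> V"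
      then have "(height v, abscissa v) \<in> sliced_region t0 t1 c w" by (simp add: V_def sliced_region_def)
      then have "\<bar>height v\<bar> \<le> R" "\<bar>abscissa v\<bar> \<le> R" using U by (auto simp: abs_le_iff)
      then have "norm (pt (height v) (abscissa v)) \<le> norm Q + R + R"
        unfolding pt_def using norm_e norm_f
        by (intro order_trans[OF norm_triangle_ineq] add_mono) auto
      then show "norm v \<le> norm Q + R + R" by simp
    qed
    ultimately show "pt s x \<in> inside \<Gamma>"
      using zV VX \<Gamma>_compl unfolding inside_def by (auto intro: bounded_subset)
  }
  {
    assume inside: "pt s x \<in> inside \<Gamma>"
    show "(s, x) \<in> sliced_region t0 t1 c w"
    proof (rule ccontr)
      assume z: "(s, x) \<notin> sliced_region t0 t1 c w"
      have "pt s x \<notin> \<Gamma>" using inside inside_no_overlap by blast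
      moreover have "pt s x \<notin> V" using z by (simp add: V_def sliced_region_def)
      ultimately have zX: "pt s x \<in> X" using \<Gamma>_compl by blast
      \<comment> \<open>the direction pointing away from the centre of the slice\<close>
      define \<sigma> :: real where "\<sigma> = (if c s \<le> x then 1 else - 1)"
      define ray where "ray = (\<lambda>\<tau>. pt s (x + \<tau> * \<sigma>)) ` {0..}"
      have "ray \<subseteq> - \<Gamma>"
      proof
        fix v assume "v \<in> ray"
        then obtain \<tau> where v: "v = pt s (x + \<tau> * \<sigma>)" "0 \<le> \<tau>" by (auto simp: ray_def)
        have "\<bar>x - c s\<bar> \<le> \<bar>x + \<tau> * \<sigma> - c s\<bar>" using v(2) by (auto simp: \<sigma>_def)
        then have "v \<in> X" using zX v by (auto simp: X_def)
        then show "v \<in> - \<Gamma>" using \<Gamma>_compl by simp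
      qed
      moreover have "connected ray"
        unfolding ray_def pt_def by (intro connected_continuous_image continuous_intros convex_connected) auto
      moreover have "pt s x \<in> ray" unfolding ray_def by (rule image_eqI[of _ _ 0]) auto
      ultimately have "ray \<subseteq> connected_component_set (- \<Gamma>) (pt s x)"
        by (intro connected_component_maximal)
      moreover have "\<not> bounded ray"
      proof
        assume "bounded ray"
        then obtain B where B: "\<And>v. v \<in> ray \<Longrightarrow> dist (pt s x) v \<le> B" by (metis bounded_any_center)
        have "pt s (x + (\<bar>B\<bar> + 1) * \<sigma>) \<in> ray" unfolding ray_def by (rule image_eqI[of _ _ "\<bar>B\<bar> + 1"]) auto
        from B[OF this] have "\<bar>(\<bar>B\<bar> + 1) * \<sigma>\<bar> \<le> B" by (simp add: dist_pt)
        moreover have "\<bar>\<sigma>\<bar> = 1" by (simp add: \<sigma>_def)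
        ultimately show False by (simp add: abs_mult)
      qed
      ultimately show False using inside bounded_subset unfolding inside_def by blast
    qed
  }
qed

text \<open>
  The value \<open>K 0\<close> enters the potential only on the null set \<open>y = x\<close>, so \<open>K\<close> may be replaced by
  \<open>planar_kernel K\<close>.
\<close>

lemma potential_pt:
  assumes K: "is_kernel K" and reg: "\<And>s x. pt s x \<in> region N P \<longleftrightarrow> (s, x) \<in> U"
    and [measurable]: "region N P \<in> sets borel"
  shows "potential K N P (pt s x) = planar_potential K U s x"
proof -
  interpret radial_kernel K by unfold_locales (rule K)
  have alt: "K (dist (pt s x) y) = (if dist (pt s x) y = 0 then K 0 else indicator {0<..} (dist (pt s x) y) * K (dist (pt s x) y))" for y
    by simp
  have [measurable]: "(\<lambda>y. K (dist (pt s x) y)) \<in> borel_measurable borel"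
    by (subst alt, intro measurable_If measurable_compose[OF _ kernel_measurable]) measurable
  have "potential K N P (pt s x) = (\<integral>y. indicator (region N P) y * K (dist (pt s x) y) \<partial>distr lborel borel (\<lambda>z. pt (fst z) (snd z)))"
    by (simp add: potential_def set_lebesgue_integral_def distr_pt_lborel)
  also have "\<dots> = (\<integral>z. indicator (region N P) (pt (fst z) (snd z)) * K (dist (pt s x) (pt (fst z) (snd z))) \<partial>lborel)"
    by (subst integral_distr) auto
  also have "\<dots> = planar_potential K U s x"
    unfolding planar_potential_def
  proof (rule integral_cong_AE)
    have ind: "indicator (region N P) (pt (fst z) (snd z)) = indicat_real U z" for z
      using reg[of "fst z" "snd z"] by (auto simp: indicator_def)
    have "U = (\<lambda>z. pt (fst z) (snd z)) -` region N P" using reg by auto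
    then have [measurable]: "U \<in> sets borel" using measurable_sets[OF pt_measurable, of "region N P"] by simp
    show "(\<lambda>z. indicator U z * planar_kernel K (s - fst z) (x - snd z)) \<in> borel_measurable lborel" by measurable
    show "(\<lambda>z. indicator (region N P) (pt (fst z) (snd z)) * K (dist (pt s x) (pt (fst z) (snd z)))) \<in> borel_measurable lborel"
      by (intro borel_measurable_times measurable_compose[OF pt_measurable[folded sets_lborel]]) auto
    have "AE z in lborel. z \<noteq> (s, x)" by (rule AE_lborel_singleton)
    then show "AE z in lborel. indicator (region N P) (pt (fst z) (snd z)) * K (dist (pt s x) (pt (fst z) (snd z))) =
        indicator U z * planar_kernel K (s - fst z) (x - snd z)"
      by eventually_elim (auto simp: ind dist_pt planar_kernel_def)
  qed
  finally show ?thesis .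
qed

end

section \<open>Trapezoids and quadrilaterals in adapted frames\<close>

lemma bounded_integrable_Icc:
  fixes g :: "real \<Rightarrow> real"
  assumes [measurable]: "g \<in> borel_measurable borel" and C: "\<And>s. l \<le> s \<Longrightarrow> s \<le> u \<Longrightarrow> \<bar>g s\<bar> \<le> C"
  shows "integrable lborel (\<lambda>s. indicator {l..u} s * g s)"
proof (rule Bochner_Integration.integrable_bound)
  show "integrable lborel (\<lambda>s. indicator {l..u} s * C)"
    by (intro integrable_mult_left) (cases "l \<le> u"; simp add: integrable_indicator_iff)
  show "AE s in lborel. norm (indicator {l..u} s * g s) \<le> norm (indicator {l..u} s * C)"
    by (intro AE_I2) (auto simp: indicator_def intro: order_trans[OF C])
qed simp

lemma rot90_zero [simp]: "rot90 0 = 0"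
  by (simp add: rot90_def vec_eq_iff forall_2)

lemma orthonormal_frameI:
  assumes "v \<noteq> 0" "e = (1 / norm v) *\<^sub>R v" "f = rot90 e \<or> f = - rot90 e"
  shows "orthonormal_frame e f"
  using assms by unfold_locales auto

lemma closed_segments_closed: "closed (closed_segment A B \<union> closed_segment B C \<union> closed_segment C D \<union> closed_segment D A)"
  for A :: "real^2"
  by (intro closed_Un closed_segment)

lemma (in orthonormal_frame) pt_endpoints:
  assumes "Q = midpoint A B" "B - A = (2 * a) *\<^sub>R e"
  shows "A = pt 0 (- a)" "B = pt 0 a"
proof -
  have ae: "a *\<^sub>R e = (1/2) *\<^sub>R (B - A)" using assms(2) by simp
  have "Q - a *\<^sub>R e = A" "Q + a *\<^sub>R e = B"
    unfolding ae assms(1) by (simp_all add: midpoint_def vec_eq_iff field_simps)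
  then show "A = pt 0 (- a)" "B = pt 0 a" by (simp_all add: pt_def)
qed

context radial_kernel
begin

text \<open>
  The hypothesis \<open>pos\<close> says that the top side is shifted in the direction from \<open>A\<close> to \<open>B\<close>
  relative to the base, so all slices parallel to the base are centred on the same side of its
  perpendicular bisector. The case \<open>C = D\<close> is a triangle.
\<close>

lemma trapezoid_moment_pos:
  fixes A B C D :: "real^2"
  assumes CD: "C - D = \<rho> *\<^sub>R (B - A)" "0 \<le> \<rho>"
    and nd: "orient A B D \<noteq> 0"
    and reg: "region N P = inside (closed_segment A B \<union> closed_segment B C \<union> closed_segment C D \<union> closed_segment D A)"
    and pos: "0 < (C + D - A - B) \<bullet> (B - A)"
  shows "0 < (LINT t : {0..1} | lborel. (t - 1/2) * potential K N P (A + t *\<^sub>R (B - A)))"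
proof -
  define Q where "Q = midpoint A B"
  define a where "a = norm (B - A) / 2"
  define e where "e = (1 / norm (B - A)) *\<^sub>R (B - A)"
  define f where "f = (if 0 < (D - A) \<bullet> rot90 (B - A) then rot90 e else - rot90 e)"
  have AB: "A \<noteq> B" using nd by auto
  interpret orthonormal_frame Q e f
    using AB by (intro orthonormal_frameI[of "B - A"]) (auto simp: e_def f_def)
  have a: "0 < a" using AB by (simp add: a_def)
  have BA: "B - A = (2 * a) *\<^sub>R e" using AB by (simp add: a_def e_def)
  have A: "A = pt 0 (- a)" and B: "B = pt 0 a"
    using pt_endpoints[OF Q_def BA] by blast+
  define h where "h = height D"
  define b where "b = \<rho> * a"
  define p where "p = abscissa D + b"
  have b: "0 \<le> b" using CD(2) a by (simp add: b_def)
  have D: "D = pt h (p - b)" by (simp add: h_def p_def)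
  have C: "C = pt h (p + b)"
  proof -
    have "C = D + \<rho> *\<^sub>R (B - A)" using CD(1) by (simp add: algebra_simps)
    also have "\<rho> *\<^sub>R (B - A) = (2 * b) *\<^sub>R e" by (simp add: BA b_def)
    also have "D = pt h (p - b)" by (rule D)
    also have "pt h (p - b) + (2 * b) *\<^sub>R e = pt h (p + b)"
    proof -
      have "(p - b) *\<^sub>R e + (2 * b) *\<^sub>R e = (p + b) *\<^sub>R e" by (simp flip: scaleR_add_left)
      then show ?thesis by (simp add: pt_def add.assoc add.commute add.left_commute)
    qed
    finally show ?thesis .
  qed
  have h: "0 < h"
  proof -
    have "h = (D - A) \<bullet> f"
      unfolding h_def height_def A by (simp add: pt_def inner_diff_left inner_add_left inner_frame)
    moreover have "(D - A) \<bullet> rot90 (B - A) = 2 * a * ((D - A) \<bullet> rot90 e)"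
    proof -
      have "rot90 (B - A) = (2 * a) *\<^sub>R rot90 e" unfolding BA by (simp add: rot90_def vec_eq_iff forall_2)
      then show ?thesis by simp
    qed
    ultimately show ?thesis using nd a by (auto simp: f_def zero_less_mult_iff mult_less_0_iff linorder_neq_iff split: if_splits)
  qed
  have p: "0 < p"
  proof -
    have "(C + D - A - B) \<bullet> (B - A) = 2 * a * ((C - A) \<bullet> e + (D - B) \<bullet> e)"
      by (simp add: BA algebra_simps)
    also have "(C - A) \<bullet> e + (D - B) \<bullet> e = 2 * p"
      unfolding A B C D by (simp add: pt_def inner_add_left inner_diff_left inner_frame)
    finally have "(C + D - A - B) \<bullet> (B - A) = 4 * a * p" by simp
    then show ?thesis using pos a by (simp add: zero_less_mult_iff)
  qed
  \<comment> \<open>centre and half-width of the slice at height \<open>t\<close>; both are linear since the legs are straight\<close>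
  define c where "c t = p * (t / h)" for t
  define w where "w t = a + (b - a) * (t / h)" for t
  define R where "R = p + a + b + h"
  have cw_cont: "continuous_on UNIV c" "continuous_on UNIV w"
    unfolding c_def w_def by (intro continuous_intros; use h in simp)+
  have cw_meas [measurable]: "c \<in> borel_measurable borel" "w \<in> borel_measurable borel"
    unfolding c_def w_def by measurable
  have w_alt: "w t = a * (1 - t / h) + b * (t / h)" for t by (simp add: w_def algebra_simps add_divide_distrib diff_divide_distrib)
  have w_pos: "0 < w t" if "0 < t" "t < h" for t
    unfolding w_alt using a b that by (intro add_pos_nonneg) auto
  have w_le: "w t \<le> a + b" if "0 < t" "t < h" for t
  proof -
    have "a * (1 - t / h) \<le> a * 1" "b * (t / h) \<le> b * 1" using a b that by (intro mult_left_mono; simp)+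
    then show ?thesis by (simp add: w_alt)
  qed
  have c_bd: "0 < c t" "c t \<le> p" if "0 < t" "t < h" for t
    using p that mult_left_mono[of "t / h" 1 p] by (auto simp: c_def)
  let ?U = "sliced_region 0 h c w"
  have U: "?U \<subseteq> {-R..R} \<times> {-R..R}"
  proof
    fix z assume "z \<in> ?U"
    then have z: "0 < fst z" "fst z < h" "\<bar>snd z - c (fst z)\<bar> < w (fst z)" by (auto simp: sliced_region_def)
    then show "z \<in> {-R..R} \<times> {-R..R}"
      using w_le[OF z(1,2)] c_bd[OF z(1,2)] p a b h by (auto simp: R_def mem_Times_iff)
  qed
  let ?\<Gamma> = "closed_segment A B \<union> closed_segment B C \<union> closed_segment C D \<union> closed_segment D A"
  have \<Gamma>: "pt s x \<in> ?\<Gamma> \<longleftrightarrow> 0 \<le> s \<and> s \<le> h \<and> \<bar>x - c s\<bar> \<le> w s \<and> (s = 0 \<or> s = h \<or> \<bar>x - c s\<bar> = w s)" for s x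
  proof -
    have 1: "pt s x \<in> closed_segment A B \<longleftrightarrow> s = 0 \<and> - a \<le> x \<and> x \<le> a"
      unfolding A B by (rule in_segment_horizontal) (use a in simp)
    have 2: "pt s x \<in> closed_segment B C \<longleftrightarrow> 0 \<le> s \<and> s \<le> h \<and> x = c s + w s"
      unfolding B C using in_segment_graph[OF h] by (simp add: c_def w_def algebra_simps add_divide_distrib diff_divide_distrib)
    have 3: "pt s x \<in> closed_segment C D \<longleftrightarrow> s = h \<and> p - b \<le> x \<and> x \<le> p + b"
      unfolding C D closed_segment_commute[of "pt h (p + b)"] by (rule in_segment_horizontal) (use b in simp)
    have 4: "pt s x \<in> closed_segment D A \<longleftrightarrow> 0 \<le> s \<and> s \<le> h \<and> x = c s - w s"
      unfolding A D closed_segment_commute[of "pt h (p - b)"] using in_segment_graph[OF h] by (simp add: c_def w_def algebra_simps add_divide_distrib diff_divide_distrib)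
    have ends: "c 0 = 0" "w 0 = a" "c h = p" "w h = b" using h by (auto simp: c_def w_def)
    have w0: "0 \<le> w s" if "0 \<le> s" "s \<le> h"
      using that w_pos[of s] ends a b by (cases "s = 0 \<or> s = h") auto
    show ?thesis
      unfolding Un_iff 1 2 3 4 using ends w0 h a b by (auto simp: abs_le_iff abs_if split: if_splits)
  qed
  have "region N P \<in> sets borel"
    unfolding reg by (intro borel_open open_inside closed_segments_closed)
  moreover have "pt s x \<in> region N P \<longleftrightarrow> (s, x) \<in> ?U" for s x
    unfolding reg by (rule inside_eq_sliced_region[OF cw_cont U \<Gamma>])
  ultimately have pot: "potential K N P (pt s x) = planar_potential K ?U s x" for s x
    by (intro potential_pt K)
  define V where "V t = planar_potential K ?U 0 ((2 * t - 1) * a)" for t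
  have V: "potential K N P (A + t *\<^sub>R (B - A)) = V t" for t
    unfolding A B pt_affine pot V_def by (simp add: algebra_simps)
  have [measurable]: "V \<in> borel_measurable borel" unfolding V_def by measurable
  have in_box: "(2 * t - 1) * a \<in> {-R..R}" if "0 \<le> t" "t \<le> 1" for t
  proof -
    have "\<bar>(2 * t - 1) * a\<bar> \<le> 1 * a" unfolding abs_mult using that a by (intro mult_mono) auto
    then show ?thesis using p b h by (auto simp: R_def abs_le_iff)
  qed
  have zero_box: "0 \<in> {-R..R}" using p a b h by (simp add: R_def)
  obtain M where "\<And>x. x \<in> {-R..R} \<Longrightarrow> \<bar>planar_potential K ?U 0 x\<bar> \<le> M"
    using planar_potential_bounded[OF sliced_region_measurable[OF cw_meas] U] zero_box by blast
  then have M: "\<bar>V t\<bar> \<le> M" if "0 \<le> t" "t \<le> 1" for t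
    using in_box[OF that] by (simp add: V_def)
  have M_half: "\<bar>(t - 1/2) * V t\<bar> \<le> M" if "0 \<le> t" "t \<le> 1" for t
    using mult_mono[of "\<bar>t - 1/2\<bar>" 1 "\<bar>V t\<bar>" M] M[OF that] that by (auto simp: abs_mult)
  define g where "g t = indicator {0..1} t * ((t - 1/2) * V t)" for t
  have int: "integrable lborel g"
    unfolding g_def by (rule bounded_integrable_Icc[OF _ M_half]) auto
  then have int': "integrable lborel (\<lambda>t. g (1 - t))"
    using lborel_integrable_real_affine[of g "-1" 1] by simp
  have "(\<integral>t. g t \<partial>lborel) = (\<integral>t. g (1 - t) \<partial>lborel)"
    using lborel_integral_real_affine[of "-1" g 1] by simp
  then have "2 * (\<integral>t. g t \<partial>lborel) = (\<integral>t. g t + g (1 - t) \<partial>lborel)"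
    using int int' by simp
  also have "0 < \<dots>"
  proof (rule integral_pos_if_pos_on)
    have gap: "0 < V t - V (1 - t)" if "1/2 < t" "t \<le> 1" for t
    proof -
      have "planar_potential K ?U 0 (0 - (2 * t - 1) * a) < planar_potential K ?U 0 (0 + (2 * t - 1) * a)"
        using that a in_box[of t] in_box[of "1 - t"]
        by (intro potential_gap_pos[OF cw_meas U zero_box _ _ h _ w_pos c_bd(1)]) (simp_all add: algebra_simps)
      then show ?thesis by (simp add: V_def algebra_simps)
    qed
    have sum: "g t + g (1 - t) = indicator {0..1} t * ((t - 1/2) * (V t - V (1 - t)))" for t
      by (auto simp: g_def indicator_def algebra_simps)
    have nonneg: "0 \<le> (t - 1/2) * (V t - V (1 - t))" if "0 \<le> t" "t \<le> 1" for t
      using gap[of t] gap[of "1 - t"] that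
      by (cases t "1/2::real" rule: linorder_cases) (auto simp: zero_le_mult_iff)
    show "AE t in lborel. 0 \<le> g t + g (1 - t)"
      unfolding sum by (intro AE_I2) (use nonneg in \<open>auto simp: indicator_def\<close>)
    show "AE t in lborel. t \<in> {1/2<..<1} \<longrightarrow> 0 < g t + g (1 - t)"
      unfolding sum by (intro AE_I2) (use gap in \<open>auto simp: indicator_def\<close>)
    show "emeasure lborel {1/2<..<1::real} \<noteq> 0" by simp
  qed (use int int' in auto)
  finally show ?thesis by (simp add: set_lebesgue_integral_def V g_def)
qed

text \<open>
  With \<open>AC\<close> as horizontal axis, the four side integrals are integrals over heights, with weights that are
  linear on each side of \<open>AC\<close> and vanish on it, exactly like the slice centres \<open>c\<close>. The
  hypotheses therefore make the expression in \<open>slice_centers_not_injective\<close> vanish, and \<open>c\<close> cannot be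
  injective above or below \<open>AC\<close>, that is, \<open>B\<close> and \<open>D\<close> have abscissa \<open>0\<close>.
\<close>

lemma separating_diagonal_bisected:
  fixes A B C D :: "real^2"
  assumes opp: "orient A C B * orient A C D < 0"
    and reg: "region N P = inside (closed_segment A B \<union> closed_segment B C \<union> closed_segment C D \<union> closed_segment D A)"
    and weightB: "(LINT t : {0..1} | lborel. t * potential K N P (A + t *\<^sub>R (B - A))) =
      (LINT t : {0..1} | lborel. t * potential K N P (C + t *\<^sub>R (B - C)))"
    and weightD: "(LINT t : {0..1} | lborel. t * potential K N P (A + t *\<^sub>R (D - A))) =
      (LINT t : {0..1} | lborel. t * potential K N P (C + t *\<^sub>R (D - C)))"
  shows "dist A B = dist C B \<and> dist A D = dist C D"
proof -
  define Q where "Q = midpoint A C"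
  define a where "a = norm (C - A) / 2"
  define e where "e = (1 / norm (C - A)) *\<^sub>R (C - A)"
  define f where "f = (if 0 < (B - A) \<bullet> rot90 (C - A) then rot90 e else - rot90 e)"
  have AC: "A \<noteq> C" using opp by auto
  interpret orthonormal_frame Q e f
    using AC by (intro orthonormal_frameI[of "C - A"]) (auto simp: e_def f_def)
  have a: "0 < a" using AC by (simp add: a_def)
  have CA: "C - A = (2 * a) *\<^sub>R e" using AC by (simp add: a_def e_def)
  have A: "A = pt 0 (- a)" and C: "C = pt 0 a"
    using pt_endpoints[OF Q_def CA] by blast+
  define h where "h = height B"
  define k where "k = - height D"
  define p where "p = abscissa B"
  define q where "q = abscissa D"
  have B: "B = pt h p" by (simp add: h_def p_def)
  have D: "D = pt (- k) q" by (simp add: k_def q_def)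
  have h: "0 < h" and k: "0 < k"
  proof -
    have "height X = (X - A) \<bullet> f" for X
      unfolding height_def A by (simp add: pt_def inner_diff_left inner_add_left inner_frame)
    then have eq: "h = (B - A) \<bullet> f" "k = - ((D - A) \<bullet> f)" by (simp_all add: h_def k_def)
    have "rot90 (C - A) = (2 * a) *\<^sub>R rot90 e" unfolding CA by (simp add: rot90_def vec_eq_iff forall_2)
    then have rot: "(X - A) \<bullet> rot90 (C - A) = 2 * a * ((X - A) \<bullet> rot90 e)" for X by simp
    show "0 < h" "0 < k"
      using opp a unfolding eq rot f_def by (auto simp: mult_less_0_iff zero_less_mult_iff split: if_splits)
  qed
  \<comment> \<open>one of the two terms vanishes above and the other below the diagonal, so \<open>c\<close> and \<open>w\<close> are continuous and linear on each part\<close>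
  define c where "c s = p * (max s 0 / h) + q * (max (- s) 0 / k)" for s
  define w where "w s = a * (1 - max s 0 / h - max (- s) 0 / k)" for s
  define R where "R = \<bar>p\<bar> + \<bar>q\<bar> + a + h + k"
  have cw_cont: "continuous_on UNIV c" "continuous_on UNIV w"
    unfolding c_def w_def by (intro continuous_intros; use h k in simp)+
  have cw_meas [measurable]: "c \<in> borel_measurable borel" "w \<in> borel_measurable borel" unfolding c_def w_def by measurable
  have up: "c s = p * (s / h)" "w s = a * (1 - s / h)" if "0 \<le> s" for s
    using that by (simp_all add: c_def w_def)
  have down: "c s = q * (- s / k)" "w s = a * (1 - (- s / k))" if "s \<le> 0" for s
    using that by (simp_all add: c_def w_def max_def)
  have w_pos: "0 < w s" if "- k < s" "s < h" for s
  proof (cases "0 \<le> s")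
    case True
    then show ?thesis using that a h by (simp add: up)
  next
    case False
    then have "- s / k < 1" using that k by (simp add: field_simps)
    then show ?thesis using False a by (simp add: down)
  qed
  have w_nonneg: "0 \<le> w s" if "- k \<le> s" "s \<le> h" for s
    using that w_pos[of s] h k by (cases "s = h \<or> s = - k") (auto simp: up down)
  have cw_le: "\<bar>c s\<bar> + w s \<le> R" if "- k \<le> s" "s \<le> h" for s
  proof (cases "0 \<le> s")
    case True
    have "\<bar>p\<bar> * (s / h) \<le> \<bar>p\<bar> * 1" "a * (1 - s / h) \<le> a * 1" using that True a h by (intro mult_left_mono; simp)+
    then show ?thesis using True h k by (simp add: up R_def abs_mult)
  next
    case False
    then have s: "s \<le> 0" by simp
    have "\<bar>q\<bar> * (- s / k) \<le> \<bar>q\<bar> * 1" using that k by (intro mult_left_mono) (auto simp: field_simps)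
    moreover have "a * (1 - (- s / k)) \<le> a * 1" using s a k by (intro mult_left_mono) (auto simp: field_simps)
    moreover have "\<bar>c s\<bar> = \<bar>q\<bar> * (- s / k)" using s k by (simp add: down abs_mult)
    ultimately show ?thesis using h k by (simp add: down[OF s] R_def)
  qed
  have s_le: "s \<in> {-R..R}" if "- k \<le> s" "s \<le> h" for s using that h k a by (auto simp: R_def)
  let ?U = "sliced_region (- k) h c w"
  have U: "?U \<subseteq> {-R..R} \<times> {-R..R}"
  proof
    fix z assume "z \<in> ?U"
    then have z: "- k \<le> fst z" "fst z \<le> h" "\<bar>snd z - c (fst z)\<bar> < w (fst z)" by (auto simp: sliced_region_def)
    then have "\<bar>snd z\<bar> \<le> R" using cw_le[OF z(1,2)] by linarith
    then show "z \<in> {-R..R} \<times> {-R..R}"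
      using s_le[OF z(1,2)] by (simp add: mem_Times_iff abs_le_iff)
  qed
  let ?\<Gamma> = "closed_segment A B \<union> closed_segment B C \<union> closed_segment C D \<union> closed_segment D A"
  have \<Gamma>: "pt s x \<in> ?\<Gamma> \<longleftrightarrow> - k \<le> s \<and> s \<le> h \<and> \<bar>x - c s\<bar> \<le> w s \<and> (s = - k \<or> s = h \<or> \<bar>x - c s\<bar> = w s)" for s x
  proof -
    have 1: "pt s x \<in> closed_segment A B \<longleftrightarrow> 0 \<le> s \<and> s \<le> h \<and> x = c s - w s"
      unfolding A B using in_segment_graph[OF h] up[of s] by (auto simp: algebra_simps add_divide_distrib diff_divide_distrib)
    have 2: "pt s x \<in> closed_segment B C \<longleftrightarrow> 0 \<le> s \<and> s \<le> h \<and> x = c s + w s"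
      unfolding B C closed_segment_commute[of "pt h p"] using in_segment_graph[OF h] up[of s] by (auto simp: algebra_simps add_divide_distrib diff_divide_distrib)
    have k': "- k < 0" "(s - - k) / (0 - - k) = 1 - (- s / k)" using k by (auto simp: field_simps)
    have 3: "pt s x \<in> closed_segment C D \<longleftrightarrow> - k \<le> s \<and> s \<le> 0 \<and> x = c s + w s"
      unfolding C D closed_segment_commute[of "pt 0 a"] in_segment_graph[OF k'(1)] k'(2) using down[of s] by (auto simp: algebra_simps add_divide_distrib diff_divide_distrib)
    have 4: "pt s x \<in> closed_segment D A \<longleftrightarrow> - k \<le> s \<and> s \<le> 0 \<and> x = c s - w s"
      unfolding A D in_segment_graph[OF k'(1)] k'(2) using down[of s] by (auto simp: algebra_simps add_divide_distrib diff_divide_distrib)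
    have ends: "w (- k) = 0" "w h = 0" using h k by (auto simp: up down)
    show ?thesis
      unfolding Un_iff 1 2 3 4 using ends w_nonneg[of s] h k by (auto simp: abs_if split: if_splits)
  qed
  have "region N P \<in> sets borel"
    unfolding reg by (intro borel_open open_inside closed_segments_closed)
  moreover have "pt s x \<in> region N P \<longleftrightarrow> (s, x) \<in> ?U" for s x
    unfolding reg by (rule inside_eq_sliced_region[OF cw_cont U \<Gamma>])
  ultimately have pot: "potential K N P (pt s x) = planar_potential K ?U s x" for s x
    by (intro potential_pt K)
  let ?v = "planar_potential K ?U"
  obtain M where M: "\<And>s x. s \<in> {-R..R} \<Longrightarrow> x \<in> {-R..R} \<Longrightarrow> \<bar>?v s x\<bar> \<le> M"
    using planar_potential_bounded[OF sliced_region_measurable[OF cw_meas] U] by blast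
  have side_box: "c s + w s \<in> {-R..R}" "c s - w s \<in> {-R..R}" if "- k \<le> s" "s \<le> h" for s
    using cw_le[OF that] w_nonneg[OF that] by (auto simp: abs_if split: if_splits)
  define G where "G s = c s * (?v s (c s + w s) - ?v s (c s - w s))" for s
  have [measurable]: "G \<in> borel_measurable borel" unfolding G_def by measurable
  have G_bd: "\<bar>G s\<bar> \<le> R * (M + M)" if "- k \<le> s" "s \<le> h" for s
  proof -
    have "\<bar>?v s (c s + w s) - ?v s (c s - w s)\<bar> \<le> M + M"
      using M[OF s_le[OF that] side_box(1)[OF that]] M[OF s_le[OF that] side_box(2)[OF that]] by linarith
    moreover have "\<bar>c s\<bar> \<le> R" using cw_le[OF that] w_nonneg[OF that] by linarith
    ultimately show ?thesis unfolding G_def abs_mult by (intro mult_mono) auto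
  qed
  \<comment> \<open>substitution \<open>s = h * t\<close> on the part above the diagonal\<close>
  have half_up: "(\<integral>s. indicator {0..h} s * G s \<partial>lborel) = 0"
  proof -
    have at: "c (h * t) = p * t" "w (h * t) = a * (1 - t)" if "0 \<le> t" for t using that h by (simp_all add: up)
    have box: "h * t \<in> {-R..R}" "p * t + a * (1 - t) \<in> {-R..R}" "p * t - a * (1 - t) \<in> {-R..R}" if "0 \<le> t" "t \<le> 1" for t
    proof -
      have "h * t \<le> h * 1" using that h by (intro mult_left_mono) auto
      then have "- k \<le> h * t" "h * t \<le> h" using that h k by (auto intro: order_trans[of _ 0])
      from s_le[OF this] side_box[OF this] show "h * t \<in> {-R..R}" "p * t + a * (1 - t) \<in> {-R..R}" "p * t - a * (1 - t) \<in> {-R..R}"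
        using that by (simp_all add: at)
    qed
    have i: "integrable lborel (\<lambda>t. indicator {0..1} t * (t * ?v (h * t) (p * t + a * (1 - t))))"
      "integrable lborel (\<lambda>t. indicator {0..1} t * (t * ?v (h * t) (p * t - a * (1 - t))))"
      by (rule bounded_integrable_Icc[where C="1 * M"];
          use M[OF box(1,2)] M[OF box(1,3)] in \<open>auto simp: abs_mult intro!: mult_mono[of _ 1 _ M, simplified]\<close>)+
    have "(\<integral>s. indicator {0..h} s * G s \<partial>lborel) = h * (\<integral>t. indicator {0..h} (h * t) * G (h * t) \<partial>lborel)"
      using lborel_integral_real_affine[of h "\<lambda>s. indicator {0..h} s * G s" 0] h by simp
    also have "(\<integral>t. indicator {0..h} (h * t) * G (h * t) \<partial>lborel) =
      (\<integral>t. p * (indicator {0..1} t * (t * ?v (h * t) (p * t + a * (1 - t))) - indicator {0..1} t * (t * ?v (h * t) (p * t - a * (1 - t)))) \<partial>lborel)"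
    proof (intro Bochner_Integration.integral_cong refl)
      fix t
      have "indicator {0..h} (h * t) = indicat_real {0..1} t"
        using h by (auto simp: indicator_def zero_le_mult_iff)
      moreover have "G (h * t) = (p * t) * (?v (h * t) (p * t + a * (1 - t)) - ?v (h * t) (p * t - a * (1 - t)))" if "0 \<le> t"
        by (simp only: G_def at[OF that])
      ultimately show "indicator {0..h} (h * t) * G (h * t) = p * (indicator {0..1} t * (t * ?v (h * t) (p * t + a * (1 - t))) -
          indicator {0..1} t * (t * ?v (h * t) (p * t - a * (1 - t))))"
        by (cases "0 \<le> t \<and> t \<le> 1") (auto simp: right_diff_distrib mult.assoc)
    qed
    also have "\<dots> = p * ((\<integral>t. indicator {0..1} t * (t * ?v (h * t) (p * t + a * (1 - t))) \<partial>lborel) - (\<integral>t. indicator {0..1} t * (t * ?v (h * t) (p * t - a * (1 - t))) \<partial>lborel))"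
      using i by simp
    also have "(\<integral>t. indicator {0..1} t * (t * ?v (h * t) (p * t + a * (1 - t))) \<partial>lborel) = (LINT t : {0..1} | lborel. t * potential K N P (C + t *\<^sub>R (B - C)))"
      unfolding C B pt_affine pot set_lebesgue_integral_def by (intro Bochner_Integration.integral_cong refl) (simp add: algebra_simps)
    also have "(\<integral>t. indicator {0..1} t * (t * ?v (h * t) (p * t - a * (1 - t))) \<partial>lborel) = (LINT t : {0..1} | lborel. t * potential K N P (A + t *\<^sub>R (B - A)))"
      unfolding A B pt_affine pot set_lebesgue_integral_def by (intro Bochner_Integration.integral_cong refl) (simp add: algebra_simps)
    finally show ?thesis using weightB by simp
  qed
  \<comment> \<open>substitution \<open>s = - k * t\<close> on the part below the diagonal\<close>
  have half_down: "(\<integral>s. indicator {-k..0} s * G s \<partial>lborel) = 0"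
  proof -
    have at: "c (- (k * t)) = q * t" "w (- (k * t)) = a * (1 - t)" if "0 \<le> t" for t using that k by (simp_all add: down)
    have box: "- (k * t) \<in> {-R..R}" "q * t + a * (1 - t) \<in> {-R..R}" "q * t - a * (1 - t) \<in> {-R..R}" if "0 \<le> t" "t \<le> 1" for t
    proof -
      have "k * t \<le> k * 1" using that k by (intro mult_left_mono) auto
      moreover have "0 \<le> k * t" using that k by simp
      ultimately have "- k \<le> - (k * t)" "- (k * t) \<le> h" using h by linarith+
      from s_le[OF this] side_box[OF this] show "- (k * t) \<in> {-R..R}" "q * t + a * (1 - t) \<in> {-R..R}" "q * t - a * (1 - t) \<in> {-R..R}"
        using that by (simp_all add: at)
    qed
    have i: "integrable lborel (\<lambda>t. indicator {0..1} t * (t * ?v (- (k * t)) (q * t + a * (1 - t))))"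
      "integrable lborel (\<lambda>t. indicator {0..1} t * (t * ?v (- (k * t)) (q * t - a * (1 - t))))"
      by (rule bounded_integrable_Icc[where C="1 * M"];
          use M[OF box(1,2)] M[OF box(1,3)] in \<open>auto simp: abs_mult intro!: mult_mono[of _ 1 _ M, simplified]\<close>)+
    have "(\<integral>s. indicator {-k..0} s * G s \<partial>lborel) = k * (\<integral>t. indicator {-k..0} (- (k * t)) * G (- (k * t)) \<partial>lborel)"
      using lborel_integral_real_affine[of "- k" "\<lambda>s. indicator {-k..0} s * G s" 0] k by simp
    also have "(\<integral>t. indicator {-k..0} (- (k * t)) * G (- (k * t)) \<partial>lborel) =
      (\<integral>t. q * (indicator {0..1} t * (t * ?v (- (k * t)) (q * t + a * (1 - t))) - indicator {0..1} t * (t * ?v (- (k * t)) (q * t - a * (1 - t)))) \<partial>lborel)"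
    proof (intro Bochner_Integration.integral_cong refl)
      fix t
      have "indicator {-k..0} (- (k * t)) = indicat_real {0..1} t"
        using k by (auto simp: indicator_def zero_le_mult_iff)
      moreover have "G (- (k * t)) = (q * t) * (?v (- (k * t)) (q * t + a * (1 - t)) - ?v (- (k * t)) (q * t - a * (1 - t)))" if "0 \<le> t"
        by (simp only: G_def at[OF that])
      ultimately show "indicator {-k..0} (- (k * t)) * G (- (k * t)) = q * (indicator {0..1} t * (t * ?v (- (k * t)) (q * t + a * (1 - t))) -
          indicator {0..1} t * (t * ?v (- (k * t)) (q * t - a * (1 - t))))"
        by (cases "0 \<le> t \<and> t \<le> 1") (auto simp: right_diff_distrib mult.assoc)
    qed
    also have "\<dots> = q * ((\<integral>t. indicator {0..1} t * (t * ?v (- (k * t)) (q * t + a * (1 - t))) \<partial>lborel) - (\<integral>t. indicator {0..1} t * (t * ?v (- (k * t)) (q * t - a * (1 - t))) \<partial>lborel))"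
      using i by simp
    also have "(\<integral>t. indicator {0..1} t * (t * ?v (- (k * t)) (q * t + a * (1 - t))) \<partial>lborel) = (LINT t : {0..1} | lborel. t * potential K N P (C + t *\<^sub>R (D - C)))"
      unfolding C D pt_affine pot set_lebesgue_integral_def by (intro Bochner_Integration.integral_cong refl) (simp add: algebra_simps)
    also have "(\<integral>t. indicator {0..1} t * (t * ?v (- (k * t)) (q * t - a * (1 - t))) \<partial>lborel) = (LINT t : {0..1} | lborel. t * potential K N P (A + t *\<^sub>R (D - A)))"
      unfolding A D pt_affine pot set_lebesgue_integral_def by (intro Bochner_Integration.integral_cong refl) (simp add: algebra_simps)
    finally show ?thesis using weightD by simp
  qed
  have zero: "(\<integral>s. indicator {-k<..<h} s * (c s * (?v s (c s + w s) - ?v s (c s - w s))) \<partial>lborel) = 0"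
  proof -
    have "G 0 = 0" "G h = 0" "G (- k) = 0" using h k by (auto simp: G_def up down)
    then have "indicator {-k<..<h} s * G s = indicator {0..h} s * G s + indicator {-k..0} s * G s" for s
      using h k by (cases "s = 0 \<or> s = h \<or> s = - k") (auto simp: indicator_def)
    moreover have "integrable lborel (\<lambda>s. indicator {0..h} s * G s)" "integrable lborel (\<lambda>s. indicator {-k..0} s * G s)"
      by (rule bounded_integrable_Icc[OF _ G_bd]; use h k in auto)+
    ultimately have "(\<integral>s. indicator {-k<..<h} s * G s \<partial>lborel) = 0"
      using half_up half_down by simp
    then show ?thesis by (simp add: G_def)
  qed
  have not_inj: "\<not> inj_on c {\<alpha><..<\<beta>}" if "{\<alpha><..<\<beta>} \<subseteq> {-k<..<h}" "\<alpha> < \<beta>" for \<alpha> \<beta>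
  proof
    assume inj: "inj_on c {\<alpha><..<\<beta>}"
    show False
    proof (rule slice_centers_not_injective[OF cw_meas U _ _ _ that inj zero])
      show "\<bar>s\<bar> \<le> R" if "s \<in> {-k<..<h}" for s using s_le[of s] that by (simp add: abs_le_iff)
      show "\<bar>c s\<bar> + w s \<le> R" if "s \<in> {-k<..<h}" for s using cw_le[of s] that by simp
      show "0 < w s" if "s \<in> {-k<..<h}" for s using w_pos[of s] that by simp
    qed
  qed
  have "p = 0"
  proof (rule ccontr)
    assume "p \<noteq> 0"
    then have "inj_on c {0<..<h}" using h by (auto simp: inj_on_def up)
    moreover have "{0<..<h} \<subseteq> {-k<..<h}" using k by (intro subsetI) auto
    ultimately show False using not_inj[of 0 h] h by blast
  qed
  moreover have "q = 0"
  proof (rule ccontr)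
    assume "q \<noteq> 0"
    then have "inj_on c {-k<..<0}" using k by (auto simp: inj_on_def down)
    moreover have "{-k<..<0} \<subseteq> {-k<..<h}" using h by (intro subsetI) auto
    ultimately show False using not_inj[of "- k" 0] k by auto
  qed
  ultimately show ?thesis by (simp add: A B C D dist_pt)
qed

end

section \<open>Elementary geometry of triangles and quadrilaterals\<close>

lemma orient_components: "orient A B C = (C$2 - A$2) * (B$1 - A$1) - (C$1 - A$1) * (B$2 - A$2)"
  by (simp add: rot90_def inner_vec_def sum_2 algebra_simps)

lemma orient_rotate: "orient A B C = orient B C A"
  unfolding orient_components by (simp add: algebra_simps)

lemma corner_angle_open_segment:
  assumes "B \<in> open_segment A C"
  shows "corner_angle A B C = pi"
proof -
  obtain t where t: "0 < t" "t < 1" "B = (1 - t) *\<^sub>R A + t *\<^sub>R C" and AC: "A \<noteq> C"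
    using assms by (auto simp: in_segment)
  have eqs: "A - B = (- t) *\<^sub>R (C - A)" "C - B = (1 - t) *\<^sub>R (C - A)"
    by (simp_all add: t(3) algebra_simps)
  have n: "norm (C - A) \<noteq> 0" using AC by simp
  have "(A - B) \<bullet> (C - B) / (norm (A - B) * norm (C - B)) = - 1"
    unfolding eqs using t n by (simp add: dot_square_norm power2_eq_square)
  then show ?thesis unfolding corner_angle_def by simp
qed

lemma collinear_if_orient_zero:
  assumes "orient A B C = 0" "A \<noteq> B"
  shows "collinear {A, B, C}"
proof -
  have parallel: "\<exists>c. v = c *\<^sub>R u" if "u \<noteq> 0" "v$2 * u$1 = v$1 * u$2" for u v :: "real^2"
  proof (cases "u$1 = 0")
    case True
    then have u2: "u$2 \<noteq> 0" using that(1) by (auto simp: vec_eq_iff forall_2)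
    then show ?thesis using that(2) True by (intro exI[of _ "v$2 / u$2"]) (auto simp: vec_eq_iff forall_2)
  next
    case False
    then show ?thesis using that(2) by (intro exI[of _ "v$1 / u$1"]) (auto simp: vec_eq_iff forall_2 field_simps)
  qed
  have "\<exists>c. C - A = c *\<^sub>R (B - A)"
    by (rule parallel) (use assms in \<open>simp_all add: orient_components del: eq_iff_diff_eq_0\<close>)
  then have "collinear {0, B - A, C - A}" by (auto simp: collinear_lemma)
  then have "collinear {B, A, C}" by (subst collinear_3) (simp_all add: NO_MATCH_def)
  then show ?thesis by (simp add: insert_commute)
qed

text \<open>
  If three consecutive vertices are collinear, one lies between the other two. If it is the middle one, the
  angle is \<open>\<pi>\<close>; otherwise the two sides overlap.
\<close>

lemma orient_nonzero_at_corner: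
  assumes AB: "A \<noteq> B" and BC: "B \<noteq> C"
    and adj: "closed_segment A B \<inter> closed_segment B C \<subseteq> {B}"
    and angle: "corner_angle A B C \<noteq> pi"
  shows "orient A B C \<noteq> 0"
proof
  assume "orient A B C = 0"
  then have "collinear {A, B, C}" using AB by (rule collinear_if_orient_zero)
  then consider "A \<in> closed_segment B C" | "B \<in> closed_segment C A" | "C \<in> closed_segment A B"
    by (auto simp: collinear_between_cases between_mem_segment)
  then show False
  proof cases
    case 1
    then show False using adj AB by auto
  next
    case 2
    then have "B \<in> open_segment A C" using AB BC by (auto simp: open_segment_def closed_segment_commute)
    then show False using angle corner_angle_open_segment by blast
  next
    case 3
    then show False using adj BC by auto
  qed
qed

text \<open>
  Cramer's rule gives the common point of the two lines. It lies within both segments because the line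
  through each of them separates the end points of the other one.
\<close>

lemma segments_cross:
  assumes "orient A B C * orient A B D < 0" "orient C D A * orient C D B < 0"
  shows "closed_segment A B \<inter> closed_segment C D \<noteq> {}"
proof -
  define \<alpha> where "\<alpha> = orient A B C"
  define \<delta> where "\<delta> = orient A B D"
  define \<beta> where "\<beta> = orient C D A"
  define \<gamma> where "\<gamma> = orient C D B"
  have unit: "0 \<le> x / (x - y) \<and> x / (x - y) \<le> 1 \<and> x - y \<noteq> 0" if "x * y < 0" for x y :: real
    using that by (auto simp: mult_less_0_iff field_simps)
  define u where "u = \<alpha> / (\<alpha> - \<delta>)"
  define t where "t = \<beta> / (\<beta> - \<gamma>)"
  have u: "0 \<le> u" "u \<le> 1" and t: "0 \<le> t" "t \<le> 1" and nz: "\<alpha> - \<delta> \<noteq> 0" "\<beta> - \<gamma> \<noteq> 0"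
    using unit[of \<alpha> \<delta>] unit[of \<beta> \<gamma>] assms by (auto simp: u_def t_def \<alpha>_def \<beta>_def \<gamma>_def \<delta>_def)
  have sum: "\<alpha> - \<delta> = - (\<beta> - \<gamma>)"
    unfolding \<alpha>_def \<beta>_def \<gamma>_def \<delta>_def orient_components by (simp add: algebra_simps)
  then have u': "u = - \<alpha> / (\<beta> - \<gamma>)" unfolding u_def by (metis minus_divide_left minus_divide_right)
  have "A + t *\<^sub>R (B - A) = C + u *\<^sub>R (D - C)"
  proof -
    have id1: "(\<beta> - \<gamma>) * (C$1 - A$1) = \<alpha> * (D$1 - C$1) + \<beta> * (B$1 - A$1)"
      unfolding \<alpha>_def \<beta>_def \<gamma>_def orient_components by (simp add: algebra_simps)
    have id2: "(\<beta> - \<gamma>) * (C$2 - A$2) = \<alpha> * (D$2 - C$2) + \<beta> * (B$2 - A$2)"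
      unfolding \<alpha>_def \<beta>_def \<gamma>_def orient_components by (simp add: algebra_simps)
    have tu: "(\<beta> - \<gamma>) * t = \<beta>" "(\<beta> - \<gamma>) * u = - \<alpha>" using nz by (simp_all add: t_def u')
    have eqI: "x = y" if "(\<beta> - \<gamma>) * x = (\<beta> - \<gamma>) * y" for x y using that nz by simp
    have "A$1 + t * (B$1 - A$1) = C$1 + u * (D$1 - C$1)"
      by (rule eqI, simp only: distrib_left mult.assoc[symmetric] tu) (use id1 in \<open>simp add: algebra_simps\<close>)
    moreover have "A$2 + t * (B$2 - A$2) = C$2 + u * (D$2 - C$2)"
      by (rule eqI, simp only: distrib_left mult.assoc[symmetric] tu) (use id2 in \<open>simp add: algebra_simps\<close>)
    ultimately show ?thesis by (simp add: vec_eq_iff forall_2)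
  qed
  moreover have "A + t *\<^sub>R (B - A) \<in> closed_segment A B" "C + u *\<^sub>R (D - C) \<in> closed_segment C D"
    using t u unfolding closed_segment_param by auto
  ultimately show ?thesis by force
qed

text \<open>
  If neither diagonal separates, then the signs of the oriented triangles \<open>ABC\<close> and
  \<open>CDA\<close> differ, and so do those of \<open>BCD\<close> and \<open>DAB\<close>. In each of the resulting sign
  patterns one pair of opposite sides crosses.
\<close>

lemma simple_quadrilateral_diagonal_separates:
  assumes "orient A B C \<noteq> 0" "orient B C D \<noteq> 0" "orient C D A \<noteq> 0" "orient D A B \<noteq> 0"
    and disj: "closed_segment A B \<inter> closed_segment C D = {}" "closed_segment B C \<inter> closed_segment D A = {}"
  shows "orient A C B * orient A C D < 0 \<or> orient B D C * orient B D A < 0"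
proof (rule ccontr)
  define \<alpha> \<gamma> \<beta> \<delta> where "\<alpha> = orient A B C" and "\<gamma> = orient B C D" and "\<beta> = orient C D A" and "\<delta> = orient D A B"
  have eqs: "orient A C B = - \<alpha>" "orient A C D = \<beta>" "orient B D C = - \<gamma>" "orient B D A = \<delta>"
    "orient A B D = \<delta>" "orient C D B = \<gamma>" "orient B C A = \<alpha>" "orient D A C = \<beta>"
    unfolding \<alpha>_def \<beta>_def \<gamma>_def \<delta>_def orient_components by (simp_all add: algebra_simps)
  assume "\<not> ?thesis"
  then have "\<alpha> * \<beta> \<le> 0" "\<gamma> * \<delta> \<le> 0" unfolding eqs by (auto simp: not_less)
  moreover have nz: "\<alpha> \<noteq> 0" "\<beta> \<noteq> 0" "\<gamma> \<noteq> 0" "\<delta> \<noteq> 0"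
    using assms(1-4) by (simp_all add: \<alpha>_def \<beta>_def \<gamma>_def \<delta>_def)
  ultimately consider "\<alpha> * \<delta> < 0" "\<beta> * \<gamma> < 0" | "\<gamma> * \<alpha> < 0" "\<delta> * \<beta> < 0"
    by (auto simp: mult_le_0_iff mult_less_0_iff not_less le_less)
  then show False
  proof cases
    case 1
    then have "orient A B C * orient A B D < 0" "orient C D A * orient C D B < 0"
      unfolding eqs by (simp_all add: \<alpha>_def \<beta>_def)
    from segments_cross[OF this] disj(1) show False by simp
  next
    case 2
    then have "orient B C D * orient B C A < 0" "orient D A B * orient D A C < 0"
      unfolding eqs by (simp_all add: \<gamma>_def \<delta>_def)
    from segments_cross[OF this] disj(2) show False by simp
  qed
qed

lemma arc_linepath_iff: "arc (linepath a b) \<longleftrightarrow> a \<noteq> b"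
  by (metis arc_linepath arc_distinct_ends pathstart_linepath pathfinish_linepath)

lemma simple_triangle_path:
  assumes "simple_path ((linepath A B +++ linepath B C) +++ linepath C A)"
  shows "A \<noteq> B" "B \<noteq> C" "closed_segment A B \<inter> closed_segment B C \<subseteq> {B}"
  using assms
  by (auto simp: simple_path_join_loop_eq arc_join_eq path_image_join arc_linepath_iff)

lemma simple_quadrilateral_path:
  assumes "simple_path (((linepath A B +++ linepath B C) +++ linepath C D) +++ linepath D A)"
  shows "A \<noteq> B" "B \<noteq> C" "C \<noteq> D" "D \<noteq> A"
    "closed_segment A B \<inter> closed_segment B C \<subseteq> {B}" "closed_segment B C \<inter> closed_segment C D \<subseteq> {C}"
    "closed_segment C D \<inter> closed_segment D A \<subseteq> {D}" "closed_segment D A \<inter> closed_segment A B \<subseteq> {A}"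
    "closed_segment A B \<inter> closed_segment C D = {}" "closed_segment B C \<inter> closed_segment D A = {}"
proof -
  have *: "A \<noteq> B" "B \<noteq> C" "C \<noteq> D" "D \<noteq> A"
    "closed_segment A B \<inter> closed_segment B C \<subseteq> {B}"
    "(closed_segment A B \<union> closed_segment B C) \<inter> closed_segment C D \<subseteq> {C}"
    "(closed_segment A B \<union> closed_segment B C \<union> closed_segment C D) \<inter> closed_segment D A \<subseteq> {A, D}"
    using assms by (auto simp: simple_path_join_loop_eq arc_join_eq path_image_join arc_linepath_iff)
  show "A \<noteq> B" "B \<noteq> C" "C \<noteq> D" "D \<noteq> A" by (fact *)+
  have ends: "A \<in> closed_segment A B" "B \<in> closed_segment A B" "B \<in> closed_segment B C" "C \<in> closed_segment B C"
    "C \<in> closed_segment C D" "D \<in> closed_segment C D" "D \<in> closed_segment D A" "A \<in> closed_segment D A" by auto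
  show AB_BC: "closed_segment A B \<inter> closed_segment B C \<subseteq> {B}" by (fact *)
  show BC_CD: "closed_segment B C \<inter> closed_segment C D \<subseteq> {C}" using * by blast
  show AB_CD: "closed_segment A B \<inter> closed_segment C D = {}" using * ends by blast
  show "closed_segment B C \<inter> closed_segment D A = {}" using * ends by blast
  show "closed_segment C D \<inter> closed_segment D A \<subseteq> {D}" using * ends AB_CD by blast
  show "closed_segment D A \<inter> closed_segment A B \<subseteq> {A}" using * ends AB_CD by blast
qed

text \<open>
  The linear equation of the perpendicular bisector of \<open>AC\<close>.
\<close>

lemma equidistant_iff: "dist A B = dist C B \<longleftrightarrow> 2 * ((B - A) \<bullet> (C - A)) = (C - A) \<bullet> (C - A)"
  for A B C :: "'a::real_inner"
proof -
  have "dist A B = dist C B \<longleftrightarrow> (B - A) \<bullet> (B - A) = (B - C) \<bullet> (B - C)"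
    unfolding dist_norm norm_minus_commute[of A B] norm_minus_commute[of C B] by (rule norm_eq)
  also have "B - C = (B - A) - (C - A)" by simp
  finally show ?thesis by (simp add: inner_diff_left inner_diff_right inner_commute algebra_simps)
qed

text \<open>
  The line \<open>BD\<close> is the perpendicular bisector of \<open>AC\<close>, so it passes between \<open>A\<close> and \<open>C\<close>.
\<close>

lemma bisected_diagonal_separates:
  assumes opp: "orient A C B * orient A C D < 0" and eq: "dist A B = dist C B" "dist A D = dist C D"
  shows "orient B D C * orient B D A < 0"
proof -
  define P1 P2 s where "P1 = orient B D C" and "P2 = orient B D A" and "s = orient A C D - orient A C B"
  have AC: "A \<noteq> C" using opp by auto
  have s: "s \<noteq> 0" using opp by (auto simp: s_def mult_less_0_iff)
  have diff: "P1 - P2 = - s" unfolding P1_def P2_def s_def orient_components by (simp add: algebra_simps)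
  have perp: "(A + C - 2 *\<^sub>R B) \<bullet> (C - A) = 0" "(D - B) \<bullet> (C - A) = 0"
    using eq unfolding equidistant_iff by (simp_all add: algebra_simps inner_commute)
  have cross: "x$1 * y$2 = x$2 * y$1" if "x \<bullet> (C - A) = 0" "y \<bullet> (C - A) = 0" for x y :: "real^2"
  proof -
    let ?u = "C - A"
    have x: "x$1 * ?u$1 + x$2 * ?u$2 = 0" and y: "y$1 * ?u$1 + y$2 * ?u$2 = 0"
      using that by (simp_all add: inner_vec_def sum_2)
    have "?u$1 * (x$1 * y$2 - x$2 * y$1) = 0" "?u$2 * (x$1 * y$2 - x$2 * y$1) = 0"
      using x y by algebra+
    moreover have "?u$1 \<noteq> 0 \<or> ?u$2 \<noteq> 0" using AC by (auto simp: vec_eq_iff forall_2)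
    ultimately show ?thesis by auto
  qed
  have "P1 + P2 = 0"
    using cross[OF perp] unfolding P1_def P2_def orient_components by (simp add: algebra_simps)
  with diff have P12: "P1 = - s / 2" "P2 = s / 2" by linarith+
  have "0 < s * s" using s by (auto simp: zero_less_mult_iff linorder_neq_iff)
  then have "P1 * P2 < 0" unfolding P12 by simp
  then show ?thesis by (simp add: P1_def P2_def)
qed

text \<open>
  The diagonals are orthogonal, and \<open>A + C - B - D\<close> is orthogonal to both of them.
\<close>

lemma rhombus_parallelogram:
  fixes A B C D :: "real^2"
  assumes AC: "A \<noteq> C" and BD: "B \<noteq> D"
    and eq: "dist A B = dist C B" "dist A D = dist C D" "dist B C = dist D C" "dist B A = dist D A"
  shows "C - D = B - A"
proof -
  define z where "z = A + C - B - D"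
  have zu: "z \<bullet> (C - A) = 0" and zw: "z \<bullet> (D - B) = 0" and uw: "(D - B) \<bullet> (C - A) = 0"
    using eq unfolding equidistant_iff z_def by (simp_all add: algebra_simps inner_commute)
  let ?u = "C - A" and ?w = "D - B"
  have zu': "z$1 * ?u$1 + z$2 * ?u$2 = 0" and zw': "z$1 * ?w$1 + z$2 * ?w$2 = 0" and uw': "?w$1 * ?u$1 + ?w$2 * ?u$2 = 0"
    using zu zw uw by (simp_all only: inner_vec_def sum_2 inner_real_def)
  have "?w$1 * ?u$1 = - (?w$2 * ?u$2)" using uw' by linarith
  have det: "?w$1 * ?u$2 - ?w$2 * ?u$1 \<noteq> 0"
  proof
    assume "?w$1 * ?u$2 - ?w$2 * ?u$1 = 0"
    then have "(?w$1 * ?w$1 + ?w$2 * ?w$2) * (?u$1 * ?u$1 + ?u$2 * ?u$2) = 0" using uw' by algebra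
    then have "?w = 0 \<or> ?u = 0" by (auto simp: sum_squares_eq_zero_iff vec_eq_iff forall_2)
    then show False using AC BD by simp
  qed
  have "z$1 * (?w$1 * ?u$2 - ?w$2 * ?u$1) = 0" "z$2 * (?w$1 * ?u$2 - ?w$2 * ?u$1) = 0"
    using zu' zw' by algebra+
  then have "z = 0" using det by (auto simp: vec_eq_iff forall_2)
  then show ?thesis by (simp add: z_def algebra_simps)
qed

section \<open>Consequences of the boundary conditions\<close>

context radial_kernel
begin

text \<open>
  In the chart given by the coordinate axes the potential is a planar potential of a bounded set, which is
  bounded on every box.
\<close>

lemma potential_measurable_integrable:
  assumes [measurable]: "region N P \<in> sets borel" and bd: "bounded (region N P)"
  shows "potential K N P \<in> borel_measurable borel"
    and "set_integrable lborel {0..1} (\<lambda>t. potential K N P (A + t *\<^sub>R (B - A)))"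
proof -
  interpret orthonormal_frame 0 "axis 1 1" "rot90 (axis 1 1)" by unfold_locales simp_all
  define U where "U = (\<lambda>z. pt (fst z) (snd z)) -` region N P"
  have [measurable]: "U \<in> sets borel" using measurable_sets[OF pt_measurable assms(1)] by (simp add: U_def)
  have pot: "potential K N P z = planar_potential K U (height z) (abscissa z)" for z
    using potential_pt[OF K, of N P U "height z" "abscissa z"] by (simp add: U_def)
  have cont: "continuous_on UNIV height" "continuous_on UNIV abscissa"
    using continuous_height[of UNIV "\<lambda>z. z"] continuous_abscissa[of UNIV "\<lambda>z. z"] by (auto simp: continuous_on_id)
  have [measurable]: "height \<in> borel_measurable borel" "abscissa \<in> borel_measurable borel"
    by (intro borel_measurable_continuous_onI cont)+
  have [measurable]: "(\<lambda>t. A + t *\<^sub>R (B - A)) \<in> borel_measurable borel"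
    by (intro borel_measurable_continuous_onI continuous_intros)
  show meas: "potential K N P \<in> borel_measurable borel" unfolding pot[abs_def] by measurable
  obtain r where r: "\<And>z. z \<in> region N P \<Longrightarrow> norm z \<le> r" using bd by (auto simp: bounded_iff)
  have coord_le: "\<bar>height z\<bar> \<le> norm z" "\<bar>abscissa z\<bar> \<le> norm z" for z
    using Cauchy_Schwarz_ineq2[of z "rot90 (axis 1 1)"] Cauchy_Schwarz_ineq2[of z "axis 1 1"] norm_f norm_e
    by (auto simp: height_def abscissa_def)
  define R where "R = \<bar>r\<bar> + norm A + norm B"
  have U: "U \<subseteq> {-R..R} \<times> {-R..R}"
  proof
    fix z assume "z \<in> U"
    then have n: "norm (pt (fst z) (snd z)) \<le> r" using r by (simp add: U_def)
    have "\<bar>fst z\<bar> \<le> r" "\<bar>snd z\<bar> \<le> r"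
      using coord_le[of "pt (fst z) (snd z)"] n by simp_all
    moreover have "r \<le> R" by (simp add: R_def add.assoc abs_ge_self add_increasing2)
    ultimately have "\<bar>fst z\<bar> \<le> R" "\<bar>snd z\<bar> \<le> R" by linarith+
    then show "z \<in> {-R..R} \<times> {-R..R}" by (simp add: mem_Times_iff abs_le_iff)
  qed
  obtain M where M: "\<And>s x. s \<in> {-R..R} \<Longrightarrow> x \<in> {-R..R} \<Longrightarrow> \<bar>planar_potential K U s x\<bar> \<le> M"
    using planar_potential_bounded[OF \<open>U \<in> sets borel\<close> U] by blast
  show "set_integrable lborel {0..1} (\<lambda>t. potential K N P (A + t *\<^sub>R (B - A)))"
    unfolding set_integrable_def real_scaleR_def
  proof (rule bounded_integrable_Icc)
    show "(\<lambda>t. potential K N P (A + t *\<^sub>R (B - A))) \<in> borel_measurable borel" using meas by measurable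
    fix t :: real assume t: "0 \<le> t" "t \<le> 1"
    let ?z = "A + t *\<^sub>R (B - A)"
    have "?z = (1 - t) *\<^sub>R A + t *\<^sub>R B" by (simp add: algebra_simps)
    also have "norm \<dots> \<le> norm ((1 - t) *\<^sub>R A) + norm (t *\<^sub>R B)" by (rule norm_triangle_ineq)
    also have "\<dots> \<le> norm A + norm B"
      using t by (intro add_mono) (auto intro!: mult_left_le_one_le)
    finally have "norm ?z \<le> R" by (simp add: R_def)
    then have "\<bar>height ?z\<bar> \<le> R" "\<bar>abscissa ?z\<bar> \<le> R" using coord_le[of ?z] by linarith+
    then show "\<bar>potential K N P ?z\<bar> \<le> M" unfolding pot by (intro M) (auto simp: abs_le_iff)
  qed
qed

lemma polygon_region_borel_bounded:
  assumes "is_polygon N P"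
  shows "region N P \<in> sets borel" "bounded (region N P)"
proof -
  have "compact (path_image (boundary_path N P))"
    using assms by (auto simp: is_polygon_def intro: compact_simple_path_image)
  then show "region N P \<in> sets borel" "bounded (region N P)"
    unfolding region_def
    by (simp_all add: borel_open open_inside bounded_inside compact_imp_closed compact_imp_bounded)
qed

lemma balanced_side:
  assumes P: "is_polygon N P" "balanced_moments K N P" and i: "i \<in> {1..N}" and ne: "P i \<noteq> P (i + 1)"
  shows "(LINT t : {0..1} | lborel. (t - 1/2) * potential K N P (P i + t *\<^sub>R (P (i + 1) - P i))) = 0"
    and "(LINT t : {0..1} | lborel. (t - 1/2) * potential K N P (P (i + 1) + t *\<^sub>R (P i - P (i + 1)))) = 0"
proof -
  note reg = potential_measurable_integrable[OF polygon_region_borel_bounded[OF P(1)]]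
  have bal: "(LINT x : closed_segment (P i) (midpoint (P i) (P (i + 1))) | hausdorff1. potential K N P x * dist x (midpoint (P i) (P (i + 1)))) =
        (LINT x : closed_segment (P (i + 1)) (midpoint (P i) (P (i + 1))) | hausdorff1. potential K N P x * dist x (midpoint (P i) (P (i + 1))))"
    using P(2) i by (simp add: balanced_moments_def side_midpoint_def)
  show "(LINT t : {0..1} | lborel. (t - 1/2) * potential K N P (P i + t *\<^sub>R (P (i + 1) - P i))) = 0"
    by (rule first_moment_zero_if_balanced[OF reg(1) ne reg(2) bal])
  show "(LINT t : {0..1} | lborel. (t - 1/2) * potential K N P (P (i + 1) + t *\<^sub>R (P i - P (i + 1)))) = 0"
    by (rule first_moment_zero_if_balanced[OF reg(1) ne[symmetric] reg(2)]) (unfold midpoint_sym[of "P (i + 1)"], rule bal[symmetric])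
qed

text \<open>
  Balance says that the mean of the parameter \<open>t\<close> with respect to \<open>v\<close> is \<open>1/2\<close>, so weighting by
  \<open>t\<close> halves the average \<open>m\<close>. The value is the same for both directions of the side.
\<close>

lemma linear_weight_integral_side:
  assumes P: "is_polygon N P" "balanced_moments K N P" and i: "i \<in> {1..N}" and ne: "P i \<noteq> P (i + 1)"
  defines "m \<equiv> 1 / side_length P i * (LINT x : closed_segment (P i) (P (i + 1)) | hausdorff1. potential K N P x)"
  shows "(LINT t : {0..1} | lborel. t * potential K N P (P i + t *\<^sub>R (P (i + 1) - P i))) = m / 2"
    and "(LINT t : {0..1} | lborel. t * potential K N P (P (i + 1) + t *\<^sub>R (P i - P (i + 1)))) = m / 2"
proof -
  note reg = potential_measurable_integrable[OF polygon_region_borel_bounded[OF P(1)]]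
  have weight: "(LINT t : {0..1} | lborel. t * potential K N P (A + t *\<^sub>R (B - A))) = m / 2"
    if AB: "A \<noteq> B" "m = 1 / dist A B * (LINT x : closed_segment A B | hausdorff1. potential K N P x)"
      and bal: "(LINT t : {0..1} | lborel. (t - 1/2) * potential K N P (A + t *\<^sub>R (B - A))) = 0" for A B
  proof -
    define V where "V t = potential K N P (A + t *\<^sub>R (B - A))" for t
    have V: "integrable lborel (\<lambda>t. indicator {0..1} t * V t)"
      using reg(2)[of A B] by (simp add: set_integrable_def V_def)
    have tV: "integrable lborel (\<lambda>t. indicator {0..1} t * (t * V t))"
    proof (rule Bochner_Integration.integrable_bound[OF V])
      have [measurable]: "V \<in> borel_measurable borel"
        unfolding V_def
        by (rule measurable_compose[OF _ reg(1)]) (intro borel_measurable_continuous_onI continuous_intros)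
      show "(\<lambda>t. indicator {0..1} t * (t * V t)) \<in> borel_measurable lborel" by measurable
      show "AE t in lborel. norm (indicator {0..1} t * (t * V t)) \<le> norm (indicator {0..1} t * V t)"
        by (intro AE_I2) (auto simp: abs_mult indicator_def intro!: mult_left_le_one_le)
    qed
    have m: "m = (\<integral>t. indicator {0..1} t * V t \<partial>lborel)"
      using AB LINT_hausdorff1_segment[OF reg(1), of A B] by (simp add: set_lebesgue_integral_def V_def)
    have "0 = (\<integral>t. indicator {0..1} t * (t * V t) - (1/2) * (indicator {0..1} t * V t) \<partial>lborel)"
      using bal unfolding set_lebesgue_integral_def V_def by (simp add: algebra_simps)
    also have "\<dots> = (\<integral>t. indicator {0..1} t * (t * V t) \<partial>lborel) - m / 2"
      using V tV by (simp add: m)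
    finally show ?thesis by (simp add: set_lebesgue_integral_def V_def)
  qed
  show "(LINT t : {0..1} | lborel. t * potential K N P (P i + t *\<^sub>R (P (i + 1) - P i))) = m / 2"
    by (rule weight[OF ne _ balanced_side(1)[OF P i ne]]) (simp add: m_def side_length_def)
  show "(LINT t : {0..1} | lborel. t * potential K N P (P (i + 1) + t *\<^sub>R (P i - P (i + 1)))) = m / 2"
    by (rule weight[OF ne[symmetric] _ balanced_side(2)[OF P i ne]])
      (simp add: m_def side_length_def dist_commute closed_segment_commute)
qed

text \<open>
  If the top side were shifted to one side relative to the base, the first moment would be positive in one of
  the two directions of the base.
\<close>

lemma balanced_trapezoid_isosceles:
  fixes A B C D :: "real^2"
  assumes CD: "C - D = \<rho> *\<^sub>R (B - A)" "0 \<le> \<rho>" and nd: "orient A B D \<noteq> 0"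
    and reg: "region N P = inside (closed_segment A B \<union> closed_segment B C \<union> closed_segment C D \<union> closed_segment D A)"
    and bal: "(LINT t : {0..1} | lborel. (t - 1/2) * potential K N P (A + t *\<^sub>R (B - A))) = 0"
      "(LINT t : {0..1} | lborel. (t - 1/2) * potential K N P (B + t *\<^sub>R (A - B))) = 0"
  shows "(C + D - A - B) \<bullet> (B - A) = 0"
proof (rule ccontr)
  assume "(C + D - A - B) \<bullet> (B - A) \<noteq> 0"
  then consider "0 < (C + D - A - B) \<bullet> (B - A)" | "0 < (D + C - B - A) \<bullet> (A - B)"
    by (auto simp: algebra_simps linorder_neq_iff)
  then show False
  proof cases
    case 1
    from trapezoid_moment_pos[OF CD nd reg this] bal(1) show False by simp
  next
    case 2
    have CD': "D - C = \<rho> *\<^sub>R (A - B)" using CD(1) by (simp add: algebra_simps)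
    have C: "C = D + \<rho> *\<^sub>R (B - A)" using CD(1) by (simp add: algebra_simps)
    have "orient B A C = - orient A B D"
      unfolding orient_components C by (simp add: algebra_simps)
    then have nd': "orient B A C \<noteq> 0" using nd by simp
    have reg': "region N P = inside (closed_segment B A \<union> closed_segment A D \<union> closed_segment D C \<union> closed_segment C B)"
      unfolding reg by (simp add: closed_segment_commute Un_ac)
    from trapezoid_moment_pos[OF CD' CD(2) nd' reg' 2] bal(2) show False by simp
  qed
qed

lemma triangle_isosceles:
  assumes nd: "orient A B C \<noteq> 0"
    and reg: "region N P = inside (closed_segment A B \<union> closed_segment B C \<union> closed_segment C A)"
    and bal: "(LINT t : {0..1} | lborel. (t - 1/2) * potential K N P (A + t *\<^sub>R (B - A))) = 0"
      "(LINT t : {0..1} | lborel. (t - 1/2) * potential K N P (B + t *\<^sub>R (A - B))) = 0"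
  shows "dist A C = dist B C"
proof -
  have "closed_segment A B \<union> closed_segment B C \<union> closed_segment C C \<union> closed_segment C A =
      closed_segment A B \<union> closed_segment B C \<union> closed_segment C A" by auto
  then have "(C + C - A - B) \<bullet> (B - A) = 0"
    using reg by (intro balanced_trapezoid_isosceles[where \<rho>=0, OF _ _ nd _ bal]) auto
  also have "C + C - A - B = (C - A) + (C - A) - (B - A)" by simp
  finally show ?thesis unfolding equidistant_iff by (simp only: inner_add_left inner_diff_left) simp
qed

text \<open>
  The first diagonal is bisected; then the second one separates as well and is bisected in turn.
\<close>

lemma separated_quadrilateral_equilateral:
  fixes A B C D :: "real^2"
  assumes opp: "orient A C B * orient A C D < 0"
    and reg: "region N P = inside (closed_segment A B \<union> closed_segment B C \<union> closed_segment C D \<union> closed_segment D A)"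
    and weight: "\<And>X Y. (X, Y) \<in> {(A, B), (B, A), (B, C), (C, B), (C, D), (D, C), (D, A), (A, D)} \<Longrightarrow>
      (LINT t : {0..1} | lborel. t * potential K N P (X + t *\<^sub>R (Y - X))) = m"
  shows "dist A B = dist C B" "dist A D = dist C D" "dist B C = dist D C" "dist B A = dist D A"
proof -
  show *: "dist A B = dist C B" "dist A D = dist C D"
    using separating_diagonal_bisected[OF opp reg] weight by simp_all
  have reg': "region N P = inside (closed_segment B C \<union> closed_segment C D \<union> closed_segment D A \<union> closed_segment A B)"
    unfolding reg by (simp add: Un_ac)
  show "dist B C = dist D C" "dist B A = dist D A"
    using separating_diagonal_bisected[OF bisected_diagonal_separates[OF opp *] reg'] weight by simp_all
qed

end

theorem theorem1p2:
  fixes K :: "real \<Rightarrow> real"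
  assumes "is_kernel K"
  shows "(\<forall>P. is_polygon 3 P \<and> balanced_moments K 3 P \<longrightarrow> is_equilateral_triangle P) \<and>
         (\<forall>P. is_polygon 4 P \<and> balanced_moments K 4 P \<and> equal_side_averages K 4 P \<longrightarrow> is_square P)"
proof (intro conjI allI impI)
  interpret radial_kernel K by unfold_locales (rule assms)
  {
    fix P assume P: "is_polygon 3 P \<and> balanced_moments K 3 P"
    then have poly: "is_polygon 3 P" and bal: "balanced_moments K 3 P" by simp_all
    define A B C where "A = P 1" and "B = P 2" and "C = P 3"
    have PN: "P 0 = C" "P 4 = A" using poly by (simp_all add: is_polygon_def A_def C_def)
    have path: "boundary_path 3 P = (linepath A B +++ linepath B C) +++ linepath C A"
      using PN by (simp add: boundary_path_def numeral_2_eq_2 A_def B_def C_def eval_nat_numeral)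
    have simple: "simple_path ((linepath A B +++ linepath B C) +++ linepath C A)"
      using poly unfolding is_polygon_def path by blast
    note tri = simple_triangle_path[OF simple]
    have "corner_angle A B C \<noteq> pi"
      using poly unfolding is_polygon_def A_def B_def C_def by (auto dest!: bspec[of _ _ 2])
    then have nd: "orient A B C \<noteq> 0" by (intro orient_nonzero_at_corner tri)
    then have CA: "C \<noteq> A" by auto
    have reg: "region 3 P = inside (closed_segment A B \<union> closed_segment B C \<union> closed_segment C A)"
      by (simp add: region_def path path_image_join)
    have "dist A C = dist B C"
      using triangle_isosceles[OF nd reg] balanced_side[OF poly bal, of 1] tri
      by (simp add: A_def B_def eval_nat_numeral)
    moreover have "dist B A = dist C A"
    proof (rule triangle_isosceles)
      show "orient B C A \<noteq> 0" using nd orient_rotate[where A=A and B=B and C=C] by metis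
      show "region 3 P = inside (closed_segment B C \<union> closed_segment C A \<union> closed_segment A B)"
        using reg by (simp add: Un_ac)
    qed (use balanced_side[OF poly bal, of 2] tri in \<open>simp_all add: C_def B_def eval_nat_numeral\<close>)
    ultimately have "side_length P i = dist A B" if "i \<in> {1..3}" for i
    proof -
      have "i = 1 \<or> i = 2 \<or> i = 3" using that by auto
      then show ?thesis
        using \<open>dist A C = dist B C\<close> \<open>dist B A = dist C A\<close> PN
        by (auto simp: side_length_def A_def B_def C_def dist_commute eval_nat_numeral)
    qed
    then show "is_equilateral_triangle P" using poly by (simp add: is_equilateral_triangle_def)
  }
  {
    fix P assume P: "is_polygon 4 P \<and> balanced_moments K 4 P \<and> equal_side_averages K 4 P"
    then have poly: "is_polygon 4 P" and bal: "balanced_moments K 4 P" and avg: "equal_side_averages K 4 P" by simp_all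
    define A B C D where "A = P 1" and "B = P 2" and "C = P 3" and "D = P 4"
    have PN: "P 0 = D" "P 5 = A" using poly by (simp_all add: is_polygon_def A_def D_def)
    have path: "boundary_path 4 P = ((linepath A B +++ linepath B C) +++ linepath C D) +++ linepath D A"
      using PN by (simp add: boundary_path_def A_def B_def C_def D_def eval_nat_numeral)
    have simple: "simple_path (((linepath A B +++ linepath B C) +++ linepath C D) +++ linepath D A)"
      using poly unfolding is_polygon_def path by blast
    note quad = simple_quadrilateral_path[OF simple]
    \<comment> \<open>the cyclic index conventions, resolved once for all four sides\<close>
    have nums: "1 + 1 = (2::nat)" "2 + 1 = (3::nat)" "3 + 1 = (4::nat)" "4 + 1 = (5::nat)"
      "1 - 1 = (0::nat)" "2 - 1 = (1::nat)" "3 - 1 = (2::nat)" "4 - 1 = (3::nat)" by simp_all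
    have idx: "P (1 + 1) = B" "P (2 + 1) = C" "P (3 + 1) = D" "P (4 + 1) = A"
      "P (1 - 1) = D" "P (2 - 1) = A" "P (3 - 1) = B" "P (4 - 1) = C"
      "P 1 = A" "P 2 = B" "P 3 = C" "P 4 = D"
      by (simp_all only: nums PN A_def B_def C_def D_def)
    have angles: "corner_angle (P (i - 1)) (P i) (P (i + 1)) \<noteq> pi" if "i \<in> {1..4}" for i
      using poly that by (simp add: is_polygon_def)
    have ang: "corner_angle A B C \<noteq> pi" "corner_angle B C D \<noteq> pi" "corner_angle C D A \<noteq> pi" "corner_angle D A B \<noteq> pi"
      using angles[of 2] angles[of 3] angles[of 4] angles[of 1] unfolding idx by simp_all
    have nd: "orient A B C \<noteq> 0" "orient B C D \<noteq> 0" "orient C D A \<noteq> 0" "orient D A B \<noteq> 0"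
      by (rule orient_nonzero_at_corner[OF quad(1,2,5) ang(1)] orient_nonzero_at_corner[OF quad(2,3,6) ang(2)]
          orient_nonzero_at_corner[OF quad(3,4,7) ang(3)] orient_nonzero_at_corner[OF quad(4,1,8) ang(4)])+
    have reg: "region 4 P = inside (closed_segment A B \<union> closed_segment B C \<union> closed_segment C D \<union> closed_segment D A)"
      by (simp add: region_def path path_image_join)
    define m where "m i = 1 / side_length P i * (LINT x : closed_segment (P i) (P (i + 1)) | hausdorff1. potential K 4 P x)" for i
    have m: "m i = m 1" if "i \<in> {1..4}" for i
    proof -
      have "\<forall>i\<in>{1..4}. \<forall>j\<in>{1..4}. m i = m j" using avg unfolding equal_side_averages_def m_def .
      moreover have "1 \<in> {1..4::nat}" by simp
      ultimately show ?thesis using that by blast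
    qed
    have ne: "P i \<noteq> P (i + 1)" if "i \<in> {1..4}" for i
    proof -
      have "i = 1 \<or> i = 2 \<or> i = 3 \<or> i = 4" using that by auto
      then show ?thesis by (elim disjE) (simp_all only: idx quad(1-4) not_False_eq_True)
    qed
    have weights: "(LINT t : {0..1} | lborel. t * potential K 4 P (P i + t *\<^sub>R (P (i + 1) - P i))) = m 1 / 2"
      "(LINT t : {0..1} | lborel. t * potential K 4 P (P (i + 1) + t *\<^sub>R (P i - P (i + 1)))) = m 1 / 2" if "i \<in> {1..4}" for i
      using linear_weight_integral_side[OF poly bal that ne[OF that]] m[OF that] by (simp_all add: m_def)
    have weight: "(LINT t : {0..1} | lborel. t * potential K 4 P (X + t *\<^sub>R (Y - X))) = m 1 / 2"
      if "(X, Y) \<in> {(A, B), (B, A), (B, C), (C, B), (C, D), (D, C), (D, A), (A, D)}" for X Y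
      using that weights[of 1, unfolded idx] weights[of 2, unfolded idx] weights[of 3, unfolded idx] weights[of 4, unfolded idx]
      by auto
    have eq: "dist A B = dist C B \<and> dist A D = dist C D \<and> dist B C = dist D C \<and> dist B A = dist D A"
      using simple_quadrilateral_diagonal_separates[OF nd quad(9,10)]
    proof
      assume "orient A C B * orient A C D < 0"
      from separated_quadrilateral_equilateral[OF this reg weight] show ?thesis by simp
    next
      assume *: "orient B D C * orient B D A < 0"
      have reg': "region 4 P = inside (closed_segment B C \<union> closed_segment C D \<union> closed_segment D A \<union> closed_segment A B)"
        unfolding reg by (simp add: Un_ac)
      have "dist B C = dist D C" "dist B A = dist D A" "dist C D = dist A D" "dist C B = dist A B"
        by (rule separated_quadrilateral_equilateral[OF * reg', of "m 1 / 2"]; rule weight; auto)+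
      then show ?thesis by simp
    qed
    have "A \<noteq> C" "B \<noteq> D" using nd by auto
    then have par: "C - D = B - A" by (rule rhombus_parallelogram) (use eq in simp_all)
    have "orient A B D \<noteq> 0" using nd(4) orient_rotate[where A=D and B=A and C=B] by simp
    then have "(C + D - A - B) \<bullet> (B - A) = 0"
      using balanced_trapezoid_isosceles[where \<rho>=1, OF _ _ _ reg] par balanced_side[OF poly bal, of 1, unfolded idx] quad(1)
      by simp
    moreover have C: "C = B + D - A" using par by (simp add: algebra_simps)
    have "C + D - A - B = (D - A) + (D - A)" unfolding C by simp
    ultimately have "(D - A) \<bullet> (B - A) + (D - A) \<bullet> (B - A) = 0" by (simp only: inner_add_left)
    then have right: "(B - A) \<bullet> (D - A) = 0" by (simp add: inner_commute)
    have sides: "side_length P i = dist A B" if "i \<in> {1..4}" for i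
    proof -
      have "i = 1 \<or> i = 2 \<or> i = 3 \<or> i = 4" using that by auto
      then show ?thesis
        using eq by (elim disjE) (simp_all only: side_length_def idx, simp_all add: dist_commute)
    qed
    have "corner_angle (P (i - 1)) (P i) (P (i + 1)) = pi / 2" if "i \<in> {1..4}" for i
    proof -
      have "(D - A) \<bullet> (B - A) = 0" "(A - B) \<bullet> (C - B) = 0" "(B - C) \<bullet> (D - C) = 0" "(C - D) \<bullet> (A - D) = 0"
        using right unfolding C by (simp_all add: algebra_simps inner_commute)
      moreover have "i = 1 \<or> i = 2 \<or> i = 3 \<or> i = 4" using that by auto
      ultimately show ?thesis
        by (elim disjE) (simp_all only: corner_angle_def idx, simp_all add: arccos_0)
    qed
    then show "is_square P" using poly sides by (simp add: is_square_def)
  }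
qed

end
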